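(* Let $(H_t)_{t\in(0,\infty)}$ be the product system built from the zero/level sets of Brownian motion, $H_t=L_2(\mathcal C_t,\mathcal B_t,\mathcal P_t)$, and let $(v_t)_{t\in(0,\infty)}$ be its special unit corresponding to the atom $\{\emptyset\}$ (both defined in the context). Then every unit $(u_t)_{t\in(0,\infty)}$ of the product system $(H_t)$ is of the form $u_t=e^{i\lambda t}v_t$ for all $t\in(0,\infty)$, for some $\lambda\in\mathbb C$.
   Context: Hilbert spaces are complex. $\mu\sim\nu$ means that the measures $\mu,\nu$ are mutually absolutely continuous. Spaces of closed sets. For $t\in(0,\infty)$, $\mathcal C_t$ is the set of all closed subsets of $[0,t]$ (including $\emptyset$), a compact metrizable space under the Hausdorff metric (with $\emptyset$ an isolated point), and $\mathcal B_t$ is its Borel $\sigma$-field. Measure types. Let $B$ be the standard Brownian motion in $\mathbb R$ (started at $0$). For $a,t\in(0,\infty)$ let $P_{t,a}$ be the law on $(\mathcal C_t,\mathcal B_t)$ of the random set $Z_{t,a}=\{s\in[0,t]:B(s)=a\}$. For fixed $t$ the measures $P_{t,a}$, $a\in(0,\infty)$, are mutually equivalent. $\mathcal P_t$ is the set of all probability measures on $(\mathcal C_t,\mathcal B_t)$ equivalent to $P_{t,a}$ for some (hence all) $a\in(0,\infty)$. Every $P\in\mathcal P_t$ satisfies $P(\{\emptyset\})>0$. Hilbert spaces. $H_t=L_2(\mathcal C_t,\mathcal B_t,\mathcal P_t)$ is the Hilbert space of families $\psi=(\psi_P)_{P\in\mathcal P_t}$ with $\psi_P\in L_2(\mathcal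 C_t,\mathcal B_t,P)$ and $\psi_{P_2}=\sqrt{dP_1/dP_2}\,\psi_{P_1}$ for all $P_1,P_2\in\mathcal P_t$; its inner product is $\langle\psi,\phi\rangle=\int\psi_P\overline{\phi_P}\,dP$ (independent of $P\in\mathcal P_t$). Multiplication. For $P_1\in\mathcal P_s$, $P_2\in\mathcal P_t$ let $P_1\otimes P_2$ be the law of $C_1\cup(C_2+s)$ where $C_1\sim P_1$, $C_2\sim P_2$ are independent; it belongs to $\mathcal P_{s+t}$, and up to null sets $(C_1,C_2)\mapsto C_1\cup(C_2+s)$ is an isomorphism. This gives a natural unitary identification $H_s\otimes H_t=H_{s+t}$, namely $(\psi_1\otimes\psi_2)_{P_1\otimes P_2}(C_1\cup(C_2+s))=(\psi_1)_{P_1}(C_1)\,(\psi_2)_{P_2}(C_2)$. Borel structure. For $t>0$ let $R_t:\mathcal C_1\to\mathcal C_t$, $R_t(C)=t\cdot C$; it sends $\mathcal P_1$ to $\mathcal P_t$. Let $\tilde R_t:H_1\to H_t$ be the unitary operator $(\tilde R_t\psi)_{R_t(P)}(R_t(C))=\psi_P(C)$, where $R_t(P)=P\circ R_t^{-1}$, $P\in\mathcal P_1$. The disjoint union $\bigcup_{t>0}H_t$ carries the Borel structure transported from $(0,\infty)\times H_1$ by $(t,\psi)\mapsto\tilde R_t\psi$. With these structures $(H_t)_{t\in(0,\infty)}$ is a product system in the sense of Arveson. Units. A unit of a product system $(H_t)$ is a family $(u_t)_{t\in(0,\infty)}$ with $u_t\in H_t$, $u_s\otimes u_t=u_{s+t}$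 for all $s,t\in(0,\infty)$, such that $t\mapsto u_t\in\bigcup_tH_t$ is measurable and $u_t\ne0$ for some $t$ (equivalently, for all $t$). Special unit. $v_t\in H_t$ is defined by $(v_t)_P(C)=1/\sqrt{P(\{\emptyset\})}$ if $C=\emptyset$ and $(v_t)_P(C)=0$ otherwise, for $P\in\mathcal P_t$. *)

theory Defs
  imports "HOL-Probability.Probability"
begin

section \<open>Borel sigma-fields\<close>

definition borel_of :: "'a topology \<Rightarrow> 'a measure" where
  "borel_of X = sigma (topspace X) {U. openin X U}"

text \<open>Locale \<^term>\<open>Metric_space\<close> demands nonnegativity and symmetry also outside the carrier, hence
  the truncation of \<open>d\<close>.\<close>

definition metric_borel :: "'a set \<Rightarrow> ('a \<Rightarrow> 'a \<Rightarrow> real) \<Rightarrow> 'a measure" where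
  "metric_borel S d =
     borel_of (Metric_space.mtopology S (\<lambda>x y. if x \<in> S \<and> y \<in> S then d x y else 0))"


section \<open>Spaces of closed sets\<close>

definition closed_subsets :: "real \<Rightarrow> real set set" where
  "closed_subsets t = {C. closed C \<and> C \<subseteq> {0..t}}"

text \<open>
  The Hausdorff metric on the closed subsets of \<open>[0,t]\<close>. The distance of the empty set to any
  other closed set is set to \<open>t\<close>, the diameter of \<open>[0,t]\<close>; this makes the empty set an
  isolated point and keeps the triangle inequality.
\<close>

definition hausdorff_dist :: "real \<Rightarrow> real set \<Rightarrow> real set \<Rightarrow> real" where
  "hausdorff_dist t C D =
     (if C = {} \<and> D = {} then 0
      else if C = {} \<or> D = {} then t
      else max (SUP x\<in>C. infdist x D) (SUP x\<in>D. infdist x C))"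

definition closed_sets_space :: "real \<Rightarrow> real set measure" where
  "closed_sets_space t = metric_borel (closed_subsets t) (hausdorff_dist t)"


section \<open>Brownian motion and its level sets\<close>

locale standard_brownian_motion = prob_space M
  for M :: "'w measure" +
  fixes B :: "real \<Rightarrow> 'w \<Rightarrow> real"
  assumes random_variable_B: "\<And>t. 0 \<le> t \<Longrightarrow> random_variable borel (B t)"
    and start_zero: "\<And>\<omega>. \<omega> \<in> space M \<Longrightarrow> B 0 \<omega> = 0"
    and continuous_paths: "\<And>\<omega>. \<omega> \<in> space M \<Longrightarrow> continuous_on {0..} (\<lambda>t. B t \<omega>)"
    and normal_increments: "\<And>s t. 0 \<le> s \<Longrightarrow> s < t \<Longrightarrow>
          distributed M lborel (\<lambda>\<omega>. B t \<omega> - B s \<omega>) (normal_density 0 (sqrt (t - s)))"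
    and indep_increments: "\<And>(\<tau> :: nat \<Rightarrow> real) n. 0 \<le> \<tau> 0 \<Longrightarrow> strict_mono \<tau> \<Longrightarrow>
          indep_vars (\<lambda>_. borel) (\<lambda>i \<omega>. B (\<tau> (Suc i)) \<omega> - B (\<tau> i) \<omega>) {..<n}"

definition level_set_law :: "'w measure \<Rightarrow> (real \<Rightarrow> 'w \<Rightarrow> real) \<Rightarrow> real \<Rightarrow> real \<Rightarrow> real set measure"
  where "level_set_law M B t a = distr M (closed_sets_space t) (\<lambda>\<omega>. {s\<in>{0..t}. B s \<omega> = a})"

definition equivalent_measures :: "'a measure \<Rightarrow> 'a measure \<Rightarrow> bool" where
  "equivalent_measures \<mu> \<nu> \<longleftrightarrow>
     sets \<mu> = sets \<nu> \<and> absolutely_continuous \<mu> \<nu> \<and> absolutely_continuous \<nu> \<mu>"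

definition level_set_type ::
    "'w measure \<Rightarrow> (real \<Rightarrow> 'w \<Rightarrow> real) \<Rightarrow> real \<Rightarrow> real set measure set" where
  "level_set_type M B t =
     {P. prob_space P \<and> (\<exists>a>0. equivalent_measures P (level_set_law M B t a))}"


section \<open>The Hilbert space of a measure type\<close>

text \<open>
  Elements of \<open>L\<^sub>2(P)\<close> are classes of measurable functions modulo equality almost everywhere. An
  element of \<open>L\<^sub>2\<close> of a measure type \<open>\<T>\<close> (a set of mutually equivalent probability measures) is a
  family \<open>(\<psi> P)\<close>, indexed by \<open>P \<in> \<T>\<close>, of such classes; it is extensional, that is,
  \<open>undefined\<close> outside \<open>\<T>\<close>, so that equality in the Hilbert space is equality in HOL.
\<close>

type_synonym 'a half_density = "'a measure \<Rightarrow> ('a \<Rightarrow> complex) set"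

definition ae_class :: "'a measure \<Rightarrow> ('a \<Rightarrow> complex) \<Rightarrow> ('a \<Rightarrow> complex) set" where
  "ae_class P f = {g \<in> borel_measurable P. AE x in P. g x = f x}"

definition L2_classes :: "'a measure \<Rightarrow> ('a \<Rightarrow> complex) set set" where
  "L2_classes P =
     {ae_class P f | f. f \<in> borel_measurable P \<and> integrable P (\<lambda>x. (cmod (f x))\<^sup>2)}"

text \<open>\<open>RN_deriv P\<^sub>2 P\<^sub>1\<close> is the density \<open>dP\<^sub>1/dP\<^sub>2\<close>.\<close>

definition L2_type :: "'a measure set \<Rightarrow> 'a half_density set" where
  "L2_type \<T> = {\<psi> \<in> (\<Pi>\<^sub>E P\<in>\<T>. L2_classes P).
     \<forall>P\<^sub>1\<in>\<T>. \<forall>P\<^sub>2\<in>\<T>. \<forall>f\<in>\<psi> P\<^sub>1.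
       \<psi> P\<^sub>2 = ae_class P\<^sub>2 (\<lambda>x. complex_of_real (sqrt (enn2real (RN_deriv P\<^sub>2 P\<^sub>1 x))) * f x)}"

definition L2_zero :: "'a measure set \<Rightarrow> 'a half_density" where
  "L2_zero \<T> = (\<lambda>P\<in>\<T>. ae_class P (\<lambda>_. 0))"

definition L2_scale :: "'a measure set \<Rightarrow> complex \<Rightarrow> 'a half_density \<Rightarrow> 'a half_density" where
  "L2_scale \<T> c \<psi> = (\<lambda>P\<in>\<T>. \<Union>f\<in>\<psi> P. ae_class P (\<lambda>x. c * f x))"

definition L2_diff ::
    "'a measure set \<Rightarrow> 'a half_density \<Rightarrow> 'a half_density \<Rightarrow> 'a half_density" where
  "L2_diff \<T> \<psi> \<phi> = (\<lambda>P\<in>\<T>. \<Union>f\<in>\<psi> P. \<Union>g\<in>\<phi> P. ae_class P (\<lambda>x. f x - g x))"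

text \<open>The inner product is the common value, for all \<open>P \<in> \<T>\<close> and all representatives, of the
  integrals below.\<close>

definition L2_inner :: "'a measure set \<Rightarrow> 'a half_density \<Rightarrow> 'a half_density \<Rightarrow> complex" where
  "L2_inner \<T> \<psi> \<phi> =
     (THE z. \<forall>P\<in>\<T>. \<forall>f\<in>\<psi> P. \<forall>g\<in>\<phi> P. z = (LINT x|P. f x * cnj (g x)))"

definition L2_norm :: "'a measure set \<Rightarrow> 'a half_density \<Rightarrow> real" where
  "L2_norm \<T> \<psi> = sqrt (Re (L2_inner \<T> \<psi> \<psi>))"

definition L2_borel :: "'a measure set \<Rightarrow> 'a half_density measure" where
  "L2_borel \<T> = metric_borel (L2_type \<T>) (\<lambda>\<psi> \<phi>. L2_norm \<T> (L2_diff \<T> \<psi> \<phi>))"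


section \<open>Product systems of random closed sets\<close>

text \<open>
  Below, \<open>\<P> t\<close> is a measure type on the closed subsets of \<open>[0,t]\<close>, for every \<open>t > 0\<close>; the
  Hilbert spaces of the product system are \<open>H\<^sub>t = L2_type (\<P> t)\<close>.
\<close>

definition join :: "real \<Rightarrow> real set \<Rightarrow> real set \<Rightarrow> real set" where
  "join s C\<^sub>1 C\<^sub>2 = C\<^sub>1 \<union> (\<lambda>x. x + s) ` C\<^sub>2"

definition join_law ::
    "real \<Rightarrow> real \<Rightarrow> real set measure \<Rightarrow> real set measure \<Rightarrow> real set measure" where
  "join_law s t P\<^sub>1 P\<^sub>2 =
     distr (P\<^sub>1 \<Otimes>\<^sub>M P\<^sub>2) (closed_sets_space (s + t)) (\<lambda>(C\<^sub>1, C\<^sub>2). join s C\<^sub>1 C\<^sub>2)"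

text \<open>
  \<open>is_tensor \<P> s t \<psi>\<^sub>1 \<psi>\<^sub>2 \<psi>\<close> says that \<open>\<psi>\<close> is the element of \<open>H\<^sub>s\<^sub>+\<^sub>t\<close> identified with
  \<open>\<psi>\<^sub>1 \<otimes> \<psi>\<^sub>2\<close>. It determines \<open>\<psi>\<close>, since one class \<open>\<psi> P\<close> determines the others.
\<close>

definition is_tensor ::
    "(real \<Rightarrow> real set measure set) \<Rightarrow> real \<Rightarrow> real \<Rightarrow>
     real set half_density \<Rightarrow> real set half_density \<Rightarrow> real set half_density \<Rightarrow> bool" where
  "is_tensor \<P> s t \<psi>\<^sub>1 \<psi>\<^sub>2 \<psi> \<longleftrightarrow>
     \<psi> \<in> L2_type (\<P> (s + t)) \<and>
     (\<forall>P\<^sub>1\<in>\<P> s. \<forall>P\<^sub>2\<in>\<P> t. \<forall>f\<^sub>1\<in>\<psi>\<^sub>1 P\<^sub>1. \<forall>f\<^sub>2\<in>\<psi>\<^sub>2 P\<^sub>2. \<forall>f\<in>\<psi> (join_law s t P\<^sub>1 P\<^sub>2).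
        AE C in P\<^sub>1 \<Otimes>\<^sub>M P\<^sub>2. f (join s (fst C) (snd C)) = f\<^sub>1 (fst C) * f\<^sub>2 (snd C))"

definition dilate :: "real \<Rightarrow> real set \<Rightarrow> real set" where
  "dilate t C = (\<lambda>x. t * x) ` C"

definition dilate_law :: "real \<Rightarrow> real set measure \<Rightarrow> real set measure" where
  "dilate_law t P = distr P (closed_sets_space t) (dilate t)"

text \<open>
  The unitary operator from \<open>H\<^sub>1\<close> to \<open>H\<^sub>t\<close> induced by \<open>C \<mapsto> t \<cdot> C\<close>. Its value at \<open>Q \<in> \<P> t\<close> is the
  class of all \<open>g\<close> with \<open>g (dilate t C) = f C\<close> almost surely, where \<open>f\<close> represents \<open>\<psi> P\<close>
  and \<open>P \<in> \<P> 1\<close> is the (unique) measure with image \<open>Q\<close>.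
\<close>

definition dilate_op ::
    "(real \<Rightarrow> real set measure set) \<Rightarrow> real \<Rightarrow> real set half_density \<Rightarrow> real set half_density" where
  "dilate_op \<P> t \<psi> = (\<lambda>Q\<in>\<P> t. {g \<in> borel_measurable Q.
     \<exists>P\<in>\<P> 1. Q = dilate_law t P \<and> (\<exists>f\<in>\<psi> P. AE C in P. g (dilate t C) = f C)})"

text \<open>The disjoint union of the \<open>H\<^sub>t\<close>, with the Borel structure transported from
  \<open>(0,\<infinity>) \<times> H\<^sub>1\<close> by the bijection \<open>(t, \<psi>) \<mapsto> (t, dilate_op \<P> t \<psi>)\<close>.\<close>

definition bundle_space ::
    "(real \<Rightarrow> real set measure set) \<Rightarrow> (real \<times> real set half_density) measure" where
  "bundle_space \<P> = sigma (SIGMA t:{0<..}. L2_type (\<P> t))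
     {(\<lambda>(t, \<psi>). (t, dilate_op \<P> t \<psi>)) ` A | A.
        A \<in> sets (restrict_space borel {0<..} \<Otimes>\<^sub>M L2_borel (\<P> 1))}"


text \<open>Families indexed by \<open>(0,\<infinity>)\<close> are functions on the reals whose values at
  nonpositive arguments are irrelevant.\<close>

definition product_system_unit ::
    "(real \<Rightarrow> real set measure set) \<Rightarrow> (real \<Rightarrow> real set half_density) \<Rightarrow> bool" where
  "product_system_unit \<P> u \<longleftrightarrow>
     (\<forall>t>0. u t \<in> L2_type (\<P> t)) \<and>
     (\<forall>s>0. \<forall>t>0. is_tensor \<P> s t (u s) (u t) (u (s + t))) \<and>
     (\<lambda>t. (t, u t)) \<in> measurable (restrict_space borel {0<..}) (bundle_space \<P>) \<and>
     (\<exists>t>0. u t \<noteq> L2_zero (\<P> t))"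

definition special_unit :: "(real \<Rightarrow> real set measure set) \<Rightarrow> real \<Rightarrow> real set half_density" where
  "special_unit \<P> t = (\<lambda>P\<in>\<P> t. ae_class P
     (\<lambda>C. if C = {} then complex_of_real (1 / sqrt (measure P {{}})) else 0))"

end

theory Submission
  imports Defs
begin

text \<open>
  Let \<open>u\<close> be a unit. The squared modulus of \<open>u t\<close> is a finite measure \<open>\<mu> t\<close> on the closed subsets of \<open>[0,t]\<close>,
  absolutely continuous with respect to the law of a Brownian level set, and the unit equation makes this
  family factorizing: \<open>\<mu> (s + t)\<close> is the image of \<open>\<mu> s \<otimes> \<mu> t\<close> under concatenation of sets. Up to
  normalization, a stationary random closed set with independent parts is a Poisson process or meets every interval.

  The second case is impossible, since the level set of a nonzero level does not contain \<open>0\<close>: a neighbourhood of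
  \<open>0\<close> is missed with positive measure, hence the empty set has positive measure (\<open>void_pos\<close>). Then the expected number
  of cells that are met, in a partition of \<open>[0,t]\<close> into \<open>n\<close> equal cells, is bounded uniformly in \<open>n\<close>
  (\<open>expected_cells_le\<close>), so the set is almost surely finite. But a Brownian level set is almost surely
  empty or infinite (\<open>AE_level_set_empty_or_infinite\<close>). Therefore \<open>\<mu> t\<close> is concentrated on the empty set (\<open>AE_empty\<close>),
  that is, \<open>u t\<close> is a multiple \<open>g t\<close> of the special unit. The unit equation says that \<open>g\<close> is multiplicative. It is
  measurable, because the Borel structure of the bundle is transported from \<open>H\<^sub>1\<close> by dilations, which
  preserve the coefficient at the empty set (\<open>measurable_void_coeff\<close>). A measurable multiplicative function is
  an exponential (\<open>measurable_multiplicative_exp\<close>).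

  To make sense of the unit equation one has to know that the laws of the level sets at different levels are
  equivalent (\<open>level_set_law_equivalent\<close>), that concatenation of independent level sets stays in the measure type
  (\<open>join_law_in_type\<close>), and that the measure types for different \<open>t\<close> are dilations of each other
  (\<open>level_set_law_scaling\<close>). All this follows from one uniqueness theorem for the law of the Brownian path
  (\<open>brownian_law_unique\<close>), applied to processes made from a Brownian motion: the motion with a drift, under a
  density of Girsanov's type; a motion that is continued by an independent one; and the scaled motion. The continued motion also
  yields the Markov property (\<open>markov_property\<close>), on which the infinity of level sets rests: immediately after
  the first hit of a level, the path passes to both sides of it.
\<close>

section \<open>The Borel sets of the space of closed sets\<close>

lemma infdist_le_diam:
  fixes x :: real
  assumes "D \<noteq> {}" "D \<subseteq> {0..t}" "x \<in> {0..t}"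
  shows "infdist x D \<le> t"
proof -
  obtain d where d: "d \<in> D" using assms by auto
  have "infdist x D \<le> dist x d" using d by (rule infdist_le)
  also have "\<dots> \<le> t" using subsetD[OF assms(2) d] assms(3) by (auto simp: dist_real_def)
  finally show ?thesis .
qed

lemma hausdorff_dist_le_iff:
  assumes "C \<in> closed_subsets t" "D \<in> closed_subsets t" "C \<noteq> {}" "D \<noteq> {}"
  shows "hausdorff_dist t C D \<le> r \<longleftrightarrow> (\<forall>x\<in>C. infdist x D \<le> r) \<and> (\<forall>x\<in>D. infdist x C \<le> r)"
proof -
  have bdd: "bdd_above ((\<lambda>x. infdist x D) ` C)" "bdd_above ((\<lambda>x. infdist x C) ` D)"
    using assms by (auto intro!: bdd_aboveI[of _ t] infdist_le_diam simp: closed_subsets_def)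
  show ?thesis using assms bdd by (simp add: hausdorff_dist_def cSUP_le_iff)
qed

lemma hausdorff_dist_nonneg:
  assumes "C \<in> closed_subsets t" "D \<in> closed_subsets t" "0 < t"
  shows "0 \<le> hausdorff_dist t C D"
proof (cases "C = {} \<or> D = {}")
  case True then show ?thesis using assms by (auto simp: hausdorff_dist_def)
next
  case False
  then obtain x where "x \<in> C" by auto
  then have "infdist x D \<le> hausdorff_dist t C D"
    using hausdorff_dist_le_iff[of C t D "hausdorff_dist t C D"] False assms by auto
  then show ?thesis using infdist_nonneg[of x D] by linarith
qed

lemma hausdorff_dist_commute: "hausdorff_dist t C D = hausdorff_dist t D C"
  by (auto simp: hausdorff_dist_def max.commute)

lemma hausdorff_dist_triangle:
  assumes C: "C \<in> closed_subsets t" and D: "D \<in> closed_subsets t" and E: "E \<in> closed_subsets t"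
    and t: "0 < t"
  shows "hausdorff_dist t C E \<le> hausdorff_dist t C D + hausdorff_dist t D E"
proof (cases "C = {} \<or> E = {} \<or> D = {}")
  case True
  have le: "hausdorff_dist t C E \<le> t" if "C \<noteq> {}" "E \<noteq> {}"
    using that hausdorff_dist_le_iff[OF C E that] C E
    by (auto intro!: infdist_le_diam simp: closed_subsets_def)
  show ?thesis
  proof (cases "D = {} \<and> C \<noteq> {} \<and> E \<noteq> {}")
    case D: True
    then have "hausdorff_dist t C D = t" "hausdorff_dist t D E = t"
      by (auto simp: hausdorff_dist_def)
    then show ?thesis using le D t by auto
  next
    case False
    then show ?thesis
      using True t hausdorff_dist_nonneg[OF C D t] hausdorff_dist_nonneg[OF D E t]
      by (auto simp: hausdorff_dist_def split: if_splits)
  qed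
next
  case False
  let ?r = "hausdorff_dist t C D" and ?s = "hausdorff_dist t D E"
  have 1: "\<forall>x\<in>C. infdist x D \<le> ?r" "\<forall>x\<in>D. infdist x C \<le> ?r"
    using hausdorff_dist_le_iff[OF C D, of ?r] False by auto
  have 2: "\<forall>x\<in>D. infdist x E \<le> ?s" "\<forall>x\<in>E. infdist x D \<le> ?s"
    using hausdorff_dist_le_iff[OF D E, of ?s] False by auto
  have step: "infdist x Y \<le> a + b"
    if "infdist x D \<le> a" "\<forall>y\<in>D. infdist y Y \<le> b" for x Y and a b :: real
  proof -
    have "closed D" "D \<noteq> {}" using D False by (auto simp: closed_subsets_def)
    then obtain y where y: "y \<in> D" "infdist x D = dist x y"
      using infdist_attains_inf by blast
    have "infdist x Y \<le> infdist y Y + dist x y" by (rule infdist_triangle)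
    then show ?thesis using that y by fastforce
  qed
  have "infdist x E \<le> ?r + ?s" if "x \<in> C" for x using step 1 2 that by blast
  moreover have "infdist x C \<le> ?r + ?s" if "x \<in> E" for x
    using step[of x ?s C ?r] 1 2 that by (simp add: add.commute)
  ultimately show ?thesis using hausdorff_dist_le_iff[OF C E, of "?r + ?s"] False by blast
qed

lemma hausdorff_dist_eq_0_iff:
  assumes C: "C \<in> closed_subsets t" and D: "D \<in> closed_subsets t" and t: "0 < t"
  shows "hausdorff_dist t C D = 0 \<longleftrightarrow> C = D"
proof (cases "C = {} \<or> D = {}")
  case True then show ?thesis using t by (auto simp: hausdorff_dist_def)
next
  case False
  have cl: "closed C" "closed D" using C D by (auto simp: closed_subsets_def)
  have "hausdorff_dist t C D = 0 \<longleftrightarrow> hausdorff_dist t C D \<le> 0"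
    using hausdorff_dist_nonneg[OF C D t] by linarith
  also have "\<dots> \<longleftrightarrow> (\<forall>x\<in>C. infdist x D = 0) \<and> (\<forall>x\<in>D. infdist x C = 0)"
    using hausdorff_dist_le_iff[OF C D] False by (auto simp: antisym infdist_nonneg)
  also have "\<dots> \<longleftrightarrow> C = D"
    using False cl in_closed_iff_infdist_zero by blast
  finally show ?thesis .
qed

lemma hausdorff_Metric_space:
  assumes "0 < t"
  shows "Metric_space (closed_subsets t)
    (\<lambda>x y. if x \<in> closed_subsets t \<and> y \<in> closed_subsets t then hausdorff_dist t x y else 0)"
proof
  fix x y
  show "0 \<le> (if x \<in> closed_subsets t \<and> y \<in> closed_subsets t then hausdorff_dist t x y else 0)"
    using hausdorff_dist_nonneg[of x t y] assms by simp
  show "(if x \<in> closed_subsets t \<and> y \<in> closed_subsets t then hausdorff_dist t x y else 0) =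
      (if y \<in> closed_subsets t \<and> x \<in> closed_subsets t then hausdorff_dist t y x else 0)"
    by (simp add: hausdorff_dist_commute[of t x y])
next
  fix x y assume "x \<in> closed_subsets t" "y \<in> closed_subsets t"
  then show "((if x \<in> closed_subsets t \<and> y \<in> closed_subsets t then hausdorff_dist t x y else 0) = 0) = (x = y)"
    using hausdorff_dist_eq_0_iff[of x t y] assms by simp
next
  fix x y z assume "x \<in> closed_subsets t" "y \<in> closed_subsets t" "z \<in> closed_subsets t"
  then show "(if x \<in> closed_subsets t \<and> z \<in> closed_subsets t then hausdorff_dist t x z else 0)
      \<le> (if x \<in> closed_subsets t \<and> y \<in> closed_subsets t then hausdorff_dist t x y else 0) +
        (if y \<in> closed_subsets t \<and> z \<in> closed_subsets t then hausdorff_dist t y z else 0)"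
    using hausdorff_dist_triangle[of x t y z] assms by simp
qed

text \<open>
  For points of the carrier the truncated distance is \<open>d\<close> itself, so openness can be expressed by
  \<open>d\<close> alone.
\<close>

lemma Metric_space_borel_of:
  assumes "Metric_space S (\<lambda>x y. if x \<in> S \<and> y \<in> S then d x y else 0)"
  shows space_metric_borel: "space (metric_borel S d) = S"
    and sets_metric_borel: "sets (metric_borel S d) =
      sigma_sets S {U. U \<subseteq> S \<and> (\<forall>x\<in>U. \<exists>r>0. \<forall>y\<in>S. d x y < r \<longrightarrow> y \<in> U)}"
proof -
  interpret Metric_space S "\<lambda>x y. if x \<in> S \<and> y \<in> S then d x y else 0" by fact
  have *: "{U. openin mtopology U} = {U. U \<subseteq> S \<and> (\<forall>x\<in>U. \<exists>r>0. \<forall>y\<in>S. d x y < r \<longrightarrow> y \<in> U)}"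
  proof (intro Collect_cong iffI)
    fix U assume U: "openin mtopology U"
    then have "U \<subseteq> S" by (simp add: openin_mtopology)
    moreover have "\<exists>r>0. \<forall>y\<in>S. d x y < r \<longrightarrow> y \<in> U" if x: "x \<in> U" for x
    proof -
      obtain r where "r > 0" "mball x r \<subseteq> U" using U x unfolding openin_mtopology by blast
      moreover have "y \<in> mball x r" if "y \<in> S" "d x y < r" for y
        using that x \<open>U \<subseteq> S\<close> by (simp add: subsetD)
      ultimately show ?thesis by blast
    qed
    ultimately show "U \<subseteq> S \<and> (\<forall>x\<in>U. \<exists>r>0. \<forall>y\<in>S. d x y < r \<longrightarrow> y \<in> U)" by auto
  next
    fix U assume U: "U \<subseteq> S \<and> (\<forall>x\<in>U. \<exists>r>0. \<forall>y\<in>S. d x y < r \<longrightarrow> y \<in> U)"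
    show "openin mtopology U"
      unfolding openin_mtopology
    proof (intro conjI allI impI)
      show "U \<subseteq> S" using U by auto
      fix x assume x: "x \<in> U"
      then obtain r where r: "r > 0" "\<forall>y\<in>S. d x y < r \<longrightarrow> y \<in> U" using U by blast
      then have "mball x r \<subseteq> U" using x U by auto
      then show "\<exists>r>0. mball x r \<subseteq> U" using r by blast
    qed
  qed
  show "space (metric_borel S d) = S"
    by (auto simp: metric_borel_def borel_of_def space_measure_of_conv)
  show "sets (metric_borel S d) =
      sigma_sets S {U. U \<subseteq> S \<and> (\<forall>x\<in>U. \<exists>r>0. \<forall>y\<in>S. d x y < r \<longrightarrow> y \<in> U)}"
    unfolding metric_borel_def borel_of_def * by (subst sets_measure_of) auto
qed

lemma space_closed_sets [simp]: "0 < t \<Longrightarrow> space (closed_sets_space t) = closed_subsets t"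
  unfolding closed_sets_space_def by (intro space_metric_borel hausdorff_Metric_space)

lemma sets_closed_sets:
  "0 < t \<Longrightarrow> sets (closed_sets_space t) = sigma_sets (closed_subsets t)
    {U. U \<subseteq> closed_subsets t \<and>
      (\<forall>x\<in>U. \<exists>r>0. \<forall>y\<in>closed_subsets t. hausdorff_dist t x y < r \<longrightarrow> y \<in> U)}"
  unfolding closed_sets_space_def by (intro sets_metric_borel hausdorff_Metric_space)

text \<open>
  By compactness, a closed set that misses \<open>[p,q]\<close> keeps a positive distance from it. The radius is
  taken at most \<open>t\<close>, the distance to the empty set, so that the ball around a nonempty set contains
  only nonempty sets.
\<close>

lemma miss_open:
  assumes t: "0 < t"
  shows "{C \<in> closed_subsets t. C \<inter> {p..q} = {}} \<in> sets (closed_sets_space t)"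
  unfolding sets_closed_sets[OF t]
proof (intro sigma_sets.Basic CollectI conjI ballI)
  fix C assume "C \<in> {C \<in> closed_subsets t. C \<inter> {p..q} = {}}"
  then have C: "C \<in> closed_subsets t" and miss: "C \<inter> {p..q} = {}" by auto
  have "\<exists>r>0. r \<le> t \<and> (\<forall>x\<in>C. \<forall>y\<in>{p..q}. r \<le> dist x y)"
  proof -
    have "compact C" using C
      by (auto simp: closed_subsets_def compact_eq_bounded_closed
        intro: bounded_subset[OF bounded_closed_interval])
    then obtain d where "d > 0" "\<forall>x\<in>C. \<forall>y\<in>{p..q}. d \<le> dist x y"
      using separate_compact_closed[of C "{p..q}"] miss by auto
    then show ?thesis using t by (intro exI[of _ "min d t"]) (auto intro: min.coboundedI1)
  qed
  then obtain r where r: "r > 0" "r \<le> t" "\<And>x y. x\<in>C \<Longrightarrow> y\<in>{p..q} \<Longrightarrow> r \<le> dist x y" by blast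
  have "D \<inter> {p..q} = {}" if D: "D \<in> closed_subsets t" and lt: "hausdorff_dist t C D < r" for D
  proof (rule ccontr)
    assume "D \<inter> {p..q} \<noteq> {}"
    then obtain y where y: "y \<in> D" "y \<in> {p..q}" by blast
    have ne: "C \<noteq> {}" "D \<noteq> {}" using y lt r(2) by (auto simp: hausdorff_dist_def split: if_splits)
    have "infdist y C \<le> hausdorff_dist t C D"
      using hausdorff_dist_le_iff[OF C D ne, of "hausdorff_dist t C D"] y by auto
    moreover obtain x where "x \<in> C" "infdist y C = dist y x"
      using infdist_attains_inf[of C y] C ne by (auto simp: closed_subsets_def)
    ultimately show False using r(3)[of x y] y lt by (simp add: dist_commute)
  qed
  then show "\<exists>r>0. \<forall>y\<in>closed_subsets t.
      hausdorff_dist t C y < r \<longrightarrow> y \<in> {C \<in> closed_subsets t. C \<inter> {p..q} = {}}"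
    using r(1) by (intro exI[of _ r]) auto
qed auto

lemma sets_hit [measurable]:
  assumes "0 < t"
  shows "{C \<in> closed_subsets t. C \<inter> {p..q} \<noteq> {}} \<in> sets (closed_sets_space t)"
proof -
  have eq: "{C \<in> closed_subsets t. C \<inter> {p..q} \<noteq> {}} =
      space (closed_sets_space t) - {C \<in> closed_subsets t. C \<inter> {p..q} = {}}"
    using assms by auto
  show ?thesis unfolding eq by (rule sets.compl_sets[OF miss_open[OF assms]])
qed

lemma sets_hit_Ioc:
  assumes "0 < t"
  shows "{C \<in> closed_subsets t. C \<inter> {p<..q} \<noteq> {}} \<in> sets (closed_sets_space t)"
proof -
  have "{p<..q} = (\<Union>n::nat. {p + 1 / Suc n..q})"
  proof (intro set_eqI iffI)
    fix x assume "x \<in> {p<..q}"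
    then have "x - p > 0" "x \<le> q" by auto
    then obtain n where "inverse (of_nat (Suc n)) < x - p" using reals_Archimedean by blast
    then show "x \<in> (\<Union>n::nat. {p + 1 / Suc n..q})"
      using \<open>x \<le> q\<close> by (auto intro!: exI[of _ n] simp: field_simps inverse_eq_divide)
  next
    fix x assume "x \<in> (\<Union>n::nat. {p + 1 / Suc n..q})"
    then obtain n :: nat where "p + 1 / Suc n \<le> x" "x \<le> q" by auto
    moreover have "0 < 1 / real (Suc n)" by simp
    ultimately have "p < x" by linarith
    then show "x \<in> {p<..q}" using \<open>x \<le> q\<close> by simp
  qed
  then have "{C \<in> closed_subsets t. C \<inter> {p<..q} \<noteq> {}} =
      (\<Union>n::nat. {C \<in> closed_subsets t. C \<inter> {p + 1 / Suc n..q} \<noteq> {}})" by auto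
  also have "\<dots> \<in> sets (closed_sets_space t)" using sets_hit[OF assms] by (intro sets.countable_UN) auto
  finally show ?thesis .
qed

text \<open>
  A partition of \<open>[0,t]\<close> into \<open>n\<close> equal cells resolves closed sets up to \<open>t / n\<close>. Hence an open set of
  closed sets is a countable union of events of the form "exactly these cells are met", and the
  events "this closed interval is met" generate the Borel sets.
\<close>

lemma hausdorff_dist_same_cells:
  assumes C: "C \<in> closed_subsets t" and D: "D \<in> closed_subsets t" and t: "0 < t" and n: "0 < n"
    and same: "\<And>k. k < n \<Longrightarrow> (C \<inter> {real k * t / n..real (Suc k) * t / n} \<noteq> {}) =
      (D \<inter> {real k * t / n..real (Suc k) * t / n} \<noteq> {})"
  shows "hausdorff_dist t C D \<le> t / n"
proof -
  have cell: "\<exists>k<n. x \<in> {real k * t / n..real (Suc k) * t / n}" if "x \<in> {0..t}" for x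
  proof (cases "x = t")
    case True
    then show ?thesis using n t by (intro exI[of _ "n - 1"]) (auto simp: field_simps of_nat_diff)
  next
    case False
    define k where "k = nat \<lfloor>x * n / t\<rfloor>"
    have "0 \<le> x * n / t" using that t by auto
    then have k: "real k \<le> x * n / t" "x * n / t < real k + 1" unfolding k_def by linarith+
    have "x * n / t < n" using False that t n by (auto simp: field_simps)
    then have "k < n" using k by linarith
    then show ?thesis using k t n by (intro exI[of _ k]) (auto simp: field_simps)
  qed
  have near: "infdist x Y \<le> t / n" if XY: "X \<in> closed_subsets t" "x \<in> X"
    "\<And>k. k < n \<Longrightarrow> X \<inter> {real k * t / n..real (Suc k) * t / n} \<noteq> {} \<Longrightarrow>
      Y \<inter> {real k * t / n..real (Suc k) * t / n} \<noteq> {}" for x X Y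
  proof -
    have "x \<in> {0..t}" using XY by (auto simp: closed_subsets_def)
    from cell[OF this] obtain k where k: "k < n" "x \<in> {real k * t / n..real (Suc k) * t / n}" by blast
    then obtain y where y: "y \<in> Y" "y \<in> {real k * t / n..real (Suc k) * t / n}"
      using XY by blast
    have "infdist x Y \<le> dist x y" using y by (intro infdist_le) auto
    also have "\<dots> \<le> t / n" using k y n by (auto simp: dist_real_def field_simps abs_le_iff)
    finally show ?thesis .
  qed
  show ?thesis
  proof (cases "C = {} \<or> D = {}")
    case True
    have "C = D"
    proof (rule ccontr)
      assume "C \<noteq> D"
      then obtain x where x: "x \<in> C \<union> D" using True by auto
      then have "x \<in> {0..t}" using C D by (auto simp: closed_subsets_def)
      from cell[OF this] obtain k where "k < n" "x \<in> {real k * t / n..real (Suc k) * t / n}" by blast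
      then show False using same[of k] x True by auto
    qed
    then show ?thesis using hausdorff_dist_eq_0_iff[OF C D t] t by auto
  next
    case False
    then show ?thesis using near[OF C] near[OF D] same hausdorff_dist_le_iff[OF C D] by auto
  qed
qed

text \<open>
  The countable union is indexed by the pairs \<open>(n, S)\<close> such that every closed set whose pattern of met
  cells, at resolution \<open>n\<close>, is \<open>S\<close> belongs to the given open set.
\<close>

lemma measurable_closed_setsI:
  assumes t: "0 < t"
    and f: "\<And>\<omega>. \<omega> \<in> space M \<Longrightarrow> f \<omega> \<in> closed_subsets t"
    and hit: "\<And>p q. p \<le> q \<Longrightarrow> {\<omega> \<in> space M. f \<omega> \<inter> {p..q} \<noteq> {}} \<in> sets M"
  shows "f \<in> M \<rightarrow>\<^sub>M closed_sets_space t"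
proof -
  define pat where "pat n C = {k. k < n \<and> C \<inter> {real k * t / real n..real (Suc k) * t / real n} \<noteq> {}}" for n C
  let ?G = "{U. U \<subseteq> closed_subsets t \<and>
      (\<forall>x\<in>U. \<exists>r>0. \<forall>y\<in>closed_subsets t. hausdorff_dist t x y < r \<longrightarrow> y \<in> U)}"
  have "f \<in> measurable M (sigma (closed_subsets t) ?G)"
  proof (rule measurable_measure_of)
    show "?G \<subseteq> Pow (closed_subsets t)" by auto
    show "f \<in> space M \<rightarrow> closed_subsets t" using f by auto
    fix U assume U: "U \<in> ?G"
    let ?I = "{(n, S). n > 0 \<and> S \<subseteq> {..<n} \<and> (\<forall>C\<in>closed_subsets t. pat n C = S \<longrightarrow> C \<in> U)}"
    have "f -` U \<inter> space M = (\<Union>(n, S)\<in>?I. {\<omega> \<in> space M. pat n (f \<omega>) = S})"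
    proof (intro set_eqI iffI)
      fix \<omega> assume "\<omega> \<in> (\<Union>(n, S)\<in>?I. {\<omega> \<in> space M. pat n (f \<omega>) = S})"
      then show "\<omega> \<in> f -` U \<inter> space M" using f by auto
    next
      fix \<omega> assume om: "\<omega> \<in> f -` U \<inter> space M"
      then obtain r where r: "r > 0" "\<And>y. y\<in>closed_subsets t \<Longrightarrow> hausdorff_dist t (f \<omega>) y < r \<Longrightarrow> y \<in> U"
        using U by blast
      obtain n :: nat where n: "t / r < real n" using reals_Archimedean2 by blast
      have "0 < t / r" using t r by simp
      then have n0: "n > 0" using n by (cases n) auto
      have tn: "t / n < r" using n n0 r t by (simp add: field_simps)
      have "C \<in> U" if "C \<in> closed_subsets t" "pat n C = pat n (f \<omega>)" for C
      proof -
        have "(f \<omega> \<inter> {real k * t / real n..real (Suc k) * t / real n} \<noteq> {}) =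
            (C \<inter> {real k * t / real n..real (Suc k) * t / real n} \<noteq> {})" if "k < n" for k
          using \<open>pat n C = pat n (f \<omega>)\<close> that unfolding pat_def by blast
        then have "hausdorff_dist t (f \<omega>) C \<le> t / n"
          using f om that n0 t by (intro hausdorff_dist_same_cells) auto
        then show ?thesis using r(2)[of C] that tn by auto
      qed
      then have "(n, pat n (f \<omega>)) \<in> ?I" using n0 by (auto simp: pat_def)
      then show "\<omega> \<in> (\<Union>(n, S)\<in>?I. {\<omega> \<in> space M. pat n (f \<omega>) = S})" using om by blast
    qed
    also have "\<dots> \<in> sets M"
    proof (rule sets.countable_UN'[OF _ image_subsetI])
      have "?I \<subseteq> (SIGMA n:UNIV. Pow {..<n})" by auto
      moreover have "countable (SIGMA n:(UNIV::nat set). Pow {..<n})"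
        by (intro countable_SIGMA) (auto intro: uncountable_infinite countable_finite)
      ultimately show "countable ?I" by (rule countable_subset)
      fix nS assume "nS \<in> ?I"
      obtain n S where nS: "nS = (n, S)" by (cases nS)
      have "{\<omega> \<in> space M. pat n (f \<omega>) = S} \<in> sets M" if S: "S \<subseteq> {..<n}" and n: "0 < n"
      proof -
        have "{\<omega> \<in> space M. pat n (f \<omega>) = S} = {\<omega> \<in> space M. \<forall>k\<in>{..<n}. k \<in> S \<longleftrightarrow>
            f \<omega> \<inter> {real k * t / real n..real (Suc k) * t / real n} \<noteq> {}}"
          using S by (auto simp: pat_def subset_iff)
        also have "\<dots> \<in> sets M"
        proof (rule sets.sets_Collect_finite_All')
          fix k :: nat assume "k \<in> {..<n}"
          have "real k * t / real n \<le> real (Suc k) * t / real n"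
            using t by (intro divide_right_mono mult_right_mono) auto
          note h = hit[OF this]
          show "{\<omega> \<in> space M. k \<in> S \<longleftrightarrow>
            f \<omega> \<inter> {real k * t / real n..real (Suc k) * t / real n} \<noteq> {}} \<in> sets M"
          proof (cases "k \<in> S")
            case True then show ?thesis using h by simp
          next
            case False
            have eq: "{\<omega> \<in> space M. k \<in> S \<longleftrightarrow> f \<omega> \<inter> {real k * t / real n..real (Suc k) * t / real n} \<noteq> {}} =
              space M - {\<omega> \<in> space M. f \<omega> \<inter> {real k * t / real n..real (Suc k) * t / real n} \<noteq> {}}"
              using False by auto
            show ?thesis unfolding eq by (rule sets.compl_sets[OF h])
          qed
        qed (use n in auto)
        finally show ?thesis .
      qed
      then show "(case nS of (n, S) \<Rightarrow> {\<omega> \<in> space M. pat n (f \<omega>) = S}) \<in> sets M"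
        using \<open>nS \<in> ?I\<close> nS by auto
    qed
    finally show "f -` U \<inter> space M \<in> sets M" .
  qed
  then show ?thesis
    using sets_closed_sets[OF t] by (subst measurable_cong_sets[OF refl, of _ "sigma (closed_subsets t) ?G"])
      (auto intro: sets_measure_of[symmetric, THEN trans] simp: sets_measure_of_conv)
qed

lemma empty_closed_subset [simp]: "{} \<in> closed_subsets t"
  by (simp add: closed_subsets_def)

lemma sets_singleton_empty [measurable]:
  assumes "0 < t" shows "{{}} \<in> sets (closed_sets_space t)"
proof -
  have eq: "{{}} = {C \<in> closed_subsets t. C \<inter> {0..t} = {}}" by (auto simp: closed_subsets_def)
  show ?thesis unfolding eq by (rule miss_open[OF assms])
qed

lemma join_closed_subsets:
  assumes "C \<in> closed_subsets s" "D \<in> closed_subsets t" "0 < s" "0 < t"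
  shows "join s C D \<in> closed_subsets (s + t)"
proof -
  have "(\<lambda>x. x + s) ` D = (+) s ` D" by (auto simp: add.commute)
  then have "closed ((\<lambda>x. x + s) ` D)" using assms by (auto simp: closed_subsets_def intro: closed_translation)
  then show ?thesis using assms by (fastforce simp: join_def closed_subsets_def)
qed

lemma measurable_join [measurable]:
  assumes "0 < s" "0 < t"
  shows "(\<lambda>(C, D). join s C D) \<in> closed_sets_space s \<Otimes>\<^sub>M closed_sets_space t \<rightarrow>\<^sub>M closed_sets_space (s + t)"
proof (rule measurable_closed_setsI)
  let ?M = "closed_sets_space s \<Otimes>\<^sub>M closed_sets_space t"
  show "0 < s + t" using assms by simp
  show "(case \<omega> of (C, D) \<Rightarrow> join s C D) \<in> closed_subsets (s + t)" if "\<omega> \<in> space ?M" for \<omega>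
    using that assms by (auto simp: space_pair_measure intro: join_closed_subsets)
  fix p q :: real
  have "{\<omega> \<in> space ?M. (case \<omega> of (C, D) \<Rightarrow> join s C D) \<inter> {p..q} \<noteq> {}} =
      {C \<in> closed_subsets s. C \<inter> {p..q} \<noteq> {}} \<times> closed_subsets t \<union>
      closed_subsets s \<times> {D \<in> closed_subsets t. D \<inter> {p - s..q - s} \<noteq> {}}"
    using assms by (fastforce simp: space_pair_measure join_def disjoint_iff algebra_simps)
  also have "\<dots> \<in> sets ?M"
    using assms sets_hit[of s] sets_hit[of t] sets.top[of "closed_sets_space s"] sets.top[of "closed_sets_space t"]
    by (intro sets.Un pair_measureI) (auto simp del: sets.top)
  finally show "{\<omega> \<in> space ?M. (case \<omega> of (C, D) \<Rightarrow> join s C D) \<inter> {p..q} \<noteq> {}} \<in> sets ?M" .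
qed

lemma dilate_closed_subsets:
  assumes "C \<in> closed_subsets s" "0 < c"
  shows "dilate c C \<in> closed_subsets (c * s)"
proof -
  have "closed ((\<lambda>x. c *\<^sub>R x) ` C)" using assms by (intro closed_scaling) (auto simp: closed_subsets_def)
  then show ?thesis using assms by (auto simp: dilate_def closed_subsets_def)
qed

lemma measurable_dilate:
  assumes "0 < s" "0 < c"
  shows "dilate c \<in> closed_sets_space s \<rightarrow>\<^sub>M closed_sets_space (c * s)"
proof (rule measurable_closed_setsI)
  show "0 < c * s" using assms by simp
  show "dilate c \<omega> \<in> closed_subsets (c * s)" if "\<omega> \<in> space (closed_sets_space s)" for \<omega>
    using that assms dilate_closed_subsets by auto
  fix p q :: real
  have eq: "{\<omega> \<in> space (closed_sets_space s). dilate c \<omega> \<inter> {p..q} \<noteq> {}} =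
    {C \<in> closed_subsets s. C \<inter> {p / c..q / c} \<noteq> {}}"
    using assms by (auto simp: dilate_def disjoint_iff field_simps)
  show "{\<omega> \<in> space (closed_sets_space s). dilate c \<omega> \<inter> {p..q} \<noteq> {}} \<in> sets (closed_sets_space s)"
    unfolding eq by (rule sets_hit[OF assms(1)])
qed

lemma dilate_inverse: "0 < c \<Longrightarrow> dilate (1 / c) (dilate c C) = C" "0 < c \<Longrightarrow> dilate c (dilate (1 / c) C) = C"
  by (auto simp: dilate_def image_image)

section \<open>The law of a Brownian path\<close>

definition path_space :: "(real \<Rightarrow> real) measure" where
  "path_space = (\<Pi>\<^sub>M t\<in>{0..}. borel)"

definition path_of :: "(real \<Rightarrow> 'w \<Rightarrow> real) \<Rightarrow> 'w \<Rightarrow> real \<Rightarrow> real" where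
  "path_of X \<omega> = (\<lambda>t\<in>{0..}. X t \<omega>)"

definition path_law :: "'w measure \<Rightarrow> (real \<Rightarrow> 'w \<Rightarrow> real) \<Rightarrow> (real \<Rightarrow> real) measure" where
  "path_law M X = distr M path_space (path_of X)"

definition gauss :: "real \<Rightarrow> real measure" where
  "gauss v = density lborel (\<lambda>x. ennreal (normal_density 0 (sqrt v) x))"

text \<open>
  The finite-dimensional distributions of Brownian motion are prescribed only along partitions that
  contain the pivot \<open>s\<close>. They determine the law, and processes that are glued together, or modified,
  at time \<open>s\<close> are most easily analysed along such partitions.
\<close>

definition brownian_along :: "real \<Rightarrow> 'w measure \<Rightarrow> (real \<Rightarrow> 'w \<Rightarrow> real) \<Rightarrow> bool" where
  "brownian_along s M X \<longleftrightarrow> prob_space M \<and> (\<forall>t\<ge>0. X t \<in> borel_measurable M) \<and>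
    (\<forall>\<omega>\<in>space M. X 0 \<omega> = 0) \<and>
    (\<forall>(\<tau>::nat \<Rightarrow> real) n m A. strict_mono \<tau> \<longrightarrow> \<tau> 0 = 0 \<longrightarrow> \<tau> m = s \<longrightarrow> m \<le> n \<longrightarrow>
      (\<forall>i. A i \<in> sets borel) \<longrightarrow>
      emeasure M {\<omega>\<in>space M. \<forall>i<n. X (\<tau> (Suc i)) \<omega> - X (\<tau> i) \<omega> \<in> A i} =
        (\<Prod>i<n. emeasure (gauss (\<tau> (Suc i) - \<tau> i)) (A i)))"

lemma sets_gauss [measurable_cong, simp]: "sets (gauss v) = sets borel"
  by (simp add: gauss_def)

lemma space_gauss [simp]: "space (gauss v) = UNIV"
  by (simp add: gauss_def)

lemma prob_space_gauss: "0 < v \<Longrightarrow> prob_space (gauss v)"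
  unfolding gauss_def by (rule prob_space_normal_density) simp

lemma space_path_space: "space path_space = {0..} \<rightarrow>\<^sub>E UNIV"
  by (simp add: path_space_def space_PiM)

lemma measurable_path_component: "0 \<le> t \<Longrightarrow> (\<lambda>w. w t) \<in> borel_measurable path_space"
  unfolding path_space_def by measurable

lemma measurable_path_of:
  assumes "\<And>t. 0 \<le> t \<Longrightarrow> X t \<in> borel_measurable M"
  shows "path_of X \<in> M \<rightarrow>\<^sub>M path_space"
  unfolding path_space_def path_of_def using assms by (intro measurable_restrict) auto

lemma prob_space_path_law:
  assumes "prob_space M" "\<And>t. 0 \<le> t \<Longrightarrow> X t \<in> borel_measurable M"
  shows "prob_space (path_law M X)"
  unfolding path_law_def by (intro prob_space.prob_space_distr assms measurable_path_of)

lemma strict_mono_enumeration: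
  fixes T :: "real set"
  assumes "finite T" "0 \<in> T" "T \<subseteq> {0..}"
  shows "\<exists>(\<tau> :: nat \<Rightarrow> real) n. strict_mono \<tau> \<and> \<tau> 0 = 0 \<and> (\<forall>x\<in>T. \<exists>k\<le>n. \<tau> k = x)"
proof -
  define xs where "xs = sorted_list_of_set T"
  define n where "n = length xs - 1"
  have xs: "set xs = T" "sorted_wrt (<) xs"
    using assms by (auto simp: xs_def)
  then have len: "length xs = Suc n" using assms by (cases xs) (auto simp: n_def)
  define \<tau> where "\<tau> i = (if i \<le> n then xs ! i else xs ! n + real (i - n))" for i
  have step: "\<tau> i < \<tau> (Suc i)" for i
  proof -
    consider "Suc i \<le> n" | "i = n" | "i > n" by linarith
    then show ?thesis
    proof cases
      case 1
      then have "xs ! i < xs ! Suc i" using len by (intro sorted_wrt_nth_less[OF xs(2)]) auto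
      then show ?thesis using 1 by (simp add: \<tau>_def)
    next
      case 2 then show ?thesis by (simp add: \<tau>_def)
    next
      case 3 then show ?thesis by (simp add: \<tau>_def Suc_diff_le)
    qed
  qed
  have ex: "\<exists>k\<le>n. \<tau> k = x" if "x \<in> T" for x
  proof -
    have "x \<in> set xs" using that xs(1) by simp
    then obtain k where "k < length xs" "xs ! k = x" unfolding in_set_conv_nth by blast
    then show ?thesis using len by (intro exI[of _ k]) (auto simp: \<tau>_def)
  qed
  have mono: "strict_mono \<tau>" using step by (simp add: strict_mono_Suc_iff)
  have "\<tau> 0 = 0"
  proof -
    obtain k where k: "\<tau> k = 0" using ex assms(2) by blast
    have "\<tau> 0 \<in> T" using xs(1) len by (auto simp: \<tau>_def)
    then have "0 \<le> \<tau> 0" using assms by auto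
    moreover have "\<tau> 0 \<le> \<tau> k" using mono by (simp add: strict_mono_less_eq)
    ultimately show ?thesis using k by simp
  qed
  with mono ex show ?thesis by blast
qed

lemma brownian_along_increments:
  assumes X: "brownian_along s M X"
    and \<tau>: "strict_mono \<tau>" "\<tau> 0 = 0" "\<tau> m = s" "m \<le> n"
  shows "distr M (\<Pi>\<^sub>M i\<in>{..<n}. borel) (\<lambda>\<omega>. \<lambda>i\<in>{..<n}. X (\<tau> (Suc i)) \<omega> - X (\<tau> i) \<omega>) =
    (\<Pi>\<^sub>M i\<in>{..<n}. gauss (\<tau> (Suc i) - \<tau> i))" (is "distr M ?P ?D = _")
proof -
  have pos: "0 \<le> \<tau> i" for i using \<tau> by (metis strict_mono_less_eq zero_le)
  have meas: "X t \<in> borel_measurable M" if "0 \<le> t" for t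
    using X that by (simp add: brownian_along_def)
  have [measurable]: "X (\<tau> i) \<in> borel_measurable M" for i using meas[OF pos] .
  have D: "?D \<in> M \<rightarrow>\<^sub>M ?P" by (intro measurable_restrict) measurable
  have sg: "prob_space (gauss (\<tau> (Suc i) - \<tau> i))" for i
    using \<tau> by (intro prob_space_gauss) (simp add: strict_mono_def)
  interpret product_sigma_finite "\<lambda>i. gauss (\<tau> (Suc i) - \<tau> i)"
    unfolding product_sigma_finite_def using sg by (simp add: prob_space_imp_sigma_finite)
  show ?thesis
  proof (rule PiM_eqI)
    fix A :: "nat \<Rightarrow> real set" assume A: "\<And>i. i \<in> {..<n} \<Longrightarrow> A i \<in> sets (gauss (\<tau> (Suc i) - \<tau> i))"
    define A' where "A' i = (if i < n then A i else {})" for i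
    have A_borel: "A i \<in> sets borel" if "i < n" for i using A[of i] that by simp
    then have A': "\<forall>i. A' i \<in> sets borel" by (simp add: A'_def)
    have "Pi\<^sub>E {..<n} A \<in> sets ?P" using A_borel by (intro sets_PiM_I_finite) simp_all
    from emeasure_distr[OF D this]
    have "emeasure (distr M ?P ?D) (Pi\<^sub>E {..<n} A) = emeasure M (?D -` Pi\<^sub>E {..<n} A \<inter> space M)" .
    also have "?D -` Pi\<^sub>E {..<n} A \<inter> space M =
        {\<omega>\<in>space M. \<forall>i<n. X (\<tau> (Suc i)) \<omega> - X (\<tau> i) \<omega> \<in> A' i}"
      unfolding A'_def by (intro set_eqI) (simp add: Pi_iff Ball_def conj_commute cong: conj_cong)
    also have "emeasure M \<dots> = (\<Prod>i<n. emeasure (gauss (\<tau> (Suc i) - \<tau> i)) (A' i))"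
      using X \<tau> A' unfolding brownian_along_def by blast
    also have "\<dots> = (\<Prod>i<n. emeasure (gauss (\<tau> (Suc i) - \<tau> i)) (A i))"
      by (intro prod.cong) (auto simp: A'_def)
    finally show "emeasure (distr M ?P ?D) (Pi\<^sub>E {..<n} A) =
        (\<Prod>i<n. emeasure (gauss (\<tau> (Suc i) - \<tau> i)) (A i))" .
  qed (auto intro!: sets_PiM_cong)
qed

lemma telescope_increments:
  fixes X :: "real \<Rightarrow> 'w \<Rightarrow> real"
  assumes "X (\<tau> 0) \<omega> = 0" "k \<le> n"
  shows "(\<Sum>i<k. (\<lambda>i\<in>{..<n}. X (\<tau> (Suc i)) \<omega> - X (\<tau> i) \<omega>) i) = X (\<tau> k) \<omega>"
proof -
  have "(\<Sum>i<k. (\<lambda>i\<in>{..<n}. X (\<tau> (Suc i)) \<omega> - X (\<tau> i) \<omega>) i) = (\<Sum>i<k. X (\<tau> (Suc i)) \<omega> - X (\<tau> i) \<omega>)"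
    using assms by (intro sum.cong) auto
  then show ?thesis using assms by (simp add: sum_lessThan_telescope[of "\<lambda>i. X (\<tau> i) \<omega>"])
qed

text \<open>
  Enlarge a finite set of times to a partition through \<open>0\<close> and \<open>s\<close>. The values of the process are then
  partial sums of increments, whose joint law is a prescribed product measure.
\<close>

lemma brownian_law_unique:
  fixes M :: "'v measure" and N :: "'w measure"
  assumes X: "brownian_along s M X" and Y: "brownian_along s N Y" and s: "0 \<le> s"
  shows "path_law M X = path_law N Y"
  unfolding path_law_def
proof (rule measure_eqI_PiM_infinite)
  show "sets (distr M path_space (path_of X)) = sets (\<Pi>\<^sub>M t\<in>{0..}. borel)"
    "sets (distr N path_space (path_of Y)) = sets (\<Pi>\<^sub>M t\<in>{0..}. borel)"
    by (auto simp: path_space_def)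
  have mX: "path_of X \<in> M \<rightarrow>\<^sub>M path_space" and mY: "path_of Y \<in> N \<rightarrow>\<^sub>M path_space"
    using X Y by (auto simp: brownian_along_def intro!: measurable_path_of)
  show "finite_measure (distr M path_space (path_of X))"
    using X mX by (auto simp: brownian_along_def intro!: prob_space.finite_measure prob_space.prob_space_distr)
  fix A :: "real \<Rightarrow> real set" and J :: "real set"
  assume J: "finite J" "J \<subseteq> {0..}" and A: "\<And>i. i \<in> J \<Longrightarrow> A i \<in> sets borel"
  have T: "finite (insert 0 (insert s J))" "0 \<in> insert 0 (insert s J)" "insert 0 (insert s J) \<subseteq> {0..}"
    using J s by auto
  obtain \<tau> :: "nat \<Rightarrow> real" and n where \<tau>: "strict_mono \<tau>" "\<tau> 0 = 0"
    and ex: "\<forall>x\<in>insert 0 (insert s J). \<exists>k\<le>n. \<tau> k = x"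
    using strict_mono_enumeration[OF T] by blast
  obtain m where m: "m \<le> n" "\<tau> m = s" using bspec[OF ex, of s] by blast
  have "\<forall>j\<in>J. \<exists>k. k \<le> n \<and> \<tau> k = j" using ex by simp
  from bchoice[OF this] obtain idx where idx: "\<And>j. j \<in> J \<Longrightarrow> idx j \<le> n \<and> \<tau> (idx j) = j" by auto
  let ?P = "\<Pi>\<^sub>M i\<in>{..<n}. (borel :: real measure)"
  define G where "G = {x \<in> space ?P. \<forall>j\<in>J. (\<Sum>i<idx j. x i) \<in> A j}"
  have G: "G \<in> sets ?P"
    unfolding G_def
  proof (rule sets.sets_Collect_finite_All[OF _ J(1)])
    fix j assume j: "j \<in> J"
    have [measurable]: "A j \<in> sets borel" using A[OF j] .
    have [measurable]: "(\<lambda>x. x i) \<in> borel_measurable ?P" if "i < idx j" for i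
      using that idx[OF j] by (intro measurable_component_singleton) auto
    have "(\<lambda>x. \<Sum>i<idx j. x i) \<in> borel_measurable ?P" by (intro borel_measurable_sum) auto
    then show "{x \<in> space ?P. (\<Sum>i<idx j. x i) \<in> A j} \<in> sets ?P" by measurable
  qed
  have key: "emeasure (distr K path_space (path_of Z)) (prod_emb {0..} (\<lambda>_. borel) J (Pi\<^sub>E J A)) =
      emeasure (\<Pi>\<^sub>M i\<in>{..<n}. gauss (\<tau> (Suc i) - \<tau> i)) G"
    if Z: "brownian_along s K Z" for K :: "'z measure" and Z
  proof -
    let ?D = "\<lambda>\<omega>. \<lambda>i\<in>{..<n}. Z (\<tau> (Suc i)) \<omega> - Z (\<tau> i) \<omega>"
    have pos: "0 \<le> \<tau> i" for i using \<tau> by (metis strict_mono_less_eq zero_le)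
    have [measurable]: "Z (\<tau> i) \<in> borel_measurable K" for i
      using Z pos by (simp add: brownian_along_def)
    have D: "?D \<in> K \<rightarrow>\<^sub>M ?P" by (intro measurable_restrict) measurable
    have mZ: "path_of Z \<in> K \<rightarrow>\<^sub>M path_space"
      using Z by (auto simp: brownian_along_def intro!: measurable_path_of)
    have "emeasure (distr K path_space (path_of Z)) (prod_emb {0..} (\<lambda>_. borel) J (Pi\<^sub>E J A)) =
        emeasure K (path_of Z -` prod_emb {0..} (\<lambda>_. borel) J (Pi\<^sub>E J A) \<inter> space K)"
      using J A by (intro emeasure_distr mZ) (auto simp: path_space_def intro!: sets_PiM_I)
    also have "path_of Z -` prod_emb {0..} (\<lambda>_. borel) J (Pi\<^sub>E J A) \<inter> space K = ?D -` G \<inter> space K"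
    proof (intro set_eqI)
      fix \<omega>
      have *: "(\<Sum>i<idx j. ?D \<omega> i) = Z j \<omega>" if "j \<in> J" "\<omega> \<in> space K" for j
        using telescope_increments[of Z \<tau> \<omega> "idx j" n] that idx[of j] Z \<tau>(2)
        by (simp add: brownian_along_def)
      have "\<omega> \<in> path_of Z -` prod_emb {0..} (\<lambda>_. borel) J (Pi\<^sub>E J A) \<inter> space K \<longleftrightarrow>
          \<omega> \<in> space K \<and> (\<forall>j\<in>J. Z j \<omega> \<in> A j)"
        using J by (auto simp: prod_emb_def path_of_def PiE_iff subset_iff)
      also have "\<dots> \<longleftrightarrow> \<omega> \<in> ?D -` G \<inter> space K"
        using * by (auto simp: G_def space_PiM)
      finally show "\<omega> \<in> path_of Z -` prod_emb {0..} (\<lambda>_. borel) J (Pi\<^sub>E J A) \<inter> space K \<longleftrightarrow>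
        \<omega> \<in> ?D -` G \<inter> space K" .
    qed
    also have "emeasure K (?D -` G \<inter> space K) = emeasure (distr K ?P ?D) G"
      using D G by (simp add: emeasure_distr)
    finally show ?thesis using brownian_along_increments[OF Z \<tau> m(2,1)] by simp
  qed
  show "emeasure (distr M path_space (path_of X)) (prod_emb {0..} (\<lambda>_. borel) J (Pi\<^sub>E J A)) =
      emeasure (distr N path_space (path_of Y)) (prod_emb {0..} (\<lambda>_. borel) J (Pi\<^sub>E J A))"
    unfolding key[OF X] key[OF Y] ..
qed

context standard_brownian_motion
begin

lemma increment_law:
  assumes "0 \<le> s" "s < t"
  shows "distr M borel (\<lambda>\<omega>. B t \<omega> - B s \<omega>) = gauss (t - s)"
proof -
  have "distr M lborel (\<lambda>\<omega>. B t \<omega> - B s \<omega>) = gauss (t - s)"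
    using normal_increments[OF assms] by (simp add: distributed_def gauss_def)
  moreover have "distr M lborel (\<lambda>\<omega>. B t \<omega> - B s \<omega>) = distr M borel (\<lambda>\<omega>. B t \<omega> - B s \<omega>)"
    by (rule distr_cong) auto
  ultimately show ?thesis by simp
qed

lemma emeasure_increments:
  fixes \<tau> :: "nat \<Rightarrow> real"
  assumes \<tau>: "0 \<le> \<tau> 0" "strict_mono \<tau>" and A: "\<And>i. A i \<in> sets borel"
  shows "emeasure M {\<omega>\<in>space M. \<forall>i<n. B (\<tau> (Suc i)) \<omega> - B (\<tau> i) \<omega> \<in> A i} =
    (\<Prod>i<n. emeasure (gauss (\<tau> (Suc i) - \<tau> i)) (A i))"
proof -
  have pos: "0 \<le> \<tau> i" for i using \<tau> by (meson order_trans strict_mono_less_eq zero_le)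
  have [measurable]: "B (\<tau> i) \<in> borel_measurable M" for i using random_variable_B[OF pos] .
  have [measurable]: "A i \<in> sets borel" for i by (rule A)
  have lt: "\<tau> i < \<tau> (Suc i)" for i using \<tau> by (simp add: strict_mono_def)
  let ?I = "\<lambda>i \<omega>. indicator (A i) (B (\<tau> (Suc i)) \<omega> - B (\<tau> i) \<omega>) :: ennreal"
  have "indep_vars (\<lambda>_. borel) (\<lambda>i. ?I i) {..<n}"
    by (rule indep_vars_compose2[OF indep_increments[OF \<tau>, of n], where Y="\<lambda>i. indicator (A i)"])
      measurable
  then have "(\<integral>\<^sup>+\<omega>. (\<Prod>i<n. ?I i \<omega>) \<partial>M) = (\<Prod>i<n. \<integral>\<^sup>+\<omega>. ?I i \<omega> \<partial>M)"
    by (intro indep_vars_nn_integral) auto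
  also have "(\<Prod>i<n. \<integral>\<^sup>+\<omega>. ?I i \<omega> \<partial>M) = (\<Prod>i<n. emeasure (gauss (\<tau> (Suc i) - \<tau> i)) (A i))"
  proof (intro prod.cong refl)
    fix i
    have "(\<integral>\<^sup>+\<omega>. ?I i \<omega> \<partial>M) = (\<integral>\<^sup>+x. indicator (A i) x \<partial>distr M borel (\<lambda>\<omega>. B (\<tau> (Suc i)) \<omega> - B (\<tau> i) \<omega>))"
      by (subst nn_integral_distr) auto
    also have "\<dots> = emeasure (gauss (\<tau> (Suc i) - \<tau> i)) (A i)"
      unfolding increment_law[OF pos lt] by simp
    finally show "(\<integral>\<^sup>+\<omega>. ?I i \<omega> \<partial>M) = emeasure (gauss (\<tau> (Suc i) - \<tau> i)) (A i)" .
  qed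
  also have "(\<integral>\<^sup>+\<omega>. (\<Prod>i<n. ?I i \<omega>) \<partial>M) =
      (\<integral>\<^sup>+\<omega>. indicator {\<omega>\<in>space M. \<forall>i<n. B (\<tau> (Suc i)) \<omega> - B (\<tau> i) \<omega> \<in> A i} \<omega> \<partial>M)"
    by (intro nn_integral_cong) (auto simp: indicator_def prod_zero_iff)
  also have "\<dots> = emeasure M {\<omega>\<in>space M. \<forall>i<n. B (\<tau> (Suc i)) \<omega> - B (\<tau> i) \<omega> \<in> A i}"
    by (intro nn_integral_indicator) measurable
  finally show ?thesis by simp
qed

lemma brownian_along: "brownian_along s M B"
  unfolding brownian_along_def
  using random_variable_B start_zero emeasure_increments prob_space_axioms by auto

lemma measurable_path_B: "path_of B \<in> M \<rightarrow>\<^sub>M path_space"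
  by (intro measurable_path_of random_variable_B)

end

section \<open>Level sets as functions of the path\<close>

text \<open>
  For a continuous path this is the level set. The definition reads the path at rational times only,
  which makes it a measurable function on the space of all paths.
\<close>

definition zset :: "real \<Rightarrow> real \<Rightarrow> (real \<Rightarrow> real) \<Rightarrow> real set" where
  "zset t a w = {x\<in>{0..t}. \<forall>e>0. \<exists>q\<in>\<rat> \<inter> {0..t}. \<bar>q - x\<bar> < e \<and> \<bar>w q - a\<bar> < e}"

lemma zset_cong: "(\<And>s. s \<in> {0..t} \<Longrightarrow> w s = w' s) \<Longrightarrow> zset t a w = zset t a w'"
  unfolding zset_def by (intro Collect_cong conj_cong all_cong bex_cong refl) auto

lemma zset_closed: "zset t a w \<in> closed_subsets t"
proof -
  have "x \<in> zset t a w" if x: "x \<in> closure (zset t a w)" for x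
  proof -
    have "zset t a w \<subseteq> {0..t}" by (auto simp: zset_def)
    then have "x \<in> {0..t}" using x closure_minimal[of "zset t a w" "{0..t}"] by auto
    moreover have "\<exists>q\<in>\<rat> \<inter> {0..t}. \<bar>q - x\<bar> < e \<and> \<bar>w q - a\<bar> < e" if "e > 0" for e
    proof -
      obtain y where y: "y \<in> zset t a w" "dist y x < e / 2"
        using x \<open>e > 0\<close> unfolding closure_approachable by (meson half_gt_zero)
      then obtain q where q: "q \<in> \<rat> \<inter> {0..t}" "\<bar>q - y\<bar> < e / 2" "\<bar>w q - a\<bar> < e / 2"
        using \<open>e > 0\<close> unfolding zset_def by (auto dest!: spec[of _ "e / 2"])
      have "\<bar>q - x\<bar> < e" using y(2) q(2) unfolding dist_real_def by linarith
      moreover have "\<bar>w q - a\<bar> < e" using q(3) \<open>e > 0\<close> by linarith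
      ultimately show ?thesis using q(1) by blast
    qed
    ultimately show ?thesis by (auto simp: zset_def)
  qed
  then have "closed (zset t a w)" by (simp add: closure_subset_eq[symmetric] subsetI)
  then show ?thesis by (auto simp: closed_subsets_def zset_def)
qed

text \<open>
  By compactness, approximate hits near \<open>[p,q]\<close> at every scale accumulate at a genuine one. The right-hand
  side involves countably many coordinates only.
\<close>

lemma zset_hit_iff:
  "zset t a w \<inter> {p..q} \<noteq> {} \<longleftrightarrow> (\<forall>n::nat. \<exists>r\<in>\<rat> \<inter> {0..t} \<inter> {p - 1 / real (Suc n)<..<q + 1 / real (Suc n)}.
      \<bar>w r - a\<bar> < 1 / real (Suc n))" (is "?L \<longleftrightarrow> ?R")
proof
  assume ?L
  then obtain x where x: "x \<in> zset t a w" "p \<le> x" "x \<le> q" by auto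
  show ?R
  proof
    fix n :: nat
    have pos: "0 < 1 / real (Suc n)" by simp
    then obtain r where "r \<in> \<rat> \<inter> {0..t}" "\<bar>r - x\<bar> < 1 / real (Suc n)" "\<bar>w r - a\<bar> < 1 / real (Suc n)"
      using x(1) unfolding zset_def by blast
    moreover from this have "r \<in> {p - 1 / real (Suc n)<..<q + 1 / real (Suc n)}"
      unfolding greaterThanLessThan_iff using x(2,3) by linarith
    ultimately show "\<exists>r\<in>\<rat> \<inter> {0..t} \<inter> {p - 1 / real (Suc n)<..<q + 1 / real (Suc n)}.
      \<bar>w r - a\<bar> < 1 / real (Suc n)" by blast
  qed
next
  assume ?R
  then obtain r where r: "\<And>n::nat. r n \<in> \<rat> \<inter> {0..t} \<inter> {p - 1 / real (Suc n)<..<q + 1 / real (Suc n)}"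
      "\<And>n. \<bar>w (r n) - a\<bar> < 1 / real (Suc n)"
    by metis
  have "compact {0..t}" by simp
  moreover have "\<forall>n. r n \<in> {0..t}" using r(1) by blast
  ultimately obtain x \<sigma> where x: "x \<in> {0..t}" "strict_mono (\<sigma> :: nat \<Rightarrow> nat)" "(r \<circ> \<sigma>) \<longlonglongrightarrow> x"
    unfolding compact_def by blast
  have inv0: "(\<lambda>n. 1 / real (Suc (\<sigma> n))) \<longlonglongrightarrow> 0"
    using LIMSEQ_subseq_LIMSEQ[OF LIMSEQ_inverse_real_of_nat x(2)] by (simp add: o_def inverse_eq_divide)
  have "p - 0 \<le> x"
  proof (rule LIMSEQ_le[OF tendsto_diff[OF tendsto_const inv0] x(3)], intro exI allI impI)
    fix n show "p - 1 / real (Suc (\<sigma> n)) \<le> (r \<circ> \<sigma>) n" using r(1)[of "\<sigma> n"] by auto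
  qed
  moreover have "x \<le> q + 0"
  proof (rule LIMSEQ_le[OF x(3) tendsto_add[OF tendsto_const inv0]], intro exI allI impI)
    fix n show "(r \<circ> \<sigma>) n \<le> q + 1 / real (Suc (\<sigma> n))" using r(1)[of "\<sigma> n"] by auto
  qed
  moreover have "\<exists>q\<in>\<rat> \<inter> {0..t}. \<bar>q - x\<bar> < e \<and> \<bar>w q - a\<bar> < e" if "e > 0" for e
  proof -
    have "\<forall>\<^sub>F n in sequentially. \<bar>r (\<sigma> n) - x\<bar> < e"
      using tendstoD[OF x(3) that] by (simp add: dist_real_def)
    moreover have "\<forall>\<^sub>F n in sequentially. 1 / real (Suc (\<sigma> n)) < e"
      using order_tendstoD(2)[OF inv0 that] .
    ultimately have "\<forall>\<^sub>F n in sequentially. \<bar>r (\<sigma> n) - x\<bar> < e \<and> 1 / real (Suc (\<sigma> n)) < e"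
      by eventually_elim blast
    then obtain n where "\<bar>r (\<sigma> n) - x\<bar> < e" "1 / real (Suc (\<sigma> n)) < e"
      unfolding eventually_sequentially by blast
    then show ?thesis using r(1)[of "\<sigma> n"] r(2)[of "\<sigma> n"] by (intro bexI[of _ "r (\<sigma> n)"]) auto
  qed
  ultimately have "x \<in> zset t a w \<inter> {p..q}" using x(1) by (simp add: zset_def)
  then show ?L by blast
qed

lemma measurable_zset [measurable]:
  assumes t: "0 < t"
  shows "zset t a \<in> path_space \<rightarrow>\<^sub>M closed_sets_space t"
proof (rule measurable_closed_setsI[OF t zset_closed])
  fix p q :: real
  have cnt: "countable (\<rat> \<inter> {0..t} \<inter> {p - 1 / real (Suc n)<..<q + 1 / real (Suc n)})" for n
    by (intro countable_Int1 countable_rat)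
  have "{w \<in> space path_space. \<forall>n::nat. \<exists>r\<in>\<rat> \<inter> {0..t} \<inter> {p - 1 / real (Suc n)<..<q + 1 / real (Suc n)}.
      \<bar>w r - a\<bar> < 1 / real (Suc n)} \<in> sets path_space"
  proof (rule sets.sets_Collect_countable_All)
    fix n :: nat
    have eq: "{w \<in> space path_space. \<exists>r\<in>\<rat> \<inter> {0..t} \<inter> {p - 1 / real (Suc n)<..<q + 1 / real (Suc n)}.
        \<bar>w r - a\<bar> < 1 / real (Suc n)} = (\<Union>r\<in>\<rat> \<inter> {0..t} \<inter> {p - 1 / real (Suc n)<..<q + 1 / real (Suc n)}.
        {w \<in> space path_space. \<bar>w r - a\<bar> < 1 / real (Suc n)})" by blast
    show "{w \<in> space path_space. \<exists>r\<in>\<rat> \<inter> {0..t} \<inter> {p - 1 / real (Suc n)<..<q + 1 / real (Suc n)}.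
        \<bar>w r - a\<bar> < 1 / real (Suc n)} \<in> sets path_space"
      unfolding eq
    proof (rule sets.countable_UN'[OF cnt image_subsetI])
      fix r assume "r \<in> \<rat> \<inter> {0..t} \<inter> {p - 1 / real (Suc n)<..<q + 1 / real (Suc n)}"
      then have [measurable]: "(\<lambda>w. w r) \<in> borel_measurable path_space"
        by (intro measurable_path_component) auto
      show "{w \<in> space path_space. \<bar>w r - a\<bar> < 1 / real (Suc n)} \<in> sets path_space" by measurable
    qed
  qed
  then show "{w \<in> space path_space. zset t a w \<inter> {p..q} \<noteq> {}} \<in> sets path_space"
    unfolding zset_hit_iff .
qed

lemma rational_near:
  fixes x :: real
  assumes "x \<in> {0..t}" "0 < t" "0 < d"
  shows "\<exists>q\<in>\<rat> \<inter> {0..t}. \<bar>q - x\<bar> < d"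
proof -
  have "max 0 (x - d) < min t (x + d)" using assms by auto
  then obtain q where "q \<in> \<rat>" "max 0 (x - d) < q" "q < min t (x + d)"
    using Rats_dense_in_real by blast
  then show ?thesis by (intro bexI[of _ q]) auto
qed

lemma zset_continuous:
  assumes w: "continuous_on {0..t} w" and t: "0 < t"
  shows "zset t a w = {s\<in>{0..t}. w s = a}"
proof (intro set_eqI iffI)
  fix x assume x: "x \<in> zset t a w"
  then have xt: "x \<in> {0..t}" by (simp add: zset_def)
  have "\<bar>w x - a\<bar> \<le> e" if "e > 0" for e
  proof -
    obtain d where d: "d > 0" "\<And>y. y \<in> {0..t} \<Longrightarrow> dist y x < d \<Longrightarrow> dist (w y) (w x) < e / 2"
      using w xt \<open>e > 0\<close> unfolding continuous_on_iff by (meson half_gt_zero)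
    have "min d (e / 2) > 0" using d(1) that by simp
    then obtain q where "q \<in> \<rat> \<inter> {0..t}" "\<bar>q - x\<bar> < min d (e / 2)" "\<bar>w q - a\<bar> < min d (e / 2)"
      using x unfolding zset_def by blast
    moreover from this have "\<bar>w q - w x\<bar> < e / 2" using d(2)[of q] by (auto simp: dist_real_def)
    ultimately show ?thesis by linarith
  qed
  then have "\<bar>w x - a\<bar> \<le> 0" by (rule field_le_epsilon[of _ 0, simplified])
  then show "x \<in> {s\<in>{0..t}. w s = a}" using xt by auto
next
  fix x assume "x \<in> {s\<in>{0..t}. w s = a}"
  then have x: "x \<in> {0..t}" "w x = a" by auto
  have "\<exists>q\<in>\<rat> \<inter> {0..t}. \<bar>q - x\<bar> < e \<and> \<bar>w q - a\<bar> < e" if "e > 0" for e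
  proof -
    obtain d where d: "d > 0" "\<And>y. y \<in> {0..t} \<Longrightarrow> dist y x < d \<Longrightarrow> dist (w y) (w x) < e"
      using w x(1) \<open>e > 0\<close> unfolding continuous_on_iff by meson
    obtain q where "q \<in> \<rat> \<inter> {0..t}" "\<bar>q - x\<bar> < min d e"
      using rational_near[OF x(1) t, of "min d e"] d(1) \<open>e > 0\<close> by auto
    then show ?thesis using d(2)[of q] x(2) by (intro bexI[of _ q]) (auto simp: dist_real_def)
  qed
  then show "x \<in> zset t a w" using x by (simp add: zset_def)
qed

definition continuous_process :: "'w measure \<Rightarrow> (real \<Rightarrow> 'w \<Rightarrow> real) \<Rightarrow> bool" where
  "continuous_process M X \<longleftrightarrow> (\<forall>t\<ge>0. X t \<in> borel_measurable M) \<and>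
    (\<forall>\<omega>\<in>space M. continuous_on {0..} (\<lambda>t. X t \<omega>))"

lemma zset_path_of:
  assumes "continuous_process M X" "0 < t" "\<omega> \<in> space M"
  shows "zset t a (path_of X \<omega>) = {s\<in>{0..t}. X s \<omega> = a}"
proof -
  have "zset t a (path_of X \<omega>) = zset t a (\<lambda>s. X s \<omega>)"
    by (rule zset_cong) (auto simp: path_of_def)
  also have "\<dots> = {s\<in>{0..t}. X s \<omega> = a}"
  proof (rule zset_continuous[OF _ assms(2)])
    have "continuous_on {0..} (\<lambda>s. X s \<omega>)" using assms by (simp add: continuous_process_def)
    then show "continuous_on {0..t} (\<lambda>s. X s \<omega>)" by (rule continuous_on_subset) auto
  qed
  finally show ?thesis .
qed

lemma measurable_level_set:
  assumes X: "continuous_process M X" and t: "0 < t"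
  shows "(\<lambda>\<omega>. {s\<in>{0..t}. X s \<omega> = a}) \<in> M \<rightarrow>\<^sub>M closed_sets_space t"
proof -
  have "path_of X \<in> M \<rightarrow>\<^sub>M path_space"
    using X by (intro measurable_path_of) (auto simp: continuous_process_def)
  then have "(\<lambda>\<omega>. zset t a (path_of X \<omega>)) \<in> M \<rightarrow>\<^sub>M closed_sets_space t"
    by (rule measurable_compose[OF _ measurable_zset[OF t]])
  then show ?thesis
    using measurable_cong[of M "\<lambda>\<omega>. zset t a (path_of X \<omega>)" "\<lambda>\<omega>. {s\<in>{0..t}. X s \<omega> = a}"]
      zset_path_of[OF X t] by blast
qed

lemma level_set_law_path:
  assumes X: "continuous_process M X" and t: "0 < t"
  shows "level_set_law M X t a = distr (path_law M X) (closed_sets_space t) (zset t a)"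
proof -
  have "path_of X \<in> M \<rightarrow>\<^sub>M path_space"
    using X by (intro measurable_path_of) (auto simp: continuous_process_def)
  then have "distr (path_law M X) (closed_sets_space t) (zset t a) =
      distr M (closed_sets_space t) (zset t a \<circ> path_of X)"
    unfolding path_law_def by (intro distr_distr measurable_zset[OF t])
  also have "\<dots> = level_set_law M X t a"
    unfolding level_set_law_def by (intro distr_cong refl) (simp add: zset_path_of[OF X t])
  finally show ?thesis ..
qed

lemma level_set_law_unique:
  fixes M :: "'v measure" and N :: "'w measure"
  assumes "brownian_along s M X" "brownian_along s N Y" "0 \<le> s"
    "continuous_process M X" "continuous_process N Y" "0 < t"
  shows "level_set_law M X t a = level_set_law N Y t a"
  unfolding level_set_law_path[OF assms(4,6)] level_set_law_path[OF assms(5,6)]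
    brownian_law_unique[OF assms(1-3)] ..

section \<open>Transformations of Brownian motion\<close>

lemma emeasure_gauss_scale:
  assumes v: "0 < v" and k: "k \<noteq> 0" and A: "A \<in> sets borel"
  shows "emeasure (gauss (k\<^sup>2 * v)) A = emeasure (gauss v) {x. k * x \<in> A}"
proof -
  have [measurable]: "A \<in> sets borel" by (rule A)
  have dens: "normal_density 0 (sqrt (k\<^sup>2 * v)) (k * x) = normal_density 0 (sqrt v) x / \<bar>k\<bar>" for x
  proof -
    have "- (k * x)\<^sup>2 / (2 * (k\<^sup>2 * v)) = - x\<^sup>2 / (2 * v)"
      using k by (simp add: power_mult_distrib)
    moreover have "sqrt (2 * pi * (k\<^sup>2 * v)) = \<bar>k\<bar> * sqrt (2 * pi * v)"
      by (simp add: real_sqrt_mult)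
    ultimately show ?thesis using v by (simp add: normal_density_def)
  qed
  have "emeasure (gauss (k\<^sup>2 * v)) A = (\<integral>\<^sup>+x. ennreal (normal_density 0 (sqrt (k\<^sup>2 * v)) x) * indicator A x \<partial>lborel)"
    unfolding gauss_def by (subst emeasure_density) auto
  also have "\<dots> = \<bar>k\<bar> * (\<integral>\<^sup>+x. ennreal (normal_density 0 (sqrt (k\<^sup>2 * v)) (0 + k * x)) * indicator A (0 + k * x) \<partial>lborel)"
    using k by (intro nn_integral_real_affine) auto
  also have "\<dots> = (\<integral>\<^sup>+x. \<bar>k\<bar> * (ennreal (normal_density 0 (sqrt v) x / \<bar>k\<bar>) * indicator {x. k * x \<in> A} x) \<partial>lborel)"
    by (subst nn_integral_cmult[symmetric]) (auto simp: dens indicator_def)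
  also have "\<dots> = (\<integral>\<^sup>+x. ennreal (normal_density 0 (sqrt v) x) * indicator {x. k * x \<in> A} x \<partial>lborel)"
    using k by (intro nn_integral_cong) (auto simp: ennreal_mult[symmetric] indicator_def)
  also have "\<dots> = emeasure (gauss v) {x. k * x \<in> A}"
    unfolding gauss_def by (subst emeasure_density) auto
  finally show ?thesis .
qed

text \<open>
  Completing the square: the exponentially tilted Gaussian density is the density shifted by \<open>\<kappa> v\<close>.
\<close>

lemma gauss_exponential_tilt:
  assumes v: "0 < v" and A: "A \<in> sets borel"
  shows "(\<integral>\<^sup>+x. indicator A (x - \<kappa> * v) * ennreal (exp (\<kappa> * x - \<kappa>\<^sup>2 * v / 2)) \<partial>gauss v) =
    emeasure (gauss v) A"
proof -
  have [measurable]: "A \<in> sets borel" by (rule A)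
  let ?\<phi> = "normal_density 0 (sqrt v)"
  have dens: "?\<phi> (\<kappa> * v + x) * exp (\<kappa> * (\<kappa> * v + x) - \<kappa>\<^sup>2 * v / 2) = ?\<phi> x" for x
  proof -
    have "- (\<kappa> * v + x)\<^sup>2 / (2 * v) + (\<kappa> * (\<kappa> * v + x) - \<kappa>\<^sup>2 * v / 2) = - x\<^sup>2 / (2 * v)"
      using v by (simp add: power2_eq_square field_simps)
    then have "exp (- (\<kappa> * v + x)\<^sup>2 / (2 * v)) * exp (\<kappa> * (\<kappa> * v + x) - \<kappa>\<^sup>2 * v / 2) = exp (- x\<^sup>2 / (2 * v))"
      by (simp only: exp_add[symmetric])
    then show ?thesis using v by (simp add: normal_density_def)
  qed
  have "(\<integral>\<^sup>+x. indicator A (x - \<kappa> * v) * ennreal (exp (\<kappa> * x - \<kappa>\<^sup>2 * v / 2)) \<partial>gauss v) =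
      (\<integral>\<^sup>+x. ennreal (?\<phi> x) * (indicator A (x - \<kappa> * v) * ennreal (exp (\<kappa> * x - \<kappa>\<^sup>2 * v / 2))) \<partial>lborel)"
    unfolding gauss_def by (subst nn_integral_density) auto
  also have "\<dots> = ennreal \<bar>1\<bar> * (\<integral>\<^sup>+x. ennreal (?\<phi> (\<kappa> * v + 1 * x)) * (indicator A (\<kappa> * v + 1 * x - \<kappa> * v) *
      ennreal (exp (\<kappa> * (\<kappa> * v + 1 * x) - \<kappa>\<^sup>2 * v / 2))) \<partial>lborel)"
    by (rule nn_integral_real_affine) auto
  also have "\<dots> = (\<integral>\<^sup>+x. ennreal (?\<phi> x) * indicator A x \<partial>lborel)"
  proof -
    have "ennreal (?\<phi> (\<kappa> * v + x)) * (indicator A x * ennreal (exp (\<kappa> * (\<kappa> * v + x) - \<kappa>\<^sup>2 * v / 2))) =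
        ennreal (?\<phi> x) * indicator A x" for x
      unfolding dens[of x, symmetric]
      by (simp add: ennreal_mult mult_ac)
    then show ?thesis by simp
  qed
  also have "\<dots> = emeasure (gauss v) A" unfolding gauss_def by (subst emeasure_density) auto
  finally show ?thesis .
qed

context standard_brownian_motion
begin

lemma continuous_process_B: "continuous_process M B"
  using random_variable_B continuous_paths by (simp add: continuous_process_def)

text \<open>
  The reflection of Brownian motion is the case \<open>k = -1\<close>, its scaling by \<open>c > 0\<close> the case \<open>k = sqrt c\<close>.
\<close>

lemma
  assumes k: "k \<noteq> 0"
  shows brownian_scaled: "brownian_along 0 M (\<lambda>t \<omega>. k * B (t / k\<^sup>2) \<omega>)"
    and continuous_scaled: "continuous_process M (\<lambda>t \<omega>. k * B (t / k\<^sup>2) \<omega>)"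
proof -
  have k2: "k\<^sup>2 > 0" using k by simp
  show "continuous_process M (\<lambda>t \<omega>. k * B (t / k\<^sup>2) \<omega>)"
    unfolding continuous_process_def
  proof (intro conjI allI impI ballI)
    fix t :: real assume "0 \<le> t"
    then have [measurable]: "B (t / k\<^sup>2) \<in> borel_measurable M" using k2 by (intro random_variable_B) simp
    show "(\<lambda>\<omega>. k * B (t / k\<^sup>2) \<omega>) \<in> borel_measurable M" by measurable
  next
    fix \<omega> assume "\<omega> \<in> space M"
    then have "continuous_on {0..} ((\<lambda>t. B t \<omega>) \<circ> (\<lambda>t. t / k\<^sup>2))"
      using k2 by (intro continuous_on_compose continuous_intros continuous_on_subset[OF continuous_paths]) auto
    then show "continuous_on {0..} (\<lambda>t. k * B (t / k\<^sup>2) \<omega>)"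
      by (intro continuous_intros) (simp add: o_def)
  qed
  then have meas: "(\<lambda>\<omega>. k * B (t / k\<^sup>2) \<omega>) \<in> borel_measurable M" if "0 \<le> t" for t
    using that by (simp add: continuous_process_def)
  show "brownian_along 0 M (\<lambda>t \<omega>. k * B (t / k\<^sup>2) \<omega>)"
    unfolding brownian_along_def
  proof (intro conjI allI impI ballI prob_space_axioms)
    fix \<tau> :: "nat \<Rightarrow> real" and n m :: nat and A :: "nat \<Rightarrow> real set"
    assume \<tau>: "strict_mono \<tau>" "\<tau> 0 = 0" and A: "\<forall>i. A i \<in> sets borel"
    define \<tau>' where "\<tau>' i = \<tau> i / k\<^sup>2" for i
    have \<tau>': "0 \<le> \<tau>' 0" "strict_mono \<tau>'"
      using \<tau> k2 by (auto simp: \<tau>'_def strict_mono_def divide_strict_right_mono)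
    have A': "{x. k * x \<in> A i} \<in> sets borel" for i
    proof -
      have [measurable]: "A i \<in> sets borel" using A by blast
      have "(\<lambda>x. k * x) -` A i \<inter> space borel \<in> sets borel" by measurable
      then show ?thesis by (simp add: vimage_def)
    qed
    have "emeasure M {\<omega> \<in> space M. \<forall>i<n. k * B (\<tau> (Suc i) / k\<^sup>2) \<omega> - k * B (\<tau> i / k\<^sup>2) \<omega> \<in> A i} =
        emeasure M {\<omega> \<in> space M. \<forall>i<n. B (\<tau>' (Suc i)) \<omega> - B (\<tau>' i) \<omega> \<in> {x. k * x \<in> A i}}"
      by (simp add: \<tau>'_def right_diff_distrib)
    also have "\<dots> = (\<Prod>i<n. emeasure (gauss (\<tau>' (Suc i) - \<tau>' i)) {x. k * x \<in> A i})"
      by (rule emeasure_increments[OF \<tau>' A'])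
    also have "\<dots> = (\<Prod>i<n. emeasure (gauss (\<tau> (Suc i) - \<tau> i)) (A i))"
    proof (intro prod.cong refl)
      fix i
      have "0 < \<tau>' (Suc i) - \<tau>' i" using \<tau>'(2) by (simp add: strict_mono_def)
      moreover have "k\<^sup>2 * (\<tau>' (Suc i) - \<tau>' i) = \<tau> (Suc i) - \<tau> i"
        using k by (simp add: \<tau>'_def right_diff_distrib)
      ultimately show "emeasure (gauss (\<tau>' (Suc i) - \<tau>' i)) {x. k * x \<in> A i} =
          emeasure (gauss (\<tau> (Suc i) - \<tau> i)) (A i)"
        using emeasure_gauss_scale[of "\<tau>' (Suc i) - \<tau>' i" k "A i"] k A by simp
    qed
    finally show "emeasure M {\<omega> \<in> space M. \<forall>i<n. k * B (\<tau> (Suc i) / k\<^sup>2) \<omega> - k * B (\<tau> i / k\<^sup>2) \<omega> \<in> A i} =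
        (\<Prod>i<n. emeasure (gauss (\<tau> (Suc i) - \<tau> i)) (A i))" .
  qed (use meas start_zero in auto)
qed

lemma level_set_law_uminus:
  assumes "0 < t"
  shows "level_set_law M B t (- a) = level_set_law M B t a"
proof -
  have "level_set_law M B t (- a) = level_set_law M (\<lambda>t \<omega>. - B t \<omega>) t a"
    unfolding level_set_law_def by (intro distr_cong refl) auto
  also have "\<dots> = level_set_law M B t a"
    using brownian_scaled[of "-1"] continuous_scaled[of "-1"] assms
    by (intro level_set_law_unique[OF _ brownian_along _ _ continuous_process_B]) auto
  finally show ?thesis .
qed

lemma level_set_law_scaling:
  assumes "0 < c" "0 < t"
  shows "level_set_law M B (c * t) a =
    distr (level_set_law M B t (a / sqrt c)) (closed_sets_space (c * t)) (dilate c)"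
proof -
  have "level_set_law M B (c * t) a = level_set_law M (\<lambda>t \<omega>. sqrt c * B (t / (sqrt c)\<^sup>2) \<omega>) (c * t) a"
    using brownian_scaled[of "sqrt c"] continuous_scaled[of "sqrt c"] assms
    by (intro level_set_law_unique[OF brownian_along _ _ continuous_process_B]) auto
  also have "\<dots> = distr M (closed_sets_space (c * t)) (dilate c \<circ> (\<lambda>\<omega>. {s\<in>{0..t}. B s \<omega> = a / sqrt c}))"
    unfolding level_set_law_def
  proof (intro distr_cong refl)
    fix \<omega>
    have "x \<in> {s \<in> {0..c * t}. sqrt c * B (s / (sqrt c)\<^sup>2) \<omega> = a} \<longleftrightarrow>
        x \<in> dilate c {s \<in> {0..t}. B s \<omega> = a / sqrt c}" for x
    proof -
      have "x \<in> dilate c {s \<in> {0..t}. B s \<omega> = a / sqrt c} \<longleftrightarrow> x / c \<in> {s \<in> {0..t}. B s \<omega> = a / sqrt c}"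
        using assms(1) by (auto simp: dilate_def image_iff intro!: exI[of _ "x / c"])
      also have "\<dots> \<longleftrightarrow> x \<in> {s \<in> {0..c * t}. sqrt c * B (s / (sqrt c)\<^sup>2) \<omega> = a}"
        using assms by (auto simp: field_simps)
      finally show ?thesis by blast
    qed
    then show "{s \<in> {0..c * t}. sqrt c * B (s / (sqrt c)\<^sup>2) \<omega> = a} =
        (dilate c \<circ> (\<lambda>\<omega>. {s \<in> {0..t}. B s \<omega> = a / sqrt c})) \<omega>" by auto
  qed
  also have "\<dots> = distr (level_set_law M B t (a / sqrt c)) (closed_sets_space (c * t)) (dilate c)"
    unfolding level_set_law_def using assms
    by (intro distr_distr[symmetric] measurable_dilate measurable_level_set continuous_process_B)
  finally show ?thesis .
qed

lemma continuous_process_shift: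
  "continuous_process (density M D) (\<lambda>t \<omega>. B t \<omega> - \<kappa> * min t \<epsilon>)"
  unfolding continuous_process_def
proof (intro conjI allI impI ballI)
  fix t :: real assume "0 \<le> t"
  then have [measurable]: "B t \<in> borel_measurable M" by (rule random_variable_B)
  show "(\<lambda>\<omega>. B t \<omega> - \<kappa> * min t \<epsilon>) \<in> borel_measurable (density M D)" by measurable
next
  fix \<omega> assume "\<omega> \<in> space (density M D)"
  then have "continuous_on {0..} (\<lambda>t. B t \<omega>)" by (simp add: continuous_paths)
  then show "continuous_on {0..} (\<lambda>t. B t \<omega> - \<kappa> * min t \<epsilon>)" by (intro continuous_intros)
qed

text \<open>
  Along a partition through \<open>\<epsilon>\<close> the density is a product over the increments before \<open>\<epsilon>\<close>, and each factor
  compensates for the shift of the mean of its increment.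
\<close>

lemma girsanov_increments:
  fixes \<tau> :: "nat \<Rightarrow> real"
  assumes \<tau>: "strict_mono \<tau>" "\<tau> 0 = 0" "\<tau> m = \<epsilon>" "m \<le> n" and A: "\<forall>i. A i \<in> sets borel"
  shows "emeasure (density M (\<lambda>\<omega>. ennreal (exp (\<kappa> * B \<epsilon> \<omega> - \<kappa>\<^sup>2 * \<epsilon> / 2))))
      {\<omega>\<in>space M. \<forall>i<n. (B (\<tau> (Suc i)) \<omega> - \<kappa> * min (\<tau> (Suc i)) \<epsilon>) - (B (\<tau> i) \<omega> - \<kappa> * min (\<tau> i) \<epsilon>) \<in> A i} =
    (\<Prod>i<n. emeasure (gauss (\<tau> (Suc i) - \<tau> i)) (A i))"
    (is "emeasure (density M ?D) ?E = _")
proof -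
  have pos: "0 \<le> \<tau> i" for i using \<tau> by (metis strict_mono_less_eq zero_le)
  have lt: "\<tau> i < \<tau> (Suc i)" for i using \<tau> by (simp add: strict_mono_def)
  have [measurable]: "B (\<tau> i) \<in> borel_measurable M" for i using random_variable_B[OF pos] .
  have [measurable]: "B \<epsilon> \<in> borel_measurable M" using random_variable_B[OF pos[of m]] \<tau>(3) by simp
  have [measurable]: "A i \<in> sets borel" for i using A by blast
  define v where "v i = \<tau> (Suc i) - \<tau> i" for i
  define f :: "nat \<Rightarrow> real \<Rightarrow> ennreal" where "f i x = (if i < m
    then indicator (A i) (x - \<kappa> * v i) * ennreal (exp (\<kappa> * x - \<kappa>\<^sup>2 * v i / 2)) else indicator (A i) x)" for i x
  let ?I = "\<lambda>i \<omega>. f i (B (\<tau> (Suc i)) \<omega> - B (\<tau> i) \<omega>)"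
  have [measurable]: "f i \<in> borel_measurable borel" for i unfolding f_def by (cases "i < m") simp_all
  have shift: "\<kappa> * min (\<tau> (Suc i)) \<epsilon> - \<kappa> * min (\<tau> i) \<epsilon> = (if i < m then \<kappa> * v i else 0)" for i
  proof (cases "i < m")
    case True
    then have "\<tau> i \<le> \<epsilon>" "\<tau> (Suc i) \<le> \<epsilon>" using \<tau>(3)[symmetric] True by (simp_all add: strict_mono_less_eq[OF \<tau>(1)])
    then show ?thesis using True by (simp add: v_def right_diff_distrib)
  next
    case False
    then have "\<epsilon> \<le> \<tau> i" "\<epsilon> \<le> \<tau> (Suc i)" using \<tau>(3)[symmetric] False by (simp_all add: strict_mono_less_eq[OF \<tau>(1)])
    then show ?thesis using False by simp
  qed
  have f_eq: "f i (B (\<tau> (Suc i)) \<omega> - B (\<tau> i) \<omega>) =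
      (if i < m then ennreal (exp (\<kappa> * (B (\<tau> (Suc i)) \<omega> - B (\<tau> i) \<omega>) - \<kappa>\<^sup>2 * v i / 2)) else 1) *
      indicator (A i) ((B (\<tau> (Suc i)) \<omega> - \<kappa> * min (\<tau> (Suc i)) \<epsilon>) - (B (\<tau> i) \<omega> - \<kappa> * min (\<tau> i) \<epsilon>))" for i \<omega>
  proof -
    have "(B (\<tau> (Suc i)) \<omega> - \<kappa> * min (\<tau> (Suc i)) \<epsilon>) - (B (\<tau> i) \<omega> - \<kappa> * min (\<tau> i) \<epsilon>) =
        (B (\<tau> (Suc i)) \<omega> - B (\<tau> i) \<omega>) - (if i < m then \<kappa> * v i else 0)"
      using shift[of i] by linarith
    then show ?thesis unfolding f_def by (cases "i < m") (simp_all only: if_True if_False mult.commute mult_1 mult_1_right diff_zero)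
  qed
  have dens: "?D \<omega> = (\<Prod>i<n. if i < m
      then ennreal (exp (\<kappa> * (B (\<tau> (Suc i)) \<omega> - B (\<tau> i) \<omega>) - \<kappa>\<^sup>2 * v i / 2)) else 1)"
    if \<omega>: "\<omega> \<in> space M" for \<omega>
  proof -
    have "(\<Sum>i<m. \<kappa> * (B (\<tau> (Suc i)) \<omega> - B (\<tau> i) \<omega>) - \<kappa>\<^sup>2 * v i / 2) =
        \<kappa> * (\<Sum>i<m. B (\<tau> (Suc i)) \<omega> - B (\<tau> i) \<omega>) - \<kappa>\<^sup>2 * (\<Sum>i<m. \<tau> (Suc i) - \<tau> i) / 2"
      unfolding v_def sum_distrib_left sum_divide_distrib by (rule sum_subtractf)
    also have "\<dots> = \<kappa> * B \<epsilon> \<omega> - \<kappa>\<^sup>2 * \<epsilon> / 2"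
      using start_zero[OF \<omega>] \<tau> by (simp add: sum_lessThan_telescope sum_lessThan_telescope[of "\<lambda>i. B (\<tau> i) \<omega>"])
    finally have "?D \<omega> = (\<Prod>i<m. ennreal (exp (\<kappa> * (B (\<tau> (Suc i)) \<omega> - B (\<tau> i) \<omega>) - \<kappa>\<^sup>2 * v i / 2)))"
      by (simp add: prod_ennreal exp_sum[symmetric])
    also have "\<dots> = (\<Prod>i<n. if i < m
      then ennreal (exp (\<kappa> * (B (\<tau> (Suc i)) \<omega> - B (\<tau> i) \<omega>) - \<kappa>\<^sup>2 * v i / 2)) else 1)"
      using \<tau>(4) by (intro prod.mono_neutral_cong_left) auto
    finally show ?thesis .
  qed
  have E: "?E \<in> sets M" by measurable
  have "emeasure (density M ?D) ?E = (\<integral>\<^sup>+\<omega>. ?D \<omega> * indicator ?E \<omega> \<partial>M)"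
    using E by (intro emeasure_density) measurable
  also have "\<dots> = (\<integral>\<^sup>+\<omega>. (\<Prod>i<n. ?I i \<omega>) \<partial>M)"
  proof (intro nn_integral_cong)
    fix \<omega> assume \<omega>: "\<omega> \<in> space M"
    have "indicator ?E \<omega> = (\<Prod>i<n. indicator (A i) ((B (\<tau> (Suc i)) \<omega> - \<kappa> * min (\<tau> (Suc i)) \<epsilon>) -
        (B (\<tau> i) \<omega> - \<kappa> * min (\<tau> i) \<epsilon>)) :: ennreal)"
      using \<omega> by (auto simp: indicator_def prod_zero_iff)
    then show "?D \<omega> * indicator ?E \<omega> = (\<Prod>i<n. ?I i \<omega>)"
      unfolding f_eq prod.distrib dens[OF \<omega>] by simp
  qed
  also have "\<dots> = (\<Prod>i<n. \<integral>\<^sup>+\<omega>. ?I i \<omega> \<partial>M)"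
  proof (rule indep_vars_nn_integral)
    show "indep_vars (\<lambda>_. borel) (\<lambda>i. ?I i) {..<n}"
      using \<tau> by (intro indep_vars_compose2[OF indep_increments[of \<tau> n], where Y="\<lambda>i. f i"]) auto
  qed auto
  also have "\<dots> = (\<Prod>i<n. emeasure (gauss (\<tau> (Suc i) - \<tau> i)) (A i))"
  proof (intro prod.cong refl)
    fix i
    have "(\<integral>\<^sup>+\<omega>. ?I i \<omega> \<partial>M) = (\<integral>\<^sup>+x. f i x \<partial>distr M borel (\<lambda>\<omega>. B (\<tau> (Suc i)) \<omega> - B (\<tau> i) \<omega>))"
      by (subst nn_integral_distr) auto
    also have "\<dots> = (\<integral>\<^sup>+x. f i x \<partial>gauss (v i))"
      unfolding increment_law[OF pos lt] v_def ..
    also have "\<dots> = emeasure (gauss (v i)) (A i)"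
      using gauss_exponential_tilt[of "v i" "A i" \<kappa>] lt[of i] by (cases "i < m") (simp_all add: f_def v_def)
    finally show "(\<integral>\<^sup>+\<omega>. ?I i \<omega> \<partial>M) = emeasure (gauss (\<tau> (Suc i) - \<tau> i)) (A i)" by (simp add: v_def)
  qed
  finally show ?thesis .
qed

text \<open>The Cameron--Martin shift along a path that is linear up to time \<open>\<epsilon>\<close> and constant afterwards.\<close>

lemma girsanov:
  assumes \<epsilon>: "0 < \<epsilon>"
  shows "brownian_along \<epsilon> (density M (\<lambda>\<omega>. ennreal (exp (\<kappa> * B \<epsilon> \<omega> - \<kappa>\<^sup>2 * \<epsilon> / 2))))
    (\<lambda>t \<omega>. B t \<omega> - \<kappa> * min t \<epsilon>)" (is "brownian_along \<epsilon> ?M' ?X")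
  unfolding brownian_along_def
proof (intro conjI allI impI)
  show "prob_space ?M'"
  proof
    have "strict_mono (\<lambda>i. \<epsilon> * real i)" using \<epsilon> by (simp add: strict_mono_def)
    from girsanov_increments[OF this, of 1 \<epsilon> 1 "\<lambda>_. UNIV" \<kappa>]
    have "emeasure ?M' (space M) = emeasure (gauss \<epsilon>) UNIV" by simp
    then show "emeasure ?M' (space ?M') = 1"
      using prob_space.emeasure_space_1[OF prob_space_gauss[OF \<epsilon>]] by simp
  qed
  show "?X t \<in> borel_measurable ?M'" if "0 \<le> t" for t
    using continuous_process_shift that unfolding continuous_process_def by blast
  show "\<forall>\<omega>\<in>space ?M'. ?X 0 \<omega> = 0" using start_zero \<epsilon> by simp
qed (use girsanov_increments in simp)

text \<open>
  Near time \<open>0\<close> the path stays away from the positive levels \<open>a\<close> and \<open>b\<close>. Adding to it a steep linear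
  shift of total height \<open>b - a\<close> during a short initial interval, one turns its \<open>a\<close>-level set into the
  \<open>b\<close>-level set of a path whose law is absolutely continuous.
\<close>

lemma level_set_law_absolutely_continuous:
  assumes a: "0 < a" and b: "0 < b" and t: "0 < t"
  shows "absolutely_continuous (level_set_law M B t b) (level_set_law M B t a)"
  unfolding absolutely_continuous_def
proof
  let ?Z = "\<lambda>\<omega>. {s\<in>{0..t}. B s \<omega> = a}"
  define \<kappa> where "\<kappa> n = (a - b) * real (Suc n)" for n
  define X where "X n t \<omega> = B t \<omega> - \<kappa> n * min t (1 / real (Suc n))" for n t \<omega>
  let ?D = "\<lambda>n \<omega>. ennreal (exp (\<kappa> n * B (1 / real (Suc n)) \<omega> - (\<kappa> n)\<^sup>2 * (1 / real (Suc n)) / 2))"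
  let ?Y = "\<lambda>n \<omega>. {s\<in>{0..t}. X n s \<omega> = b}"
  fix N assume N: "N \<in> null_sets (level_set_law M B t b)"
  have "AE \<omega> in M. ?Y n \<omega> \<notin> N" for n
  proof -
    have n: "0 < 1 / real (Suc n)" by simp
    have X: "brownian_along (1 / real (Suc n)) (density M (?D n)) (X n)"
      unfolding X_def using girsanov[OF n, of "\<kappa> n"] .
    have Xc: "continuous_process (density M (?D n)) (X n)"
      unfolding X_def by (rule continuous_process_shift)
    have "level_set_law (density M (?D n)) (X n) t b = level_set_law M B t b"
      using less_imp_le[OF n] by (intro level_set_law_unique[OF X brownian_along _ Xc continuous_process_B t])
    then have "AE C in level_set_law (density M (?D n)) (X n) t b. C \<notin> N"
      using N by (simp add: AE_not_in)
    then have "AE \<omega> in density M (?D n). ?Y n \<omega> \<notin> N"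
      unfolding level_set_law_def by (rule AE_distrD[OF measurable_level_set[OF Xc t]])
    moreover have "B (1 / real (Suc n)) \<in> borel_measurable M" by (rule random_variable_B) simp
    ultimately show "AE \<omega> in M. ?Y n \<omega> \<notin> N" by (subst (asm) AE_density) auto
  qed
  then have never: "AE \<omega> in M. \<forall>n. ?Y n \<omega> \<notin> N" by (simp add: AE_all_countable)
  have some: "\<exists>n. ?Y n \<omega> = ?Z \<omega>" if \<omega>: "\<omega> \<in> space M" for \<omega>
  proof -
    have "continuous_on {0..} (\<lambda>t. B t \<omega>)" using continuous_paths[OF \<omega>] .
    moreover have "0 < min a b" "(0::real) \<in> {0..}" using a b by simp_all
    ultimately obtain d where "d > 0" and close: "\<forall>s\<in>{0..}. dist s 0 < d \<longrightarrow> dist (B s \<omega>) (B 0 \<omega>) < min a b"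
      unfolding continuous_on_iff by blast
    then have d: "d > 0" "\<And>s. 0 \<le> s \<Longrightarrow> s < d \<Longrightarrow> \<bar>B s \<omega>\<bar> < min a b"
      using start_zero[OF \<omega>] by (simp_all add: dist_real_def)
    obtain n where "inverse (real (Suc n)) < d" using reals_Archimedean[OF d(1)] by blast
    then have n: "1 / real (Suc n) < d" by (simp add: inverse_eq_divide)
    have "X n s \<omega> = b \<longleftrightarrow> B s \<omega> = a" if s: "0 \<le> s" for s
    proof (cases "1 / real (Suc n) \<le> s")
      case True
      then have "\<kappa> n * min s (1 / real (Suc n)) = a - b" by (simp add: \<kappa>_def min_absorb2 del: of_nat_Suc)
      then show ?thesis by (simp add: X_def)
    next
      case False
      then have Bs: "\<bar>B s \<omega>\<bar> < min a b" using d(2)[OF s] n by linarith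
      define c where "c = real (Suc n) * s"
      have c: "0 \<le> c" "c \<le> 1" using False s by (auto simp: c_def field_simps simp del: of_nat_Suc)
      have X_eq: "X n s \<omega> = B s \<omega> + (b - a) * c"
        using False by (simp add: X_def \<kappa>_def c_def min_absorb1 algebra_simps del: of_nat_Suc)
      have "X n s \<omega> < b"
      proof (cases "a \<le> b")
        case True
        then have "(b - a) * c \<le> b - a" using c mult_left_mono[of c 1 "b - a"] by simp
        then show ?thesis using X_eq Bs by linarith
      next
        case False
        then have "(b - a) * c \<le> 0" using c mult_nonpos_nonneg[of "b - a" c] by simp
        then show ?thesis using X_eq Bs by linarith
      qed
      moreover have "B s \<omega> < a" using Bs by linarith
      ultimately show ?thesis by linarith
    qed
    then show ?thesis by (intro exI[of _ n]) auto
  qed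
  have "AE \<omega> in M. ?Z \<omega> \<notin> N"
    using never
  proof (rule AE_mp, intro AE_I2 impI)
    fix \<omega> assume "\<omega> \<in> space M" and not_in: "\<forall>n. ?Y n \<omega> \<notin> N"
    then obtain n where "?Y n \<omega> = ?Z \<omega>" using some by blast
    then show "?Z \<omega> \<notin> N" using not_in[rule_format, of n] by simp
  qed
  then have "AE C in level_set_law M B t a. C \<notin> N"
    unfolding level_set_law_def
    using N measurable_level_set[OF continuous_process_B t, of a]
    by (subst AE_distr_iff) (auto simp: level_set_law_def dest!: null_setsD2)
  then show "N \<in> null_sets (level_set_law M B t a)"
    using N by (subst (asm) AE_iff_null_sets[symmetric]) (auto simp: level_set_law_def dest!: null_setsD2)
qed

lemma level_set_law_equivalent:
  assumes "a \<noteq> 0" "b \<noteq> 0" "0 < t"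
  shows "equivalent_measures (level_set_law M B t a) (level_set_law M B t b)"
proof -
  have "level_set_law M B t x = level_set_law M B t \<bar>x\<bar>" for x
    using level_set_law_uminus[OF assms(3), of x] by (cases "0 \<le> x") auto
  then have "absolutely_continuous (level_set_law M B t x) (level_set_law M B t y)" if "x \<noteq> 0" "y \<noteq> 0" for x y
    using level_set_law_absolutely_continuous[of "\<bar>y\<bar>" "\<bar>x\<bar>" t] that assms(3) by (metis zero_less_abs_iff)
  moreover have "sets (level_set_law M B t a) = sets (level_set_law M B t b)"
    by (simp add: level_set_law_def)
  ultimately show ?thesis using assms by (simp add: equivalent_measures_def)
qed

end

section \<open>The Markov property and the measure type of level sets\<close>

lemma null_equivalent:
  "equivalent_measures P Q \<Longrightarrow> A \<in> sets P \<Longrightarrow> emeasure P A = 0 \<longleftrightarrow> emeasure Q A = 0"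
  unfolding equivalent_measures_def absolutely_continuous_def by (auto simp: null_sets_def)

lemma AE_equiv:
  assumes "AE x in M. P x \<longleftrightarrow> Q x"
  shows "(AE x in M. P x) \<longleftrightarrow> (AE x in M. Q x)"
proof
  show "AE x in M. Q x" if "AE x in M. P x" using assms that by eventually_elim simp
  show "AE x in M. P x" if "AE x in M. Q x" using assms that by eventually_elim simp
qed

lemma AE_pair_emeasure_zero_iff:
  assumes "sigma_finite_measure N" "E \<in> sets (M \<Otimes>\<^sub>M N)"
  shows "emeasure (M \<Otimes>\<^sub>M N) E = 0 \<longleftrightarrow> (AE x in M. emeasure N (Pair x -` E) = 0)"
proof -
  interpret sigma_finite_measure N by fact
  have "emeasure (M \<Otimes>\<^sub>M N) E = (\<integral>\<^sup>+ x. emeasure N (Pair x -` E) \<partial>M)"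
    by (rule emeasure_pair_measure_alt[OF assms(2)])
  then show ?thesis
    using measurable_emeasure_Pair[OF assms(2)] by (simp add: nn_integral_0_iff_AE)
qed

context standard_brownian_motion
begin

text \<open>Concatenation of independent paths; on the product space this is again a Brownian motion.\<close>

definition glue :: "real \<Rightarrow> real \<Rightarrow> 'w \<times> 'w \<Rightarrow> real" where
  "glue s u z = (if u \<le> s then B u (fst z) else B s (fst z) + B (u - s) (snd z))"

lemma continuous_process_glue:
  assumes s: "0 \<le> s"
  shows "continuous_process (M \<Otimes>\<^sub>M M) (glue s)"
  unfolding continuous_process_def
proof (intro conjI allI impI ballI)
  fix u :: real assume u: "0 \<le> u"
  have [measurable]: "B u \<in> borel_measurable M" "B s \<in> borel_measurable M"
    using u s random_variable_B by blast+
  show "glue s u \<in> borel_measurable (M \<Otimes>\<^sub>M M)"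
  proof (cases "u \<le> s")
    case True
    then have "glue s u = (\<lambda>z. B u (fst z))" by (simp add: glue_def fun_eq_iff)
    then show ?thesis by simp
  next
    case False
    then have [measurable]: "B (u - s) \<in> borel_measurable M" by (intro random_variable_B) simp
    have "glue s u = (\<lambda>z. B s (fst z) + B (u - s) (snd z))" using False by (simp add: glue_def fun_eq_iff)
    then show ?thesis by simp
  qed
next
  fix z assume z: "z \<in> space (M \<Otimes>\<^sub>M M)"
  have 1: "continuous_on {0..} (\<lambda>u. B u (fst z))" and 2: "continuous_on {0..} (\<lambda>u. B u (snd z))"
    using z by (auto simp: space_pair_measure intro: continuous_paths)
  have "continuous_on ({0..s} \<union> {s..}) (\<lambda>u. if u \<le> s then B u (fst z) else B s (fst z) + B (u - s) (snd z))"
  proof (rule continuous_on_cases_le)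
    show "continuous_on {t \<in> {0..s} \<union> {s..}. t \<le> s} (\<lambda>u. B u (fst z))"
      by (rule continuous_on_subset[OF 1]) (use s in auto)
    have "continuous_on {t \<in> {0..s} \<union> {s..}. s \<le> t} (\<lambda>u. B (u - s) (snd z))"
      by (rule continuous_on_compose2[OF 2]) (auto intro!: continuous_intros)
    then show "continuous_on {t \<in> {0..s} \<union> {s..}. s \<le> t} (\<lambda>u. B s (fst z) + B (u - s) (snd z))"
      by (intro continuous_intros)
  qed (use z start_zero in \<open>auto intro!: continuous_intros simp: space_pair_measure\<close>)
  moreover have "{0..s} \<union> {s..} = {0..}" using s by auto
  ultimately show "continuous_on {0..} (\<lambda>t. glue s t z)" by (simp add: glue_def)
qed

text \<open>
  In a partition through \<open>s\<close> every increment of the glued process is an increment of only one of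
  the two independent motions.
\<close>

lemma brownian_glue:
  assumes s: "0 \<le> s"
  shows "brownian_along s (M \<Otimes>\<^sub>M M) (glue s)"
  unfolding brownian_along_def
proof (intro conjI allI impI ballI)
  show "prob_space (M \<Otimes>\<^sub>M M)" by (intro prob_space_pair prob_space_axioms)
  show "glue s t \<in> borel_measurable (M \<Otimes>\<^sub>M M)" if "0 \<le> t" for t
    using continuous_process_glue[OF s] that by (simp add: continuous_process_def)
  show "glue s 0 z = 0" if "z \<in> space (M \<Otimes>\<^sub>M M)" for z
    using that s start_zero by (auto simp: glue_def space_pair_measure)
  fix \<tau> :: "nat \<Rightarrow> real" and n m :: nat and A :: "nat \<Rightarrow> real set"
  assume \<tau>: "strict_mono \<tau>" "\<tau> 0 = 0" "\<tau> m = s" and m: "m \<le> n" and A: "\<forall>i. A i \<in> sets borel"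
  define \<tau>' where "\<tau>' i = \<tau> (m + i) - s" for i
  have \<tau>': "0 \<le> \<tau>' 0" "strict_mono \<tau>'" using \<tau> by (auto simp: \<tau>'_def strict_mono_def)
  let ?E1 = "{\<omega> \<in> space M. \<forall>i<m. B (\<tau> (Suc i)) \<omega> - B (\<tau> i) \<omega> \<in> A i}"
  let ?E2 = "{\<omega> \<in> space M. \<forall>i<n - m. B (\<tau>' (Suc i)) \<omega> - B (\<tau>' i) \<omega> \<in> A (m + i)}"
  have before: "glue s (\<tau> i) z = B (\<tau> i) (fst z)" if "i \<le> m" for i z
    using that \<tau>(3)[symmetric] by (simp add: glue_def strict_mono_less_eq[OF \<tau>(1)])
  have after: "glue s (\<tau> (m + i)) z = B s (fst z) + B (\<tau>' i) (snd z)" if "z \<in> space (M \<Otimes>\<^sub>M M)" for i z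
  proof (cases "i = 0")
    case True then show ?thesis using that \<tau> start_zero by (auto simp: glue_def \<tau>'_def space_pair_measure)
  next
    case False
    then have "\<not> \<tau> (m + i) \<le> s" using \<tau>(3)[symmetric] by (simp add: strict_mono_less_eq[OF \<tau>(1)])
    then show ?thesis by (simp add: glue_def \<tau>'_def)
  qed
  have "{z \<in> space (M \<Otimes>\<^sub>M M). \<forall>i<n. glue s (\<tau> (Suc i)) z - glue s (\<tau> i) z \<in> A i} = ?E1 \<times> ?E2"
  proof (intro set_eqI)
    fix z
    have "(\<forall>i<n. glue s (\<tau> (Suc i)) z - glue s (\<tau> i) z \<in> A i) \<longleftrightarrow>
      (\<forall>i<m. B (\<tau> (Suc i)) (fst z) - B (\<tau> i) (fst z) \<in> A i) \<and>
      (\<forall>i<n - m. B (\<tau>' (Suc i)) (snd z) - B (\<tau>' i) (snd z) \<in> A (m + i))"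
      if z: "z \<in> space (M \<Otimes>\<^sub>M M)"
    proof -
      have "(\<forall>i<n. glue s (\<tau> (Suc i)) z - glue s (\<tau> i) z \<in> A i) \<longleftrightarrow>
        (\<forall>i<m. glue s (\<tau> (Suc i)) z - glue s (\<tau> i) z \<in> A i) \<and>
        (\<forall>i<n - m. glue s (\<tau> (m + Suc i)) z - glue s (\<tau> (m + i)) z \<in> A (m + i))" (is "?l \<longleftrightarrow> ?r1 \<and> ?r2")
      proof
        assume ?l then show "?r1 \<and> ?r2" using m by simp
      next
        assume r: "?r1 \<and> ?r2"
        show ?l
        proof (intro allI impI)
          fix i assume i: "i < n"
          show "glue s (\<tau> (Suc i)) z - glue s (\<tau> i) z \<in> A i"
          proof (cases "i < m")
            case False
            then have "i - m < n - m" "m + (i - m) = i" using i by auto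
            then show ?thesis using r by (metis add_Suc_right)
          qed (use r in blast)
        qed
      qed
      also have "?r1 \<longleftrightarrow> (\<forall>i<m. B (\<tau> (Suc i)) (fst z) - B (\<tau> i) (fst z) \<in> A i)"
        by (simp add: before)
      also have "?r2 \<longleftrightarrow> (\<forall>i<n - m. B (\<tau>' (Suc i)) (snd z) - B (\<tau>' i) (snd z) \<in> A (m + i))"
        unfolding after[OF z] by simp
      finally show ?thesis .
    qed
    then show "z \<in> {z \<in> space (M \<Otimes>\<^sub>M M). \<forall>i<n. glue s (\<tau> (Suc i)) z - glue s (\<tau> i) z \<in> A i} \<longleftrightarrow> z \<in> ?E1 \<times> ?E2"
      by (cases z) (auto simp: space_pair_measure)
  qed
  moreover have "emeasure (M \<Otimes>\<^sub>M M) (?E1 \<times> ?E2) = emeasure M ?E1 * emeasure M ?E2"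
  proof (rule sigma_finite_measure.emeasure_pair_measure_Times[OF prob_space_imp_sigma_finite[OF prob_space_axioms]])
    have pos: "0 \<le> \<tau> i" "0 \<le> \<tau>' i" for i
      using \<tau> \<tau>' by (metis strict_mono_less_eq zero_le order_trans)+
    have [measurable]: "B (\<tau> i) \<in> borel_measurable M" "B (\<tau>' i) \<in> borel_measurable M" for i
      using random_variable_B pos by blast+
    have [measurable]: "A i \<in> sets borel" for i using A by blast
    show "?E1 \<in> sets M" "?E2 \<in> sets M" by measurable
  qed
  moreover have "emeasure M ?E1 = (\<Prod>i<m. emeasure (gauss (\<tau> (Suc i) - \<tau> i)) (A i))"
    using \<tau> A by (intro emeasure_increments) auto
  moreover have "emeasure M ?E2 = (\<Prod>i<n - m. emeasure (gauss (\<tau>' (Suc i) - \<tau>' i)) (A (m + i)))"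
    using \<tau>' A by (intro emeasure_increments) auto
  moreover have "\<dots> = (\<Prod>i=m..<n. emeasure (gauss (\<tau> (Suc i) - \<tau> i)) (A i))"
    by (rule prod.reindex_bij_witness[of _ "\<lambda>i. i - m" "\<lambda>i. m + i"]) (auto simp: \<tau>'_def)
  moreover have "(\<Prod>i<m. emeasure (gauss (\<tau> (Suc i) - \<tau> i)) (A i)) *
      (\<Prod>i=m..<n. emeasure (gauss (\<tau> (Suc i) - \<tau> i)) (A i)) = (\<Prod>i<n. emeasure (gauss (\<tau> (Suc i) - \<tau> i)) (A i))"
    using m prod.atLeastLessThan_concat[of 0 m n "\<lambda>i. emeasure (gauss (\<tau> (Suc i) - \<tau> i)) (A i)"]
    by (simp add: atLeast0LessThan)
  ultimately show "emeasure (M \<Otimes>\<^sub>M M) {z \<in> space (M \<Otimes>\<^sub>M M). \<forall>i<n. glue s (\<tau> (Suc i)) z - glue s (\<tau> i) z \<in> A i} =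
      (\<Prod>i<n. emeasure (gauss (\<tau> (Suc i) - \<tau> i)) (A i))" by simp
qed

lemma path_law_glue: "0 \<le> s \<Longrightarrow> path_law (M \<Otimes>\<^sub>M M) (glue s) = path_law M B"
  by (rule brownian_law_unique[OF brownian_glue brownian_along])

text \<open>
  Conditioning on the past of \<open>B\<close> at time \<open>s\<close> thus becomes Fubini's theorem on the product space.
\<close>

lemma level_set_law_glue:
  "0 \<le> s \<Longrightarrow> 0 < t \<Longrightarrow> level_set_law (M \<Otimes>\<^sub>M M) (glue s) t a = level_set_law M B t a"
  by (rule level_set_law_unique[OF brownian_glue brownian_along _ continuous_process_glue continuous_process_B])

lemma level_set_glue:
  assumes "z \<in> space (M \<Otimes>\<^sub>M M)" "0 < s" "0 < t"
  shows "{u\<in>{0..s + t}. glue s u z = a} =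
    join s {u\<in>{0..s}. B u (fst z) = a} {u\<in>{0..t}. B u (snd z) = a - B s (fst z)}"
proof -
  have z0: "B 0 (snd z) = 0" using assms start_zero by (auto simp: space_pair_measure)
  have "u \<in> {u\<in>{0..s + t}. glue s u z = a} \<longleftrightarrow> u \<in> {u\<in>{0..s}. B u (fst z) = a} \<or>
    u - s \<in> {u\<in>{0..t}. B u (snd z) = a - B s (fst z)}" for u
    using z0 assms(2,3) by (cases "u = s") (auto simp: glue_def)
  moreover have "u \<in> (\<lambda>x. x + s) ` S \<longleftrightarrow> u - s \<in> S" for u S by (auto intro: image_eqI[of _ _ "u - s"])
  ultimately show ?thesis unfolding join_def by blast
qed

lemma AE_not_level: "0 < t \<Longrightarrow> AE \<omega> in M. B t \<omega> \<noteq> a"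
proof -
  assume t: "0 < t"
  have "AE x in gauss t. x \<noteq> a"
    unfolding gauss_def using AE_lborel_singleton[of a] by (subst AE_density) (auto elim: AE_mp)
  then have "AE x in distr M borel (\<lambda>\<omega>. B t \<omega> - B 0 \<omega>). x \<noteq> a"
    using increment_law[of 0 t] t by (simp only: diff_zero order_refl)
  moreover have "(\<lambda>\<omega>. B t \<omega> - B 0 \<omega>) \<in> borel_measurable M"
    using random_variable_B t by (intro borel_measurable_diff) auto
  ultimately have "AE \<omega> in M. B t \<omega> - B 0 \<omega> \<noteq> a" by (rule AE_distrD[rotated])
  then show ?thesis using start_zero by (auto elim!: AE_mp)
qed

lemma prob_space_level_set_law: "0 < t \<Longrightarrow> prob_space (level_set_law M B t a)"
  unfolding level_set_law_def
  by (intro prob_space_distr measurable_level_set continuous_process_B)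

lemma sets_level_set_law [measurable_cong, simp]: "sets (level_set_law M B t a) = sets (closed_sets_space t)"
  by (simp add: level_set_law_def)

lemma AE_level_set_law_iff:
  assumes "0 < t" "{C \<in> closed_subsets t. Q C} \<in> sets (closed_sets_space t)"
  shows "(AE C in level_set_law M B t a. Q C) \<longleftrightarrow> (AE \<omega> in M. Q {s\<in>{0..t}. B s \<omega> = a})"
  unfolding level_set_law_def using assms
  by (intro AE_distr_iff measurable_level_set continuous_process_B) simp_all

text \<open>
  On the glued process, the level set after time \<open>s\<close> is the level set, of level \<open>a - B s\<close>, of the second motion.
  Almost surely this level is nonzero, and all nonzero levels give equivalent laws; so, as far as null sets
  are concerned, the two parts of the level set are independent.
\<close>

lemma join_level_set_law_null_iff:
  assumes s: "0 < s" and t: "0 < t" and a: "a \<noteq> 0" and N: "N \<in> sets (closed_sets_space (s + t))"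
  shows "emeasure (level_set_law M B (s + t) a) N = 0 \<longleftrightarrow>
    emeasure (join_law s t (level_set_law M B s a) (level_set_law M B t a)) N = 0"
proof -
  let ?P = "level_set_law M B s a" and ?Q = "level_set_law M B t"
  let ?Z = "\<lambda>\<omega>. {u\<in>{0..s}. B u \<omega> = a}" and ?W = "\<lambda>b \<omega>. {u\<in>{0..t}. B u \<omega> = b}"
  interpret Q: prob_space "?Q a" using t by (rule prob_space_level_set_law)
  have st: "0 < s + t" using s t by simp
  have Zm: "?Z \<in> M \<rightarrow>\<^sub>M closed_sets_space s" and Wm: "?W b \<in> M \<rightarrow>\<^sub>M closed_sets_space t" for b
    by (rule measurable_level_set[OF continuous_process_B s], rule measurable_level_set[OF continuous_process_B t])
  let ?J = "(\<lambda>(C, D). join s C D) -` N \<inter> space (closed_sets_space s \<Otimes>\<^sub>M closed_sets_space t)"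
  have J: "?J \<in> sets (closed_sets_space s \<Otimes>\<^sub>M closed_sets_space t)"
    by (rule measurable_sets[OF measurable_join[OF s t] N])
  have J': "?J \<in> sets (?P \<Otimes>\<^sub>M ?Q b)" for b using J by (simp cong: sets_pair_measure_cong)
  have slice: "Pair C -` ?J \<in> sets (closed_sets_space t)" for C by (rule sets_Pair1[OF J])
  let ?E = "(\<lambda>z. {u\<in>{0..s + t}. glue s u z = a}) -` N \<inter> space (M \<Otimes>\<^sub>M M)"
  have E: "?E \<in> sets (M \<Otimes>\<^sub>M M)"
    using s st N by (intro measurable_sets[OF measurable_level_set[OF continuous_process_glue]]) auto
  have "emeasure (level_set_law M B (s + t) a) N = emeasure (level_set_law (M \<Otimes>\<^sub>M M) (glue s) (s + t) a) N"
    using s st by (simp add: level_set_law_glue)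
  also have "\<dots> = emeasure (M \<Otimes>\<^sub>M M) ?E"
    unfolding level_set_law_def using s
    by (intro emeasure_distr N measurable_level_set[OF continuous_process_glue st]) simp
  also have "\<dots> = 0 \<longleftrightarrow> (AE \<omega> in M. emeasure M (Pair \<omega> -` ?E) = 0)"
    by (rule AE_pair_emeasure_zero_iff[OF prob_space_imp_sigma_finite[OF prob_space_axioms] E])
  also have "\<dots> \<longleftrightarrow> (AE \<omega> in M. emeasure (?Q a) (Pair (?Z \<omega>) -` ?J) = 0)"
  proof (rule AE_equiv)
    show "AE \<omega> in M. emeasure M (Pair \<omega> -` ?E) = 0 \<longleftrightarrow> emeasure (?Q a) (Pair (?Z \<omega>) -` ?J) = 0"
      using AE_not_level[OF s, of a]
    proof (rule AE_mp, intro AE_I2 impI)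
      fix \<omega> assume \<omega>: "\<omega> \<in> space M" and ne: "B s \<omega> \<noteq> a"
      have "Pair \<omega> -` ?E = ?W (a - B s \<omega>) -` (Pair (?Z \<omega>) -` ?J) \<inter> space M"
      proof (intro set_eqI)
        fix \<omega>'
        have glue: "{u\<in>{0..s + t}. glue s u (\<omega>, \<omega>') = a} = join s (?Z \<omega>) (?W (a - B s \<omega>) \<omega>')"
          if "\<omega>' \<in> space M"
          using level_set_glue[of "(\<omega>, \<omega>')" s t a] that \<omega> s t by (simp only: space_pair_measure fst_conv snd_conv mem_Times_iff simp_thms)
        have "\<omega>' \<in> Pair \<omega> -` ?E \<longleftrightarrow> \<omega>' \<in> space M \<and> {u\<in>{0..s + t}. glue s u (\<omega>, \<omega>') = a} \<in> N"
          using \<omega> by (simp add: space_pair_measure conj_commute)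
        also have "\<dots> \<longleftrightarrow> \<omega>' \<in> space M \<and> join s (?Z \<omega>) (?W (a - B s \<omega>) \<omega>') \<in> N"
          by (rule conj_cong[OF refl]) (simp only: glue)
        also have "\<dots> \<longleftrightarrow> \<omega>' \<in> ?W (a - B s \<omega>) -` (Pair (?Z \<omega>) -` ?J) \<inter> space M"
          using measurable_space[OF Zm \<omega>] measurable_space[OF Wm[of "a - B s \<omega>"], of \<omega>']
          by (simp add: space_pair_measure conj_commute cong: conj_cong)
        finally show "\<omega>' \<in> Pair \<omega> -` ?E \<longleftrightarrow> \<omega>' \<in> ?W (a - B s \<omega>) -` (Pair (?Z \<omega>) -` ?J) \<inter> space M" .
      qed
      then have "emeasure M (Pair \<omega> -` ?E) = emeasure (?Q (a - B s \<omega>)) (Pair (?Z \<omega>) -` ?J)"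
        using slice Wm by (simp add: level_set_law_def emeasure_distr)
      also have "\<dots> = 0 \<longleftrightarrow> emeasure (?Q a) (Pair (?Z \<omega>) -` ?J) = 0"
        using level_set_law_equivalent[of "a - B s \<omega>" a t] ne a t slice by (intro null_equivalent) auto
      finally show "emeasure M (Pair \<omega> -` ?E) = 0 \<longleftrightarrow> emeasure (?Q a) (Pair (?Z \<omega>) -` ?J) = 0" .
    qed
  qed
  also have "\<dots> \<longleftrightarrow> (AE C in ?P. emeasure (?Q a) (Pair C -` ?J) = 0)"
  proof (rule AE_level_set_law_iff[OF s, symmetric])
    have [measurable]: "(\<lambda>C. emeasure (?Q a) (Pair C -` ?J)) \<in> borel_measurable ?P"
      by (rule Q.measurable_emeasure_Pair[OF J'])
    have "{C \<in> space ?P. emeasure (?Q a) (Pair C -` ?J) = 0} \<in> sets ?P" by measurable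
    then show "{C \<in> closed_subsets s. emeasure (?Q a) (Pair C -` ?J) = 0} \<in> sets (closed_sets_space s)"
      using s by (simp add: level_set_law_def)
  qed
  also have "\<dots> \<longleftrightarrow> emeasure (?P \<Otimes>\<^sub>M ?Q a) ?J = 0"
    by (rule AE_pair_emeasure_zero_iff[OF Q.sigma_finite_measure_axioms J', symmetric])
  also have "emeasure (?P \<Otimes>\<^sub>M ?Q a) ?J = emeasure (join_law s t ?P (?Q a)) N"
  proof -
    have "(\<lambda>(C, D). join s C D) \<in> ?P \<Otimes>\<^sub>M ?Q a \<rightarrow>\<^sub>M closed_sets_space (s + t)"
      using measurable_join[OF s t] by (simp cong: measurable_cong_sets sets_pair_measure_cong)
    then show ?thesis using N unfolding join_law_def
      by (simp add: emeasure_distr space_pair_measure level_set_law_def)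
  qed
  finally show ?thesis .
qed

end

lemma equivalent_measures_sym: "equivalent_measures P Q \<Longrightarrow> equivalent_measures Q P"
  by (auto simp: equivalent_measures_def)

lemma equivalent_measures_trans:
  "equivalent_measures P Q \<Longrightarrow> equivalent_measures Q R \<Longrightarrow> equivalent_measures P R"
  by (auto simp: equivalent_measures_def absolutely_continuous_def)

lemma equivalent_measures_sets: "equivalent_measures P Q \<Longrightarrow> sets P = sets Q"
  by (simp add: equivalent_measures_def)

lemma equivalent_measures_space: "equivalent_measures P Q \<Longrightarrow> space P = space Q"
  by (intro sets_eq_imp_space_eq equivalent_measures_sets)

lemma equivalent_measuresI:
  assumes "sets P = sets Q" "\<And>A. A \<in> sets P \<Longrightarrow> emeasure P A = 0 \<longleftrightarrow> emeasure Q A = 0"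
  shows "equivalent_measures P Q"
  using assms by (auto simp: equivalent_measures_def absolutely_continuous_def null_sets_def)

lemma AE_equivalent_measures:
  assumes "equivalent_measures P Q"
  shows "(AE x in P. \<phi> x) \<longleftrightarrow> (AE x in Q. \<phi> x)"
proof -
  have "null_sets P = null_sets Q"
    using assms by (auto simp: equivalent_measures_def absolutely_continuous_def)
  then show ?thesis using equivalent_measures_space[OF assms] by (simp add: eventually_ae_filter)
qed

lemma equivalent_measures_distr:
  assumes PQ: "equivalent_measures P Q" and f: "f \<in> P \<rightarrow>\<^sub>M N"
  shows "equivalent_measures (distr P N f) (distr Q N f)"
proof (rule equivalent_measuresI)
  have f': "f \<in> Q \<rightarrow>\<^sub>M N"
    using f equivalent_measures_sets[OF PQ] by (simp cong: measurable_cong_sets)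
  fix A assume "A \<in> sets (distr P N f)"
  then have "A \<in> sets N" by simp
  then show "emeasure (distr P N f) A = 0 \<longleftrightarrow> emeasure (distr Q N f) A = 0"
    using null_equivalent[OF PQ measurable_sets[OF f]] equivalent_measures_space[OF PQ]
    by (simp add: emeasure_distr[OF f] emeasure_distr[OF f'])
qed simp

lemma equivalent_measures_pair:
  assumes P: "equivalent_measures P P'" and Q: "equivalent_measures Q Q'"
    and "sigma_finite_measure Q" "sigma_finite_measure Q'"
  shows "equivalent_measures (P \<Otimes>\<^sub>M Q) (P' \<Otimes>\<^sub>M Q')"
proof (rule equivalent_measuresI)
  show sets: "sets (P \<Otimes>\<^sub>M Q) = sets (P' \<Otimes>\<^sub>M Q')"
    using P Q by (intro sets_pair_measure_cong equivalent_measures_sets)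
  fix E assume E: "E \<in> sets (P \<Otimes>\<^sub>M Q)"
  have "emeasure (P \<Otimes>\<^sub>M Q) E = 0 \<longleftrightarrow> (AE x in P. emeasure Q (Pair x -` E) = 0)"
    by (rule AE_pair_emeasure_zero_iff) fact+
  also have "\<dots> \<longleftrightarrow> (AE x in P'. emeasure Q (Pair x -` E) = 0)"
    by (rule AE_equivalent_measures) fact
  also have "\<dots> \<longleftrightarrow> (AE x in P'. emeasure Q' (Pair x -` E) = 0)"
    using null_equivalent[OF Q sets_Pair1[OF E]] by simp
  also have "\<dots> \<longleftrightarrow> emeasure (P' \<Otimes>\<^sub>M Q') E = 0"
    using E sets by (intro AE_pair_emeasure_zero_iff[symmetric] assms) simp
  finally show "emeasure (P \<Otimes>\<^sub>M Q) E = 0 \<longleftrightarrow> emeasure (P' \<Otimes>\<^sub>M Q') E = 0" .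
qed

context standard_brownian_motion
begin

lemma level_set_type_iff:
  assumes "0 < t"
  shows "P \<in> level_set_type M B t \<longleftrightarrow> prob_space P \<and> equivalent_measures P (level_set_law M B t 1)"
proof
  assume "P \<in> level_set_type M B t"
  then obtain a where "prob_space P" "a > 0" "equivalent_measures P (level_set_law M B t a)"
    by (auto simp: level_set_type_def)
  then show "prob_space P \<and> equivalent_measures P (level_set_law M B t 1)"
    using level_set_law_equivalent[of a 1 t] assms by (auto intro: equivalent_measures_trans)
qed (auto simp: level_set_type_def intro!: exI[of _ 1])

lemma level_set_law_in_type: "0 < t \<Longrightarrow> a \<noteq> 0 \<Longrightarrow> level_set_law M B t a \<in> level_set_type M B t"
  using level_set_law_equivalent[of a 1 t] by (simp add: level_set_type_iff prob_space_level_set_law)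

lemma level_set_type_prob: "P \<in> level_set_type M B t \<Longrightarrow> prob_space P"
  by (auto simp: level_set_type_def)

lemma level_set_type_sets: "P \<in> level_set_type M B t \<Longrightarrow> sets P = sets (closed_sets_space t)"
  by (auto simp: level_set_type_def dest: equivalent_measures_sets)

lemma level_set_type_equivalent:
  "0 < t \<Longrightarrow> P \<in> level_set_type M B t \<Longrightarrow> Q \<in> level_set_type M B t \<Longrightarrow> equivalent_measures P Q"
  using level_set_type_iff equivalent_measures_trans equivalent_measures_sym by meson

lemma join_law_in_type:
  assumes s: "0 < s" and t: "0 < t"
    and P: "P \<in> level_set_type M B s" and Q: "Q \<in> level_set_type M B t"
  shows "join_law s t P Q \<in> level_set_type M B (s + t)"
proof -
  let ?P = "level_set_law M B s 1" and ?Q = "level_set_law M B t 1"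
  have st: "0 < s + t" using s t by simp
  have j: "(\<lambda>(C, D). join s C D) \<in> P \<Otimes>\<^sub>M Q \<rightarrow>\<^sub>M closed_sets_space (s + t)"
    using measurable_join[OF s t] level_set_type_sets[OF P] level_set_type_sets[OF Q]
    by (simp cong: measurable_cong_sets sets_pair_measure_cong)
  have "prob_space (join_law s t P Q)"
    unfolding join_law_def using P Q j
    by (intro prob_space.prob_space_distr prob_space_pair level_set_type_prob)
  moreover have "equivalent_measures (join_law s t P Q) (join_law s t ?P ?Q)"
    unfolding join_law_def using P Q s t prob_space_level_set_law[OF t]
    by (intro equivalent_measures_distr[OF _ j] equivalent_measures_pair)
      (auto simp: level_set_type_iff intro: prob_space_imp_sigma_finite)
  moreover have "equivalent_measures (join_law s t ?P ?Q) (level_set_law M B (s + t) 1)"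
  proof (rule equivalent_measuresI)
    fix A assume "A \<in> sets (join_law s t ?P ?Q)"
    then show "emeasure (join_law s t ?P ?Q) A = 0 \<longleftrightarrow> emeasure (level_set_law M B (s + t) 1) A = 0"
      using join_level_set_law_null_iff[OF s t, of 1 A] by (simp add: join_law_def)
  qed (simp add: join_law_def)
  ultimately show ?thesis using st by (auto simp: level_set_type_iff intro: equivalent_measures_trans)
qed

lemma distr_dilate_in_type:
  assumes c: "0 < c" and t: "0 < t" and P: "P \<in> level_set_type M B t"
  shows "distr P (closed_sets_space (c * t)) (dilate c) \<in> level_set_type M B (c * t)"
proof -
  have d: "dilate c \<in> P \<rightarrow>\<^sub>M closed_sets_space (c * t)"
    using measurable_dilate[OF t c] level_set_type_sets[OF P] by (simp cong: measurable_cong_sets)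
  have "equivalent_measures P (level_set_law M B t (1 / sqrt c))"
    using level_set_law_in_type[OF t, of "1 / sqrt c"] P c t by (intro level_set_type_equivalent) auto
  then have "equivalent_measures (distr P (closed_sets_space (c * t)) (dilate c)) (level_set_law M B (c * t) 1)"
    unfolding level_set_law_scaling[OF c t, of 1] by (rule equivalent_measures_distr[OF _ d])
  moreover have "prob_space (distr P (closed_sets_space (c * t)) (dilate c))"
    using level_set_type_prob[OF P] d by (rule prob_space.prob_space_distr)
  ultimately show ?thesis using c t by (simp add: level_set_type_iff)
qed

lemma AE_level_set_type_zero:
  assumes t: "0 < t" and P: "P \<in> level_set_type M B t"
  shows "AE C in P. 0 \<notin> C"
proof -
  have "{C \<in> closed_subsets t. 0 \<notin> C} \<in> sets (closed_sets_space t)"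
    using miss_open[OF t, of 0 0] by simp
  from AE_level_set_law_iff[OF t this, of 1]
  have "AE C in level_set_law M B t 1. 0 \<notin> C" using start_zero by (auto intro!: AE_I2)
  then show ?thesis
    using AE_equivalent_measures[of P "level_set_law M B t 1" "\<lambda>C. 0 \<notin> C"] P t
    by (simp add: level_set_type_iff)
qed

section \<open>Level sets are almost surely empty or infinite\<close>

lemma gauss_tail_small:
  assumes "0 < e"
  shows "\<exists>K::nat. 2 \<le> K \<and> emeasure (gauss 1) {real K..} \<le> ennreal e"
proof -
  interpret G: prob_space "gauss 1" by (rule prob_space_gauss) simp
  have "(\<lambda>n::nat. G.prob {real n..}) \<longlonglongrightarrow> G.prob (\<Inter>n. {real n..})"
    by (rule G.finite_Lim_measure_decseq) (auto simp: decseq_def)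
  moreover have "\<exists>n. x < real n" for x by (rule reals_Archimedean2)
  then have "(\<Inter>n. {real n..}) = {}" by (auto simp: not_le[symmetric])
  ultimately have "(\<lambda>n::nat. G.prob {real n..}) \<longlonglongrightarrow> 0" by simp
  then have "\<forall>\<^sub>F n in sequentially. G.prob {real n..} < e" using assms by (rule order_tendstoD)
  then obtain n0 where "\<And>n. n \<ge> n0 \<Longrightarrow> G.prob {real n..} < e"
    unfolding eventually_sequentially by blast
  then have "G.prob {real (max 2 n0)..} < e" by simp
  then show ?thesis
    by (intro exI[of _ "max 2 n0"]) (simp add: G.emeasure_eq_measure ennreal_leI)
qed

lemma gauss_not_almost_surely_large: "measure (gauss 1) {- 2..} < 1"
proof -
  interpret G: prob_space "gauss 1" by (rule prob_space_gauss) simp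
  have "\<not> (AE x in gauss 1. x \<in> {- 2..})"
  proof
    assume "AE x in gauss 1. x \<in> {- 2..}"
    then have "AE x in lborel. x \<in> {- 2::real..}"
      unfolding gauss_def by (subst (asm) AE_density) (auto simp: normal_density_pos)
    then have "{..<- 2::real} \<in> null_sets lborel"
      using AE_iff_null_sets[of "{..<- 2::real}" lborel] by (auto simp: not_less)
    then have "emeasure lborel {..<- 2::real} = 0" by (rule null_setsD1)
    moreover have "emeasure lborel {- 3..<- 2::real} \<le> emeasure lborel {..<- 2::real}"
      by (rule emeasure_mono) auto
    ultimately show False by simp
  qed
  then have "G.prob {- 2..} \<noteq> 1" by (simp add: G.prob_eq_1)
  then show ?thesis using G.prob_le_1[of "{- 2..}"] by linarith
qed

text \<open>
  Take times \<open>d / K\<^sup>2\<^sup>n, \<dots>, d / K\<^sup>2, d\<close> with \<open>K\<close> large. If the path is nonnegative at all of them, then either its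
  value at one of them exceeds the standard deviation at the next one, that is, \<open>K\<close> times its own, which is
  unlikely for each of the \<open>n\<close> times by the choice of \<open>K\<close>, or none of the \<open>n\<close> independent increments is below
  \<open>-2\<close> of its standard deviations, which is unlikely for large \<open>n\<close>. The times are rational, since
  the events on path space read the path at rational times.
\<close>

lemma nonneg_near_zero_small:
  assumes d: "0 < d" "d \<in> \<rat>" and e: "0 < e"
  shows "\<exists>S\<in>sets M. emeasure M S \<le> ennreal e \<and>
    {\<omega>\<in>space M. \<forall>r\<in>\<rat> \<inter> {0..d}. 0 \<le> B r \<omega>} \<subseteq> S"
proof -
  define q where "q = measure (gauss 1) {- 2..}"
  interpret G: prob_space "gauss 1" by (rule prob_space_gauss) simp
  have q: "0 \<le> q" "q < 1" using gauss_not_almost_surely_large by (auto simp: q_def)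
  have "(\<lambda>n. q ^ n) \<longlonglongrightarrow> 0" using q by (intro LIMSEQ_power_zero) simp
  then have "\<forall>\<^sub>F n in sequentially. q ^ n < e / 2" using e by (intro order_tendstoD) auto
  then obtain n where n: "q ^ n < e / 2" unfolding eventually_sequentially by blast
  have "0 < e / 2 / real (Suc n)" using e by simp
  from gauss_tail_small[OF this] obtain K :: nat where K: "2 \<le> K"
    "emeasure (gauss 1) {real K..} \<le> ennreal (e / 2 / real (Suc n))" by blast
  have K2: "2 \<le> real K" using K by simp
  \<comment> \<open>the formula continues beyond \<open>i = n\<close>, as the times have to form an infinite increasing sequence\<close>
  define \<tau> where "\<tau> i = d * (real K)\<^sup>2 ^ i / (real K)\<^sup>2 ^ n" for i :: nat
  have \<tau>pos: "0 < \<tau> i" for i using d K2 by (simp add: \<tau>_def)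
  have K1: "1 < (real K)\<^sup>2" using K2 by (simp add: power_gt1_lemma power2_eq_square less_1_mult)
  have \<tau>Suc: "\<tau> (Suc i) = (real K)\<^sup>2 * \<tau> i" for i by (simp add: \<tau>_def)
  have mono: "strict_mono \<tau>"
    unfolding strict_mono_Suc_iff \<tau>Suc using \<tau>pos K1 by simp
  have sqrt_Suc: "sqrt (\<tau> (Suc i)) = real K * sqrt (\<tau> i)" for i
    by (simp add: \<tau>Suc real_sqrt_mult)
  have \<tau>n: "\<tau> i \<in> \<rat> \<inter> {0..d}" if "i \<le> n" for i
  proof -
    have "\<tau> i \<le> \<tau> n" using mono that by (simp add: strict_mono_less_eq)
    moreover have "\<tau> n = d" using K2 by (simp add: \<tau>_def)
    moreover have "\<tau> i \<in> \<rat>" using d by (simp add: \<tau>_def)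
    ultimately show ?thesis using \<tau>pos[of i] by simp
  qed
  have meas [measurable]: "B (\<tau> i) \<in> borel_measurable M" for i
    using less_imp_le[OF \<tau>pos] by (rule random_variable_B)
  let ?S1 = "{\<omega>\<in>space M. \<forall>i<n. B (\<tau> (Suc i)) \<omega> - B (\<tau> i) \<omega> \<in> {- sqrt (\<tau> (Suc i))..}}"
  let ?T = "\<lambda>i. {\<omega>\<in>space M. sqrt (\<tau> (Suc i)) \<le> B (\<tau> i) \<omega>}"
  have "emeasure M ?S1 = (\<Prod>i<n. emeasure (gauss (\<tau> (Suc i) - \<tau> i)) {- sqrt (\<tau> (Suc i))..})"
    using less_imp_le[OF \<tau>pos[of 0]] mono by (rule emeasure_increments) simp
  also have "\<dots> \<le> (\<Prod>i<n. ennreal q)"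
  proof (rule prod_mono_ennreal)
    fix i
    define v where "v = \<tau> (Suc i) - \<tau> i"
    have v: "v = ((real K)\<^sup>2 - 1) * \<tau> i" by (simp add: v_def \<tau>Suc algebra_simps)
    then have v0: "0 < v" using K1 \<tau>pos by simp
    have "emeasure (gauss v) {- sqrt (\<tau> (Suc i))..} =
        emeasure (gauss 1) {x. sqrt v * x \<in> {- sqrt (\<tau> (Suc i))..}}"
      using emeasure_gauss_scale[of 1 "sqrt v" "{- sqrt (\<tau> (Suc i))..}"] v0 by simp
    also have "\<dots> \<le> emeasure (gauss 1) {- 2..}"
    proof (rule emeasure_mono)
      have "(real K)\<^sup>2 \<ge> 2\<^sup>2" using K2 by (intro power_mono) auto
      then have "\<tau> (Suc i) \<le> 2\<^sup>2 * v"
        unfolding v \<tau>Suc mult.assoc[symmetric] using \<tau>pos[of i] by (intro mult_right_mono) auto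
      then have "sqrt (\<tau> (Suc i)) \<le> 2 * sqrt v" using real_sqrt_le_mono[of "\<tau> (Suc i)" "2\<^sup>2 * v"]
        by (simp add: real_sqrt_mult)
      then have "sqrt v * (- 2) \<le> sqrt v * x" if "- sqrt (\<tau> (Suc i)) \<le> sqrt v * x" for x
        using that by linarith
      then have "- 2 \<le> x" if "- sqrt (\<tau> (Suc i)) \<le> sqrt v * x" for x
        using that v0 by (meson mult_left_le_imp_le real_sqrt_gt_zero)
      then show "{x. sqrt v * x \<in> {- sqrt (\<tau> (Suc i))..}} \<subseteq> {- 2..}" by auto
    qed simp
    finally show "emeasure (gauss (\<tau> (Suc i) - \<tau> i)) {- sqrt (\<tau> (Suc i))..} \<le> ennreal q"
      by (simp add: v_def q_def G.emeasure_eq_measure)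
  qed
  also have "\<dots> = ennreal (q ^ n)" using q by (simp add: ennreal_power)
  also have "\<dots> \<le> ennreal (e / 2)" using n by (intro ennreal_leI) simp
  finally have S1: "emeasure M ?S1 \<le> ennreal (e / 2)" .
  have T: "emeasure M (?T i) \<le> ennreal (e / 2 / real (Suc n))" for i
  proof -
    have "emeasure M (?T i) = emeasure M ((\<lambda>\<omega>. B (\<tau> i) \<omega> - B 0 \<omega>) -` {sqrt (\<tau> (Suc i))..} \<inter> space M)"
      using start_zero by (intro arg_cong[where f="emeasure M"]) auto
    also have "\<dots> = emeasure (distr M borel (\<lambda>\<omega>. B (\<tau> i) \<omega> - B 0 \<omega>)) {sqrt (\<tau> (Suc i))..}"
    proof (rule emeasure_distr[symmetric])
      have [measurable]: "B 0 \<in> borel_measurable M" by (rule random_variable_B) simp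
      show "(\<lambda>\<omega>. B (\<tau> i) \<omega> - B 0 \<omega>) \<in> borel_measurable M" by measurable
    qed simp
    also have "\<dots> = emeasure (gauss (\<tau> i)) {sqrt (\<tau> (Suc i))..}"
      using increment_law[of 0 "\<tau> i"] \<tau>pos by simp
    also have "\<dots> = emeasure (gauss 1) {x. sqrt (\<tau> i) * x \<in> {sqrt (\<tau> (Suc i))..}}"
      using emeasure_gauss_scale[of 1 "sqrt (\<tau> i)" "{sqrt (\<tau> (Suc i))..}"] \<tau>pos[of i] by simp
    also have "{x. sqrt (\<tau> i) * x \<in> {sqrt (\<tau> (Suc i))..}} = {real K..}"
      using \<tau>pos[of i] by (auto simp: sqrt_Suc mult.commute[of "real K"])
    finally show ?thesis using K by simp
  qed
  let ?S = "?S1 \<union> (\<Union>i<n. ?T i)"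
  have "emeasure M ?S \<le> emeasure M ?S1 + emeasure M (\<Union>i<n. ?T i)"
    by (rule emeasure_subadditive) measurable
  also have "emeasure M (\<Union>i<n. ?T i) \<le> (\<Sum>i<n. emeasure M (?T i))"
    by (rule emeasure_subadditive_finite) (auto simp: image_subset_iff)
  also have "\<dots> \<le> (\<Sum>i<n. ennreal (e / 2 / real (Suc n)))" by (intro sum_mono T)
  also have "\<dots> = ennreal (real n * (e / 2 / real (Suc n)))"
    using e by (simp add: ennreal_mult'[symmetric] ennreal_of_nat_eq_real_of_nat)
  also have "\<dots> \<le> ennreal (e / 2)"
    using e by (intro ennreal_leI) (simp add: field_simps)
  finally have "emeasure M ?S \<le> emeasure M ?S1 + ennreal (e / 2)" by (simp add: add_left_mono)
  also have "\<dots> \<le> ennreal (e / 2) + ennreal (e / 2)" using S1 by (rule add_right_mono)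
  also have "\<dots> = ennreal e" using e by (simp flip: ennreal_plus)
  finally have "emeasure M ?S \<le> ennreal e" .
  moreover have "?S \<in> sets M" by measurable
  moreover have "{\<omega>\<in>space M. \<forall>r\<in>\<rat> \<inter> {0..d}. 0 \<le> B r \<omega>} \<subseteq> ?S"
  proof
    fix \<omega> assume "\<omega> \<in> {\<omega>\<in>space M. \<forall>r\<in>\<rat> \<inter> {0..d}. 0 \<le> B r \<omega>}"
    then have \<omega>: "\<omega> \<in> space M" and nn: "\<And>i. i \<le> n \<Longrightarrow> 0 \<le> B (\<tau> i) \<omega>" using \<tau>n by auto
    show "\<omega> \<in> ?S"
    proof (cases "\<exists>i<n. sqrt (\<tau> (Suc i)) \<le> B (\<tau> i) \<omega>")
      case False
      have "- sqrt (\<tau> (Suc i)) \<le> B (\<tau> (Suc i)) \<omega> - B (\<tau> i) \<omega>" if "i < n" for i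
        using False that nn[of "Suc i"] by (auto simp: not_le intro: order_trans[of _ "- B (\<tau> i) \<omega>"])
      then show ?thesis using \<omega> by simp
    qed (use \<omega> in auto)
  qed
  ultimately show ?thesis by blast
qed

lemma paths_nonneg_null:
  assumes d: "0 < d" "d \<in> \<rat>"
  shows "emeasure (path_law M B) {w\<in>space path_space. \<forall>r\<in>\<rat> \<inter> {0..d}. 0 \<le> w r} = 0"
    and "emeasure (path_law M B) {w\<in>space path_space. \<forall>r\<in>\<rat> \<inter> {0..d}. w r \<le> 0} = 0"
    and "{w\<in>space path_space. \<forall>r\<in>\<rat> \<inter> {0..d}. a \<le> w r} \<in> sets path_space"
    and "{w\<in>space path_space. \<forall>r\<in>\<rat> \<inter> {0..d}. w r \<le> a} \<in> sets path_space"
proof -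
  have cnt: "countable (\<rat> \<inter> {0..d})" by (intro countable_Int1 countable_rat)
  have ne: "\<rat> \<inter> {0..d} \<noteq> {}" using d by (auto intro: exI[of _ d])
  have m: "(\<lambda>w. w r) \<in> borel_measurable path_space" if "r \<in> \<rat> \<inter> {0..d}" for r
    using that by (intro measurable_path_component) auto
  show up: "{w\<in>space path_space. \<forall>r\<in>\<rat> \<inter> {0..d}. a \<le> w r} \<in> sets path_space" for a
    using m by (intro sets.sets_Collect_countable_All'[OF _ cnt] borel_measurable_le) auto
  show lo: "{w\<in>space path_space. \<forall>r\<in>\<rat> \<inter> {0..d}. w r \<le> a} \<in> sets path_space" for a
    using m by (intro sets.sets_Collect_countable_All'[OF _ cnt] borel_measurable_le) auto
  let ?U = "{w\<in>space path_space. \<forall>r\<in>\<rat> \<inter> {0..d}. 0 \<le> w r}"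
  let ?L = "{w\<in>space path_space. \<forall>r\<in>\<rat> \<inter> {0..d}. w r \<le> 0}"
  show U: "emeasure (path_law M B) ?U = 0"
  proof -
    have "emeasure (path_law M B) ?U \<le> 0 + ennreal e" if "0 < e" for e
    proof -
      obtain S where S: "S \<in> sets M" "emeasure M S \<le> ennreal e"
        "{\<omega>\<in>space M. \<forall>r\<in>\<rat> \<inter> {0..d}. 0 \<le> B r \<omega>} \<subseteq> S"
        using nonneg_near_zero_small[OF d \<open>0 < e\<close>] by blast
      have "emeasure (path_law M B) ?U = emeasure M (path_of B -` ?U \<inter> space M)"
        unfolding path_law_def by (rule emeasure_distr[OF measurable_path_B up])
      also have "\<dots> \<le> emeasure M S"
        using S(1,3) by (intro emeasure_mono) (auto simp: path_of_def)
      finally show ?thesis using S(2) by simp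
    qed
    then have "emeasure (path_law M B) ?U \<le> 0" by (rule ennreal_le_epsilon)
    then show ?thesis by simp
  qed
  have mN: "path_of (\<lambda>t \<omega>. -1 * B (t / (-1)\<^sup>2) \<omega>) \<in> M \<rightarrow>\<^sub>M path_space"
    using continuous_scaled[of "-1"] by (intro measurable_path_of) (simp add: continuous_process_def)
  have "path_law M B = path_law M (\<lambda>t \<omega>. -1 * B (t / (-1)\<^sup>2) \<omega>)"
    by (rule brownian_law_unique[OF brownian_along brownian_scaled]) simp_all
  then have "emeasure (path_law M B) ?L =
      emeasure M (path_of (\<lambda>t \<omega>. -1 * B (t / (-1)\<^sup>2) \<omega>) -` ?L \<inter> space M)"
    unfolding path_law_def by (simp only: emeasure_distr[OF mN lo])
  also have "path_of (\<lambda>t \<omega>. -1 * B (t / (-1)\<^sup>2) \<omega>) -` ?L \<inter> space M = path_of B -` ?U \<inter> space M"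
    using measurable_space[OF mN] measurable_space[OF measurable_path_B] by (auto simp: path_of_def)
  also have "emeasure M \<dots> = emeasure (path_law M B) ?U"
    unfolding path_law_def by (rule emeasure_distr[OF measurable_path_B up, symmetric])
  finally show "emeasure (path_law M B) ?L = 0" using U by simp
qed

text \<open>
  The tolerance \<open>\<eta>\<close> makes room for the error that arises when a hitting time is replaced by a nearby
  deterministic time.
\<close>

definition one_sided :: "real \<Rightarrow> real \<Rightarrow> (real \<Rightarrow> real) set" where
  "one_sided d \<eta> = {w\<in>space path_space. (\<forall>r\<in>\<rat> \<inter> {0..d}. - \<eta> \<le> w r) \<or> (\<forall>r\<in>\<rat> \<inter> {0..d}. w r \<le> \<eta>)}"

lemma one_sided_alt: "one_sided d \<eta> = {w\<in>space path_space. \<forall>r\<in>\<rat> \<inter> {0..d}. - \<eta> \<le> w r} \<union>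
    {w\<in>space path_space. \<forall>r\<in>\<rat> \<inter> {0..d}. w r \<le> \<eta>}"
  by (auto simp: one_sided_def)

lemma sets_one_sided: "0 < d \<Longrightarrow> d \<in> \<rat> \<Longrightarrow> one_sided d \<eta> \<in> sets path_space"
  unfolding one_sided_alt by (intro sets.Un paths_nonneg_null)

lemma one_sided_mono:
  assumes "\<eta> \<le> \<eta>'" shows "one_sided d \<eta> \<subseteq> one_sided d \<eta>'"
proof -
  have "- \<eta>' \<le> x" if "- \<eta> \<le> x" for x using assms that by linarith
  moreover have "x \<le> \<eta>'" if "x \<le> \<eta>" for x using assms that by linarith
  ultimately show ?thesis unfolding one_sided_def by blast
qed

lemma one_sided_small:
  assumes d: "0 < d" "d \<in> \<rat>" and e: "0 < e"
  shows "\<exists>\<eta>>0. emeasure (path_law M B) (one_sided d \<eta>) < e"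
proof -
  let ?A = "\<lambda>n. one_sided d (1 / real (Suc n))"
  interpret L: prob_space "path_law M B"
    by (intro prob_space_path_law prob_space_axioms random_variable_B)
  have lim: "(\<lambda>n. emeasure (path_law M B) (?A n)) \<longlonglongrightarrow> emeasure (path_law M B) (\<Inter>n. ?A n)"
  proof (rule Lim_emeasure_decseq)
    show "range ?A \<subseteq> sets (path_law M B)" using sets_one_sided[OF d] by (auto simp: path_law_def)
    have "1 / real (Suc n) \<le> 1 / real (Suc m)" if "m \<le> n" for m n
      using that by (intro divide_left_mono) auto
    then show "decseq ?A" unfolding decseq_def using one_sided_mono by blast
  qed (simp add: L.emeasure_finite)
  have "(\<Inter>n. ?A n) \<subseteq> {w\<in>space path_space. \<forall>r\<in>\<rat> \<inter> {0..d}. 0 \<le> w r} \<union>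
      {w\<in>space path_space. \<forall>r\<in>\<rat> \<inter> {0..d}. w r \<le> 0}"
  proof (rule subsetI, rule ccontr)
    fix w assume w: "w \<in> (\<Inter>n. ?A n)" "w \<notin> {w\<in>space path_space. \<forall>r\<in>\<rat> \<inter> {0..d}. 0 \<le> w r} \<union>
      {w\<in>space path_space. \<forall>r\<in>\<rat> \<inter> {0..d}. w r \<le> 0}"
    then obtain r1 r2 where r: "r1 \<in> \<rat> \<inter> {0..d}" "w r1 < 0" "r2 \<in> \<rat> \<inter> {0..d}" "0 < w r2"
      by (auto simp: one_sided_def not_le)
    obtain n where "inverse (real (Suc n)) < min (- w r1) (w r2)"
      using reals_Archimedean[of "min (- w r1) (w r2)"] r by auto
    then have "1 / real (Suc n) < - w r1" "1 / real (Suc n) < w r2" by (auto simp: inverse_eq_divide)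
    moreover have "w \<in> ?A n" using w by blast
    ultimately show False using r unfolding one_sided_def by force
  qed
  moreover have "{w\<in>space path_space. \<forall>r\<in>\<rat> \<inter> {0..d}. 0 \<le> w r} \<union>
      {w\<in>space path_space. \<forall>r\<in>\<rat> \<inter> {0..d}. w r \<le> 0} \<in> null_sets (path_law M B)"
    using paths_nonneg_null[OF d] by (intro null_sets.Un) (auto simp: null_sets_def path_law_def)
  ultimately have "emeasure (path_law M B) (\<Inter>n. ?A n) = 0"
    using emeasure_eq_0[OF null_setsD2 null_setsD1] by blast
  then have "(\<lambda>n. emeasure (path_law M B) (?A n)) \<longlonglongrightarrow> 0" using lim by simp
  then have "\<forall>\<^sub>F n in sequentially. emeasure (path_law M B) (?A n) < e" using e by (rule order_tendstoD)
  then obtain n where "emeasure (path_law M B) (?A n) < e" unfolding eventually_sequentially by blast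
  then show ?thesis by (intro exI[of _ "1 / real (Suc n)"]) simp
qed

text \<open>
  The glued process has the law of \<open>B\<close>, and its past and its future at time \<open>s\<close> are independent by
  construction.
\<close>

lemma markov_property:
  assumes s: "0 \<le> s" and U: "U \<in> sets path_space" and V: "V \<in> sets path_space"
  shows "emeasure M {\<omega>\<in>space M. path_of (\<lambda>u. B (min u s)) \<omega> \<in> U \<and> path_of (\<lambda>u \<omega>. B (s + u) \<omega> - B s \<omega>) \<omega> \<in> V} =
    emeasure M {\<omega>\<in>space M. path_of (\<lambda>u. B (min u s)) \<omega> \<in> U} * emeasure (path_law M B) V"
proof -
  define \<Phi> where "\<Phi> w = (\<lambda>u\<in>{0..}. w (min u s) :: real)" for w
  define \<Psi> where "\<Psi> w = (\<lambda>u\<in>{0..}. w (s + u) - w s :: real)" for w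
  have [measurable]: "\<Phi> \<in> path_space \<rightarrow>\<^sub>M path_space"
    unfolding \<Phi>_def by (subst (2) path_space_def, intro measurable_restrict measurable_path_component) (use s in auto)
  have [measurable]: "\<Psi> \<in> path_space \<rightarrow>\<^sub>M path_space"
    unfolding \<Psi>_def by (subst (2) path_space_def, intro measurable_restrict borel_measurable_diff measurable_path_component)
      (use s in auto)
  define E where "E = {w\<in>space path_space. \<Phi> w \<in> U \<and> \<Psi> w \<in> V}"
  note [measurable] = U V
  have E: "E \<in> sets path_space" unfolding E_def by measurable
  have stop: "path_of (\<lambda>u. B (min u s)) \<in> M \<rightarrow>\<^sub>M path_space"
    using s by (intro measurable_path_of random_variable_B) auto
  have eq1: "\<Phi> (path_of B \<omega>) = path_of (\<lambda>u. B (min u s)) \<omega>" for \<omega>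
    using s by (auto simp: \<Phi>_def path_of_def fun_eq_iff)
  have eq2: "\<Psi> (path_of B \<omega>) = path_of (\<lambda>u \<omega>. B (s + u) \<omega> - B s \<omega>) \<omega>" for \<omega>
    using s by (auto simp: \<Psi>_def path_of_def fun_eq_iff)
  have eq3: "\<Phi> (path_of (glue s) z) = path_of (\<lambda>u. B (min u s)) (fst z)" for z
    using s by (auto simp: \<Phi>_def path_of_def glue_def fun_eq_iff)
  have eq4: "\<Psi> (path_of (glue s) z) = path_of B (snd z)" if "z \<in> space (M \<Otimes>\<^sub>M M)" for z
  proof -
    have "B 0 (snd z) = 0" using that start_zero by (auto simp: space_pair_measure)
    then show ?thesis using s by (auto simp: \<Psi>_def path_of_def glue_def fun_eq_iff)
  qed
  have mg: "path_of (glue s) \<in> M \<Otimes>\<^sub>M M \<rightarrow>\<^sub>M path_space"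
    using continuous_process_glue[OF s] by (intro measurable_path_of) (simp add: continuous_process_def)
  have "{\<omega>\<in>space M. path_of (\<lambda>u. B (min u s)) \<omega> \<in> U \<and> path_of (\<lambda>u \<omega>. B (s + u) \<omega> - B s \<omega>) \<omega> \<in> V} =
      path_of B -` E \<inter> space M"
    using measurable_space[OF measurable_path_B] by (auto simp: E_def eq1 eq2)
  then have "emeasure M {\<omega>\<in>space M. path_of (\<lambda>u. B (min u s)) \<omega> \<in> U \<and> path_of (\<lambda>u \<omega>. B (s + u) \<omega> - B s \<omega>) \<omega> \<in> V} =
      emeasure (path_law M B) E"
    unfolding path_law_def by (simp add: emeasure_distr[OF measurable_path_B E])
  also have "\<dots> = emeasure (M \<Otimes>\<^sub>M M) (path_of (glue s) -` E \<inter> space (M \<Otimes>\<^sub>M M))"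
    unfolding path_law_glue[OF s, symmetric] unfolding path_law_def by (rule emeasure_distr[OF mg E])
  also have "path_of (glue s) -` E \<inter> space (M \<Otimes>\<^sub>M M) =
      (path_of (\<lambda>u. B (min u s)) -` U \<inter> space M) \<times> (path_of B -` V \<inter> space M)"
    using measurable_space[OF mg] eq3 eq4 by (auto simp: E_def space_pair_measure)
  also have "emeasure (M \<Otimes>\<^sub>M M) \<dots> = emeasure M (path_of (\<lambda>u. B (min u s)) -` U \<inter> space M) *
      emeasure M (path_of B -` V \<inter> space M)"
    by (intro emeasure_pair_measure_Times measurable_sets[OF stop U] measurable_sets[OF measurable_path_B V])
  also have "emeasure M (path_of B -` V \<inter> space M) = emeasure (path_law M B) V"
    unfolding path_law_def by (rule emeasure_distr[OF measurable_path_B V, symmetric])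
  also have "path_of (\<lambda>u. B (min u s)) -` U \<inter> space M = {\<omega>\<in>space M. path_of (\<lambda>u. B (min u s)) \<omega> \<in> U}"
    by auto
  finally show ?thesis .
qed

end

lemma AE_small_supersets:
  assumes "\<And>e. 0 < e \<Longrightarrow> \<exists>S\<in>sets M. emeasure M S \<le> ennreal e \<and> {x\<in>space M. \<not> P x} \<subseteq> S"
  shows "AE x in M. P x"
proof -
  have "\<forall>n. \<exists>S\<in>sets M. emeasure M S \<le> ennreal (1 / real (Suc n)) \<and> {x\<in>space M. \<not> P x} \<subseteq> S"
    using assms by simp
  then obtain S where S: "\<And>n. S n \<in> sets M" "\<And>n. emeasure M (S n) \<le> ennreal (1 / real (Suc n))"
    "\<And>n. {x\<in>space M. \<not> P x} \<subseteq> S n" by metis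
  have INT: "(\<Inter>n. S n) \<in> sets M" using S(1) by blast
  have "emeasure M (\<Inter>n. S n) \<le> 0 + ennreal e" if e: "0 < e" for e
  proof -
    obtain n where "inverse (real (Suc n)) < e" using reals_Archimedean[OF e] by blast
    then have "ennreal (1 / real (Suc n)) \<le> ennreal e" by (intro ennreal_leI) (simp add: inverse_eq_divide)
    moreover have "emeasure M (\<Inter>n. S n) \<le> emeasure M (S n)" using S(1) by (intro emeasure_mono) auto
    ultimately show ?thesis using S(2)[of n] by simp
  qed
  then have "emeasure M (\<Inter>n. S n) \<le> 0" by (rule ennreal_le_epsilon)
  then have "(\<Inter>n. S n) \<in> null_sets M" using INT by (simp add: null_sets_def)
  moreover have "{x\<in>space M. \<not> P x} \<subseteq> (\<Inter>n. S n)" using S(3) by (rule INT_greatest)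
  ultimately show ?thesis by (rule AE_I')
qed

lemma emeasure_eventually_le:
  assumes G: "\<And>n::nat. G n \<in> sets M" "\<And>n. emeasure M (G n) \<le> c"
  shows "(\<Union>N. \<Inter>n\<in>{N..}. G n) \<in> sets M" "emeasure M (\<Union>N. \<Inter>n\<in>{N..}. G n) \<le> c"
proof -
  have sets: "(\<Inter>n\<in>{N..}. G n) \<in> sets M" for N using G(1) by (intro sets.countable_INT') auto
  then show "(\<Union>N. \<Inter>n\<in>{N..}. G n) \<in> sets M" by blast
  have "incseq (\<lambda>N. \<Inter>n\<in>{N..}. G n)" by (intro monoI INF_superset_mono) auto
  then have "emeasure M (\<Union>N. \<Inter>n\<in>{N..}. G n) = (SUP N. emeasure M (\<Inter>n\<in>{N..}. G n))"
    using sets by (intro SUP_emeasure_incseq[symmetric]) auto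
  also have "\<dots> \<le> c"
  proof (rule SUP_least)
    fix N
    have "emeasure M (\<Inter>n\<in>{N..}. G n) \<le> emeasure M (G N)" using G(1) by (intro emeasure_mono) auto
    then show "emeasure M (\<Inter>n\<in>{N..}. G n) \<le> c" using G(2)[of N] by simp
  qed
  finally show "emeasure M (\<Union>N. \<Inter>n\<in>{N..}. G n) \<le> c" .
qed

context standard_brownian_motion
begin

text \<open>
  The level \<open>a\<close> is hit for the first time during \<open>(r,s]\<close>, and at time \<open>s\<close> the path is still close to it. Unlike
  the first hitting time, the times \<open>r\<close> and \<open>s\<close> are deterministic, so that the Markov property at \<open>s\<close> applies.
\<close>

definition first_hit_in :: "real \<Rightarrow> real \<Rightarrow> real \<Rightarrow> real \<Rightarrow> 'w set" where
  "first_hit_in a \<eta> r s = {\<omega>\<in>space M. {u\<in>{0..s}. B u \<omega> = a} \<noteq> {} \<and>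
     {u\<in>{0..s}. B u \<omega> = a} \<inter> {0..r} = {} \<and> \<bar>B s \<omega> - a\<bar> \<le> \<eta>}"

definition first_hit_paths :: "real \<Rightarrow> real \<Rightarrow> real \<Rightarrow> real \<Rightarrow> (real \<Rightarrow> real) set" where
  "first_hit_paths a \<eta> r s = {w\<in>space path_space. zset s a w \<noteq> {} \<and> zset s a w \<inter> {0..r} = {} \<and> \<bar>w s - a\<bar> \<le> \<eta>}"

definition hit_then_one_sided :: "real \<Rightarrow> real \<Rightarrow> real \<Rightarrow> real \<Rightarrow> real \<Rightarrow> 'w set" where
  "hit_then_one_sided a \<eta> d r s = {\<omega>\<in>first_hit_in a \<eta> r s.
     path_of (\<lambda>u \<omega>. B (s + u) \<omega> - B s \<omega>) \<omega> \<in> one_sided d \<eta>}"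

lemma first_hit_in_path:
  assumes s: "0 < s"
  shows "first_hit_paths a \<eta> r s \<in> sets path_space"
    and "first_hit_in a \<eta> r s = {\<omega>\<in>space M. path_of (\<lambda>u. B (min u s)) \<omega> \<in> first_hit_paths a \<eta> r s}"
proof -
  have "{w\<in>space path_space. zset s a w \<in> {C\<in>closed_subsets s. C \<noteq> {}}} \<in> sets path_space"
  proof -
    have "{C\<in>closed_subsets s. C \<noteq> {}} = space (closed_sets_space s) - {{}}" using s by auto
    then have "{C\<in>closed_subsets s. C \<noteq> {}} \<in> sets (closed_sets_space s)"
      using sets.compl_sets[OF sets_singleton_empty[OF s]] by simp
    from measurable_sets[OF measurable_zset[OF s] this] show ?thesis
      by (simp add: vimage_def Int_def conj_commute)
  qed
  then have 1: "{w\<in>space path_space. zset s a w \<noteq> {}} \<in> sets path_space" by (simp add: zset_closed)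
  have 2: "{w\<in>space path_space. zset s a w \<inter> {0..r} = {}} \<in> sets path_space"
  proof -
    have "{w\<in>space path_space. zset s a w \<inter> {0..r} = {}} =
        zset s a -` {C\<in>closed_subsets s. C \<inter> {0..r} = {}} \<inter> space path_space"
      using zset_closed by blast
    then show ?thesis using measurable_sets[OF measurable_zset[OF s] miss_open[OF s]] by simp
  qed
  have [measurable]: "(\<lambda>w. w s) \<in> borel_measurable path_space"
    using s by (intro measurable_path_component) simp
  have 3: "{w\<in>space path_space. \<bar>w s - a\<bar> \<le> \<eta>} \<in> sets path_space" by measurable
  show "first_hit_paths a \<eta> r s \<in> sets path_space"
    unfolding first_hit_paths_def using 1 2 3 by (intro sets.sets_Collect_conj)
  have meas: "path_of (\<lambda>u. B (min u s)) \<in> M \<rightarrow>\<^sub>M path_space"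
    using s by (intro measurable_path_of random_variable_B) simp
  have "zset s a (path_of (\<lambda>u. B (min u s)) \<omega>) = {u\<in>{0..s}. B u \<omega> = a}" if "\<omega> \<in> space M" for \<omega>
  proof -
    have "zset s a (path_of (\<lambda>u. B (min u s)) \<omega>) = zset s a (path_of B \<omega>)"
      by (rule zset_cong) (auto simp: path_of_def min_absorb1)
    then show ?thesis using zset_path_of[OF continuous_process_B s that] by simp
  qed
  moreover have "path_of (\<lambda>u. B (min u s)) \<omega> s = B s \<omega>" for \<omega> using s by (simp add: path_of_def)
  ultimately show "first_hit_in a \<eta> r s = {\<omega>\<in>space M. path_of (\<lambda>u. B (min u s)) \<omega> \<in> first_hit_paths a \<eta> r s}"
    using measurable_space[OF meas] unfolding first_hit_in_def first_hit_paths_def by (simp cong: conj_cong)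
qed

lemma hit_then_one_sided_markov:
  assumes s: "0 < s" and d: "0 < d" "d \<in> \<rat>"
  shows "first_hit_in a \<eta> r s \<in> sets M" "hit_then_one_sided a \<eta> d r s \<in> sets M"
    and "emeasure M (hit_then_one_sided a \<eta> d r s) =
      emeasure M (first_hit_in a \<eta> r s) * emeasure (path_law M B) (one_sided d \<eta>)"
proof -
  let ?U = "first_hit_paths a \<eta> r s"
  have stop: "path_of (\<lambda>u. B (min u s)) \<in> M \<rightarrow>\<^sub>M path_space"
    using s by (intro measurable_path_of random_variable_B) simp
  have shift: "path_of (\<lambda>u \<omega>. B (s + u) \<omega> - B s \<omega>) \<in> M \<rightarrow>\<^sub>M path_space"
    using s by (intro measurable_path_of borel_measurable_diff random_variable_B) simp_all
  have 1: "first_hit_in a \<eta> r s = path_of (\<lambda>u. B (min u s)) -` ?U \<inter> space M"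
    unfolding first_hit_in_path(2)[OF s] by auto
  show F: "first_hit_in a \<eta> r s \<in> sets M"
    unfolding 1 by (rule measurable_sets[OF stop first_hit_in_path(1)[OF s]])
  have 2: "hit_then_one_sided a \<eta> d r s = first_hit_in a \<eta> r s \<inter>
      (path_of (\<lambda>u \<omega>. B (s + u) \<omega> - B s \<omega>) -` one_sided d \<eta> \<inter> space M)"
    unfolding hit_then_one_sided_def first_hit_in_def by auto
  show "hit_then_one_sided a \<eta> d r s \<in> sets M"
    unfolding 2 by (intro sets.Int F measurable_sets[OF shift sets_one_sided[OF d]])
  have 3: "hit_then_one_sided a \<eta> d r s = {\<omega>\<in>space M. path_of (\<lambda>u. B (min u s)) \<omega> \<in> ?U \<and>
      path_of (\<lambda>u \<omega>. B (s + u) \<omega> - B s \<omega>) \<omega> \<in> one_sided d \<eta>}"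
    unfolding hit_then_one_sided_def first_hit_in_path(2)[OF s] by auto
  show "emeasure M (hit_then_one_sided a \<eta> d r s) =
      emeasure M (first_hit_in a \<eta> r s) * emeasure (path_law M B) (one_sided d \<eta>)"
    unfolding 3 first_hit_in_path(2)[OF s]
    by (rule markov_property[OF less_imp_le[OF s] first_hit_in_path(1)[OF s] sets_one_sided[OF d]])
qed

definition grid_event :: "real \<Rightarrow> real \<Rightarrow> real \<Rightarrow> nat \<Rightarrow> 'w set" where
  "grid_event a \<eta> d n = (\<Union>j. hit_then_one_sided a \<eta> d (real j / real (Suc n)) (real (Suc j) / real (Suc n)))"

text \<open>
  The strong Markov property at the first hit, along the grid of mesh \<open>1 / (n + 1)\<close>: the first hit falls into
  one cell only, and the path that restarts at the end of this cell is independent of the first hit.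
\<close>

lemma grid_event_le:
  assumes d: "0 < d" "d \<in> \<rat>"
  shows "grid_event a \<eta> d n \<in> sets M"
    and "emeasure M (grid_event a \<eta> d n) \<le> emeasure (path_law M B) (one_sided d \<eta>)"
proof -
  let ?F = "\<lambda>j::nat. first_hit_in a \<eta> (real j / real (Suc n)) (real (Suc j) / real (Suc n))"
  let ?H = "\<lambda>j::nat. hit_then_one_sided a \<eta> d (real j / real (Suc n)) (real (Suc j) / real (Suc n))"
  have pos: "0 < real (Suc j) / real (Suc n)" for j by simp
  note mk = hit_then_one_sided_markov[OF pos d]
  show "grid_event a \<eta> d n \<in> sets M" unfolding grid_event_def using mk(2) by blast
  have disj: "disjoint_family ?F"
      unfolding disjoint_family_on_def
  proof (intro ballI impI)
    have *: "?F i \<inter> ?F j = {}" if ij: "i < j" for i j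
    proof -
      have "real (Suc i) / real (Suc n) \<le> real j / real (Suc n)"
        using ij by (intro divide_right_mono) auto
      moreover have "real j / real (Suc n) \<le> real (Suc j) / real (Suc n)"
        by (intro divide_right_mono) auto
      ultimately show ?thesis unfolding first_hit_in_def by fastforce
    qed
    show "?F i \<inter> ?F j = {}" if "i \<noteq> j" for i j
      using *[of i j] *[of j i] that by (cases "i < j") auto
  qed
  have "emeasure M (grid_event a \<eta> d n) \<le> (\<Sum>j. emeasure M (?H j))"
    unfolding grid_event_def using mk(2) by (intro emeasure_subadditive_countably) auto
  also have "\<dots> = (\<Sum>j. emeasure M (?F j)) * emeasure (path_law M B) (one_sided d \<eta>)"
    unfolding mk(3) by simp
  also have "(\<Sum>j. emeasure M (?F j)) = emeasure M (\<Union>j. ?F j)"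
    using mk(1) disj by (intro suminf_emeasure) auto
  also have "\<dots> * emeasure (path_law M B) (one_sided d \<eta>) \<le> 1 * emeasure (path_law M B) (one_sided d \<eta>)"
    by (intro mult_right_mono emeasure_le_1) simp
  finally show "emeasure M (grid_event a \<eta> d n) \<le> emeasure (path_law M B) (one_sided d \<eta>)" by simp
qed

text \<open>
  If the level is not hit again during \<open>\<delta>\<close> after the first hit, then, by the intermediate value theorem, the path
  stays on one side of it; seen from the next grid point, it does so up to an error that tends to \<open>0\<close> with
  the mesh.
\<close>

lemma isolated_first_hit_in_grid_event:
  assumes \<omega>: "\<omega> \<in> space M" and d: "0 < d" "d < \<delta>" and \<eta>: "0 < \<eta>"
    and \<tau>: "0 < \<tau>" "B \<tau> \<omega> = a" "\<forall>u\<in>{0..<\<tau>}. B u \<omega> \<noteq> a" "\<forall>u\<in>{\<tau><..\<tau> + \<delta>}. B u \<omega> \<noteq> a"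
  shows "\<exists>N. \<forall>n\<ge>N. \<omega> \<in> grid_event a \<eta> d n"
proof -
  have cont: "continuous_on {0..} (\<lambda>t. B t \<omega>)" using \<omega> by (rule continuous_paths)
  have sides: "(\<forall>u\<in>{\<tau>..\<tau> + \<delta>}. a \<le> B u \<omega>) \<or> (\<forall>u\<in>{\<tau>..\<tau> + \<delta>}. B u \<omega> \<le> a)"
  proof (rule ccontr)
    assume "\<not> ?thesis"
    then obtain x y where x: "x \<in> {\<tau>..\<tau> + \<delta>}" "B x \<omega> < a" and y: "y \<in> {\<tau>..\<tau> + \<delta>}" "a < B y \<omega>"
      by (auto simp: not_le)
    have x': "x \<in> {\<tau><..\<tau> + \<delta>}" and y': "y \<in> {\<tau><..\<tau> + \<delta>}"
      using x y \<tau>(2) by (auto simp: less_le)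
    have "connected ((\<lambda>t. B t \<omega>) ` {\<tau><..\<tau> + \<delta>})"
    proof (rule connected_continuous_image)
      show "continuous_on {\<tau><..\<tau> + \<delta>} (\<lambda>t. B t \<omega>)"
        by (rule continuous_on_subset[OF cont]) (use \<tau> in auto)
    qed simp
    then have "a \<in> (\<lambda>t. B t \<omega>) ` {\<tau><..\<tau> + \<delta>}"
      using connectedD_interval[OF _ imageI[OF x'] imageI[OF y'], of "\<lambda>t. B t \<omega>" a] x(2) y(2) by simp
    then show False using \<tau>(4) by auto
  qed
  obtain \<rho> where \<rho>: "\<rho> > 0" "\<And>u. u \<in> {0..} \<Longrightarrow> dist u \<tau> < \<rho> \<Longrightarrow> dist (B u \<omega>) (B \<tau> \<omega>) < \<eta>"
  proof -
    have "\<tau> \<in> {0..}" using \<tau> by simp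
    then show ?thesis using cont \<eta> that unfolding continuous_on_iff by meson
  qed
  have "0 < min \<rho> (\<delta> - d)" using \<rho> d by simp
  then obtain N where N: "inverse (real (Suc N)) < min \<rho> (\<delta> - d)" using reals_Archimedean by blast
  have "\<omega> \<in> grid_event a \<eta> d n" if n: "n \<ge> N" for n
  proof -
    define h where "h = 1 / real (Suc n)"
    have "h \<le> inverse (real (Suc N))" using n by (simp add: h_def inverse_eq_divide divide_left_mono)
    then have h: "0 < h" "h < \<rho>" "h < \<delta> - d" using N by (auto simp: h_def)
    define j where "j = nat (\<lceil>\<tau> / h\<rceil> - 1)"
    have "0 < \<tau> / h" using \<tau> h by simp
    then have "real j = of_int \<lceil>\<tau> / h\<rceil> - 1" unfolding j_def by (simp add: of_nat_nat)
    then have "real j < \<tau> / h" "\<tau> / h \<le> real j + 1" using ceiling_correct[of "\<tau> / h"] by linarith+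
    then have j: "real j * h < \<tau>" "\<tau> \<le> real (Suc j) * h" using h by (auto simp: field_simps)
    define s where "s = real (Suc j) * h"
    have s: "\<tau> \<le> s" "s < \<tau> + h" "0 < s" using j \<tau> by (auto simp: s_def field_simps)
    have Bs: "\<bar>B s \<omega> - a\<bar> < \<eta>"
      using \<rho>(2)[of s] s h \<tau> by (auto simp: dist_real_def)
    have "{u\<in>{0..s}. B u \<omega> = a} \<noteq> {}" using \<tau> s by (auto intro!: exI[of _ \<tau>])
    moreover have "{u\<in>{0..s}. B u \<omega> = a} \<inter> {0..real j * h} = {}" using \<tau>(3) j by fastforce
    ultimately have "\<omega> \<in> first_hit_in a \<eta> (real j * h) s"
      using \<omega> Bs by (auto simp: first_hit_in_def)
    moreover have "path_of (\<lambda>u \<omega>. B (s + u) \<omega> - B s \<omega>) \<omega> \<in> one_sided d \<eta>"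
    proof -
      have in_range: "s + r \<in> {\<tau>..\<tau> + \<delta>}" if "r \<in> \<rat> \<inter> {0..d}" for r
        using that s h by auto
      have "path_of (\<lambda>u \<omega>. B (s + u) \<omega> - B s \<omega>) \<omega> r = B (s + r) \<omega> - B s \<omega>" if "r \<in> \<rat> \<inter> {0..d}" for r
        using that by (simp add: path_of_def)
      moreover have "(\<forall>r\<in>\<rat> \<inter> {0..d}. - \<eta> \<le> B (s + r) \<omega> - B s \<omega>) \<or> (\<forall>r\<in>\<rat> \<inter> {0..d}. B (s + r) \<omega> - B s \<omega> \<le> \<eta>)"
        using sides
      proof
        assume *: "\<forall>u\<in>{\<tau>..\<tau> + \<delta>}. a \<le> B u \<omega>"
        have "- \<eta> \<le> B (s + r) \<omega> - B s \<omega>" if "r \<in> \<rat> \<inter> {0..d}" for r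
          using *[rule_format, OF in_range[OF that]] Bs by linarith
        then show ?thesis by blast
      next
        assume *: "\<forall>u\<in>{\<tau>..\<tau> + \<delta>}. B u \<omega> \<le> a"
        have "B (s + r) \<omega> - B s \<omega> \<le> \<eta>" if "r \<in> \<rat> \<inter> {0..d}" for r
          using *[rule_format, OF in_range[OF that]] Bs by linarith
        then show ?thesis by blast
      qed
      moreover have "path_of (\<lambda>u \<omega>. B (s + u) \<omega> - B s \<omega>) \<omega> \<in> space path_space"
        by (simp add: path_of_def space_path_space)
      ultimately show ?thesis by (simp add: one_sided_def)
    qed
    ultimately have "\<omega> \<in> hit_then_one_sided a \<eta> d (real j / real (Suc n)) (real (Suc j) / real (Suc n))"
      by (simp add: hit_then_one_sided_def s_def h_def)
    then show ?thesis unfolding grid_event_def by blast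
  qed
  then show ?thesis by blast
qed

lemma AE_first_hit_not_isolated:
  assumes \<delta>: "0 < \<delta>"
  shows "AE \<omega> in M. \<not> (\<exists>\<tau>>0. B \<tau> \<omega> = a \<and> (\<forall>u\<in>{0..<\<tau>}. B u \<omega> \<noteq> a) \<and> (\<forall>u\<in>{\<tau><..\<tau> + \<delta>}. B u \<omega> \<noteq> a))"
proof (rule AE_small_supersets)
  fix e :: real assume e: "0 < e"
  obtain d where d: "d \<in> \<rat>" "0 < d" "d < \<delta>" using Rats_dense_in_real[OF \<delta>] by blast
  obtain \<eta> where \<eta>: "0 < \<eta>" "emeasure (path_law M B) (one_sided d \<eta>) < ennreal e"
    using one_sided_small[OF d(2,1), of "ennreal e"] e by auto
  let ?S = "\<Union>N. \<Inter>n\<in>{N..}. grid_event a \<eta> d n"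
  note S = emeasure_eventually_le[of "grid_event a \<eta> d", OF grid_event_le[OF d(2,1)]]
  have "{\<omega>\<in>space M. \<not> \<not> (\<exists>\<tau>>0. B \<tau> \<omega> = a \<and> (\<forall>u\<in>{0..<\<tau>}. B u \<omega> \<noteq> a) \<and>
      (\<forall>u\<in>{\<tau><..\<tau> + \<delta>}. B u \<omega> \<noteq> a))} \<subseteq> ?S"
  proof
    fix \<omega> assume "\<omega> \<in> {\<omega>\<in>space M. \<not> \<not> (\<exists>\<tau>>0. B \<tau> \<omega> = a \<and> (\<forall>u\<in>{0..<\<tau>}. B u \<omega> \<noteq> a) \<and>
      (\<forall>u\<in>{\<tau><..\<tau> + \<delta>}. B u \<omega> \<noteq> a))}"
    then obtain \<tau> where "\<omega> \<in> space M" "\<tau> > 0" "B \<tau> \<omega> = a" "\<forall>u\<in>{0..<\<tau>}. B u \<omega> \<noteq> a"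
      "\<forall>u\<in>{\<tau><..\<tau> + \<delta>}. B u \<omega> \<noteq> a" by blast
    from isolated_first_hit_in_grid_event[OF this(1) d(2,3) \<eta>(1) this(2-5)]
    show "\<omega> \<in> ?S" by blast
  qed
  then show "\<exists>S\<in>sets M. emeasure M S \<le> ennreal e \<and> {\<omega>\<in>space M. \<not> \<not> (\<exists>\<tau>>0. B \<tau> \<omega> = a \<and>
      (\<forall>u\<in>{0..<\<tau>}. B u \<omega> \<noteq> a) \<and> (\<forall>u\<in>{\<tau><..\<tau> + \<delta>}. B u \<omega> \<noteq> a))} \<subseteq> S"
    using S \<eta>(2) by (intro bexI[of _ ?S] conjI) auto
qed

text \<open>
  A finite nonempty level set would be isolated from the right at its first point.
\<close>

lemma AE_level_set_empty_or_infinite: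
  assumes t: "0 < t" and a: "a \<noteq> 0"
  shows "AE \<omega> in M. {s\<in>{0..t}. B s \<omega> = a} = {} \<or> infinite {s\<in>{0..t}. B s \<omega> = a}"
proof -
  have "AE \<omega> in M. \<forall>n::nat. \<not> (\<exists>\<tau>>0. B \<tau> \<omega> = a \<and> (\<forall>u\<in>{0..<\<tau>}. B u \<omega> \<noteq> a) \<and>
      (\<forall>u\<in>{\<tau><..\<tau> + 1 / real (Suc n)}. B u \<omega> \<noteq> a))"
    unfolding AE_all_countable by (intro allI AE_first_hit_not_isolated) simp
  then show ?thesis
    using AE_not_level[OF t, of a] AE_space
  proof eventually_elim
    fix \<omega>
    let ?Z = "{s\<in>{0..t}. B s \<omega> = a}"
    assume none: "\<forall>n::nat. \<not> (\<exists>\<tau>>0. B \<tau> \<omega> = a \<and> (\<forall>u\<in>{0..<\<tau>}. B u \<omega> \<noteq> a) \<and>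
      (\<forall>u\<in>{\<tau><..\<tau> + 1 / real (Suc n)}. B u \<omega> \<noteq> a))"
      and end_: "B t \<omega> \<noteq> a" and \<omega>: "\<omega> \<in> space M"
    show "?Z = {} \<or> infinite ?Z"
    proof (rule ccontr)
      assume "\<not> ?thesis"
      then have fin: "finite ?Z" and ne: "?Z \<noteq> {}" by auto
      define \<tau> where "\<tau> = Min ?Z"
      have "\<tau> \<in> ?Z" using fin ne unfolding \<tau>_def by (rule Min_in)
      moreover have min: "\<tau> \<le> s" if "s \<in> ?Z" for s using fin that unfolding \<tau>_def by (rule Min_le)
      ultimately have \<tau>: "0 \<le> \<tau>" "\<tau> \<le> t" "B \<tau> \<omega> = a" by auto
      have \<tau>0: "0 < \<tau>" using \<tau> a start_zero[OF \<omega>] by (cases "\<tau> = 0") auto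
      have \<tau>t: "\<tau> < t" using \<tau> end_ by (cases "\<tau> = t") auto
      \<comment> \<open>the next point of the level set, or the end of the interval\<close>
      define \<sigma> where "\<sigma> = Min (insert t (?Z - {\<tau>}))"
      have fin': "finite (insert t (?Z - {\<tau>}))" using fin by simp
      have "\<tau> < x" if "x \<in> insert t (?Z - {\<tau>})" for x
        using that \<tau>t min[of x] by (cases "x = t") (auto simp: less_le)
      then have "\<tau> < \<sigma>" using fin' by (simp add: \<sigma>_def)
      obtain n where "inverse (real (Suc n)) < \<sigma> - \<tau>"
        using reals_Archimedean[of "\<sigma> - \<tau>"] \<open>\<tau> < \<sigma>\<close> by auto
      then have n: "\<tau> + 1 / real (Suc n) < \<sigma>" by (simp add: inverse_eq_divide)
      have "\<sigma> \<le> t" unfolding \<sigma>_def using fin' by (intro Min_le) auto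
      have "B u \<omega> \<noteq> a" if u: "u \<in> {\<tau><..\<tau> + 1 / real (Suc n)}" for u
      proof
        assume "B u \<omega> = a"
        then have "u \<in> insert t (?Z - {\<tau>})" using u n \<open>\<sigma> \<le> t\<close> \<tau>0 by auto
        then have "\<sigma> \<le> u" unfolding \<sigma>_def using fin' by (intro Min_le)
        then show False using u n by simp
      qed
      moreover have "B u \<omega> \<noteq> a" if "u \<in> {0..<\<tau>}" for u
        using that min[of u] \<tau>t by auto
      ultimately show False using none[rule_format, of n] \<tau>0 \<tau>(3) by blast
    qed
  qed
qed

end

section \<open>Half-densities\<close>

lemma ae_class_eq_iff:
  assumes "f \<in> borel_measurable P" "g \<in> borel_measurable P"
  shows "ae_class P f = ae_class P g \<longleftrightarrow> (AE x in P. f x = g x)"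
proof
  assume "ae_class P f = ae_class P g"
  then have "f \<in> ae_class P g" using assms by (auto simp: ae_class_def)
  then show "AE x in P. f x = g x" by (simp add: ae_class_def)
next
  assume eq: "AE x in P. f x = g x"
  have "(AE x in P. h x = f x) \<longleftrightarrow> (AE x in P. h x = g x)" for h
    by (rule AE_equiv) (use eq in eventually_elim, simp)
  then show "ae_class P f = ae_class P g" by (simp add: ae_class_def)
qed

lemma ae_class_self: "f \<in> borel_measurable P \<Longrightarrow> f \<in> ae_class P f"
  by (simp add: ae_class_def)

lemma ae_class_member:
  "g \<in> ae_class P f \<Longrightarrow> f \<in> borel_measurable P \<Longrightarrow> ae_class P g = ae_class P f"
  by (subst ae_class_eq_iff) (auto simp: ae_class_def)

lemma L2_classesD:
  assumes "F \<in> L2_classes P" "f \<in> F"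
  shows "f \<in> borel_measurable P" "integrable P (\<lambda>x. (cmod (f x))\<^sup>2)" "F = ae_class P f"
proof -
  obtain g where g: "F = ae_class P g" "g \<in> borel_measurable P" "integrable P (\<lambda>x. (cmod (g x))\<^sup>2)"
    using assms by (auto simp: L2_classes_def)
  show f: "f \<in> borel_measurable P" using assms g by (simp add: ae_class_def)
  have "AE x in P. g x = f x" using assms(2) unfolding g(1) ae_class_def by auto
  then show "integrable P (\<lambda>x. (cmod (f x))\<^sup>2)"
    using f g by (intro integrable_cong_AE_imp[OF g(3)]) (auto elim!: eventually_mono)
  show "F = ae_class P f" using assms(2) g ae_class_member by blast
qed

lemma L2_classes_nonempty: "F \<in> L2_classes P \<Longrightarrow> \<exists>f. f \<in> F"
  unfolding L2_classes_def using ae_class_self by blast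

lemma measure_singleton_AE:
  assumes "AE x in P. \<phi> x" "{a} \<in> sets P" "measure P {a} \<noteq> 0"
  shows "\<phi> a"
proof (rule ccontr)
  assume "\<not> \<phi> a"
  obtain N where N: "N \<in> null_sets P" "{x\<in>space P. \<not> \<phi> x} \<subseteq> N"
    using assms(1) by (auto simp: eventually_ae_filter)
  have "a \<in> space P" using sets.sets_into_space[OF assms(2)] by simp
  then have "{a} \<subseteq> N" using N \<open>\<not> \<phi> a\<close> by auto
  then have "emeasure P {a} = 0" using emeasure_eq_0[of N P "{a}"] N(1) by auto
  then show False using assms(3) by (simp add: measure_def)
qed

locale measure_class =
  fixes \<T> :: "'a measure set"
  assumes nonempty: "\<T> \<noteq> {}"
    and prob: "P \<in> \<T> \<Longrightarrow> prob_space P"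
    and equivalent: "P \<in> \<T> \<Longrightarrow> Q \<in> \<T> \<Longrightarrow> equivalent_measures P Q"
begin

text \<open>
  The factor \<open>sqrt (dP/dQ)\<close> that turns the representative of a half-density in \<open>L\<^sub>2(P)\<close> into the one in
  \<open>L\<^sub>2(Q)\<close>.
\<close>

definition root_density :: "'a measure \<Rightarrow> 'a measure \<Rightarrow> 'a \<Rightarrow> real" where
  "root_density Q P x = sqrt (enn2real (RN_deriv Q P x))"

lemma sets_eq: "P \<in> \<T> \<Longrightarrow> Q \<in> \<T> \<Longrightarrow> sets P = sets Q"
  using equivalent equivalent_measures_sets by blast

lemma borel_measurable_eq: "P \<in> \<T> \<Longrightarrow> Q \<in> \<T> \<Longrightarrow> borel_measurable P = borel_measurable Q"
  by (rule measurable_cong_sets[OF sets_eq refl])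

lemma borel_measurable_root_density [measurable]: "root_density Q P \<in> borel_measurable Q"
  unfolding root_density_def by measurable

lemma sigma_finite: "P \<in> \<T> \<Longrightarrow> sigma_finite_measure P"
  by (intro prob_space_imp_sigma_finite prob)

lemma density_RN: "P \<in> \<T> \<Longrightarrow> Q \<in> \<T> \<Longrightarrow> density Q (RN_deriv Q P) = P"
  using equivalent[of P Q] sigma_finite[of Q] sets_eq[of P Q]
  by (intro sigma_finite_measure.density_RN_deriv) (auto simp: equivalent_measures_def)

lemma RN_finite: "P \<in> \<T> \<Longrightarrow> Q \<in> \<T> \<Longrightarrow> AE x in Q. RN_deriv Q P x \<noteq> \<infinity>"
  using equivalent[of P Q] sigma_finite[of Q] sigma_finite[of P] sets_eq[of P Q]
  by (intro sigma_finite_measure.RN_deriv_finite) (auto simp: equivalent_measures_def)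

lemma root_density_unique:
  assumes P: "P \<in> \<T>" and Q: "Q \<in> \<T>" and r: "r \<in> borel_measurable Q" "density Q r = P"
  shows "AE x in Q. root_density Q P x = sqrt (enn2real (r x))"
proof -
  have "AE x in Q. r x = RN_deriv Q P x"
    using sigma_finite_measure.RN_deriv_unique[OF sigma_finite[OF Q] r(1)] r(2) by simp
  then show ?thesis by (auto simp: root_density_def elim!: eventually_mono)
qed

lemma root_density_self: "P \<in> \<T> \<Longrightarrow> AE x in P. root_density P P x = 1"
  using root_density_unique[of P P "\<lambda>_. 1"] by (simp add: density_1)

lemma root_density_chain:
  assumes P: "P \<in> \<T>" and Q: "Q \<in> \<T>" and R: "R \<in> \<T>"
  shows "AE x in R. root_density R P x = root_density R Q x * root_density Q P x"
proof -
  have m: "RN_deriv Q P \<in> borel_measurable R" unfolding borel_measurable_eq[OF R Q] by simp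
  have "density R (\<lambda>x. RN_deriv R Q x * RN_deriv Q P x) = density (density R (RN_deriv R Q)) (RN_deriv Q P)"
    by (rule density_density_eq[OF borel_measurable_RN_deriv m, symmetric])
  also have "\<dots> = P" using density_RN P Q R by simp
  finally have "AE x in R. root_density R P x = sqrt (enn2real (RN_deriv R Q x * RN_deriv Q P x))"
    using m by (intro root_density_unique[OF P R]) auto
  then show ?thesis by (simp add: root_density_def enn2real_mult real_sqrt_mult)
qed

lemma nn_integral_root_density:
  assumes P: "P \<in> \<T>" and Q: "Q \<in> \<T>"
    and h: "h \<in> borel_measurable P" and f: "f \<in> borel_measurable P"
    and g: "AE x in Q. g x = complex_of_real (root_density Q P x) * f x"
  shows "(\<integral>\<^sup>+x. h x * ennreal ((cmod (g x))\<^sup>2) \<partial>Q) = (\<integral>\<^sup>+x. h x * ennreal ((cmod (f x))\<^sup>2) \<partial>P)"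
proof -
  have [measurable]: "h \<in> borel_measurable Q" "f \<in> borel_measurable Q"
    using borel_measurable_eq[OF P Q] h f by auto
  have "(\<integral>\<^sup>+x. h x * ennreal ((cmod (f x))\<^sup>2) \<partial>P) =
      (\<integral>\<^sup>+x. h x * ennreal ((cmod (f x))\<^sup>2) \<partial>density Q (RN_deriv Q P))"
    by (simp add: density_RN[OF P Q])
  also have "\<dots> = (\<integral>\<^sup>+x. RN_deriv Q P x * (h x * ennreal ((cmod (f x))\<^sup>2)) \<partial>Q)"
    by (subst nn_integral_density) auto
  also have "\<dots> = (\<integral>\<^sup>+x. h x * ennreal ((cmod (g x))\<^sup>2) \<partial>Q)"
  proof (rule nn_integral_cong_AE)
    show "AE x in Q. RN_deriv Q P x * (h x * ennreal ((cmod (f x))\<^sup>2)) = h x * ennreal ((cmod (g x))\<^sup>2)"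
      using g RN_finite[OF P Q]
    proof eventually_elim
      fix x assume gx: "g x = complex_of_real (root_density Q P x) * f x" and fin: "RN_deriv Q P x \<noteq> \<infinity>"
      have "ennreal ((cmod (g x))\<^sup>2) = ennreal (enn2real (RN_deriv Q P x)) * ennreal ((cmod (f x))\<^sup>2)"
        unfolding gx by (simp add: norm_mult power_mult_distrib root_density_def ennreal_mult)
      also have "ennreal (enn2real (RN_deriv Q P x)) = RN_deriv Q P x"
        using fin by (simp add: less_top)
      finally show "RN_deriv Q P x * (h x * ennreal ((cmod (f x))\<^sup>2)) = h x * ennreal ((cmod (g x))\<^sup>2)"
        by (simp add: mult_ac)
    qed
  qed
  finally show ?thesis by simp
qed

lemma measure_singleton_root_density:
  assumes P: "P \<in> \<T>" and Q: "Q \<in> \<T>" and a: "{a} \<in> sets P"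
  shows "sqrt (measure P {a}) = root_density Q P a * sqrt (measure Q {a})"
proof -
  have aQ: "{a} \<in> sets Q" using a sets_eq[OF P Q] by simp
  have "emeasure P {a} = emeasure (density Q (RN_deriv Q P)) {a}" by (simp add: density_RN[OF P Q])
  also have "\<dots> = (\<integral>\<^sup>+x. RN_deriv Q P x * indicator {a} x \<partial>Q)"
    using aQ by (intro emeasure_density) auto
  also have "\<dots> = (\<integral>\<^sup>+x. RN_deriv Q P a * indicator {a} x \<partial>Q)"
    by (intro nn_integral_cong) (auto simp: indicator_def)
  also have "\<dots> = RN_deriv Q P a * emeasure Q {a}" using aQ by (simp add: nn_integral_cmult)
  finally show ?thesis by (simp add: measure_def enn2real_mult root_density_def real_sqrt_mult)
qed

lemma L2_typeD:
  assumes \<psi>: "\<psi> \<in> L2_type \<T>" and P: "P \<in> \<T>" and f: "f \<in> \<psi> P"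
  shows "f \<in> borel_measurable P" "integrable P (\<lambda>x. (cmod (f x))\<^sup>2)" "\<psi> P = ae_class P f"
proof -
  have "\<psi> P \<in> L2_classes P" using \<psi> P by (auto simp: L2_type_def)
  from L2_classesD[OF this f]
  show "f \<in> borel_measurable P" "integrable P (\<lambda>x. (cmod (f x))\<^sup>2)" "\<psi> P = ae_class P f" by auto
qed

lemma L2_type_member: "\<psi> \<in> L2_type \<T> \<Longrightarrow> P \<in> \<T> \<Longrightarrow> \<exists>f. f \<in> \<psi> P"
  unfolding L2_type_def by (intro L2_classes_nonempty) auto

lemma L2_type_change:
  assumes \<psi>: "\<psi> \<in> L2_type \<T>" and P: "P \<in> \<T>" and Q: "Q \<in> \<T>" and f: "f \<in> \<psi> P"
  shows "\<psi> Q = ae_class Q (\<lambda>x. complex_of_real (root_density Q P x) * f x)"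
  using assms unfolding L2_type_def root_density_def by blast

lemma borel_measurable_change:
  "P \<in> \<T> \<Longrightarrow> Q \<in> \<T> \<Longrightarrow> f \<in> borel_measurable P \<Longrightarrow>
    (\<lambda>x. complex_of_real (root_density Q P x) * f x) \<in> borel_measurable Q"
  using borel_measurable_eq[of P Q] by (intro borel_measurable_times borel_measurable_of_real) auto

lemma L2_type_AE:
  assumes "\<psi> \<in> L2_type \<T>" "P \<in> \<T>" "Q \<in> \<T>" "f \<in> \<psi> P" "g \<in> \<psi> Q"
  shows "AE x in Q. g x = complex_of_real (root_density Q P x) * f x"
  using assms L2_type_change[of \<psi> P Q f] by (simp add: ae_class_def)

lemma L2_type_eqI:
  assumes "\<psi> \<in> L2_type \<T>" "\<phi> \<in> L2_type \<T>" "P \<in> \<T>" "f \<in> \<psi> P" "f \<in> \<phi> P"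
  shows "\<psi> = \<phi>"
proof (rule extensionalityI[of _ \<T>])
  show "\<psi> \<in> extensional \<T>" "\<phi> \<in> extensional \<T>" using assms by (auto simp: L2_type_def PiE_def)
  show "\<psi> Q = \<phi> Q" if "Q \<in> \<T>" for Q
    using L2_type_change[OF assms(1,3) that assms(4)] L2_type_change[OF assms(2,3) that assms(5)] by simp
qed

lemma integrable_square_iff:
  fixes f :: "'a \<Rightarrow> complex"
  assumes "f \<in> borel_measurable P"
  shows "integrable P (\<lambda>x. (cmod (f x))\<^sup>2) \<longleftrightarrow> (\<integral>\<^sup>+x. 1 * ennreal ((cmod (f x))\<^sup>2) \<partial>P) < \<infinity>"
  using assms by (subst integrable_iff_bounded) auto

definition half_density_of :: "'a measure \<Rightarrow> ('a \<Rightarrow> complex) \<Rightarrow> 'a half_density" where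
  "half_density_of P f = (\<lambda>Q\<in>\<T>. ae_class Q (\<lambda>x. complex_of_real (root_density Q P x) * f x))"

lemma half_density_of:
  assumes P: "P \<in> \<T>" and f: "f \<in> borel_measurable P" "integrable P (\<lambda>x. (cmod (f x))\<^sup>2)"
  shows "half_density_of P f \<in> L2_type \<T>" "f \<in> half_density_of P f P"
proof -
  let ?f = "\<lambda>Q x. complex_of_real (root_density Q P x) * f x"
  have m: "?f Q \<in> borel_measurable Q" if "Q \<in> \<T>" for Q using borel_measurable_change[OF P that f(1)] .
  have i: "integrable Q (\<lambda>x. (cmod (?f Q x))\<^sup>2)" if Q: "Q \<in> \<T>" for Q
    using nn_integral_root_density[OF P Q _ f(1), of "\<lambda>_. 1" "?f Q"] f(2)
    unfolding integrable_square_iff[OF m[OF Q]] integrable_square_iff[OF f(1)] by simp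
  show "half_density_of P f \<in> L2_type \<T>"
    unfolding L2_type_def
  proof (intro CollectI conjI ballI)
    show "half_density_of P f \<in> (\<Pi>\<^sub>E Q\<in>\<T>. L2_classes Q)"
      using m i by (auto simp: half_density_of_def L2_classes_def)
    fix Q R g assume Q: "Q \<in> \<T>" and R: "R \<in> \<T>" and "g \<in> half_density_of P f Q"
    then have g: "g \<in> borel_measurable Q" "AE x in Q. g x = ?f Q x"
      by (auto simp: half_density_of_def ae_class_def)
    then have "AE x in R. g x = ?f Q x" using AE_equivalent_measures[OF equivalent[OF Q R]] by blast
    then have "AE x in R. ?f R x = complex_of_real (root_density R Q x) * g x"
      using root_density_chain[OF P Q R] by eventually_elim simp
    then have "ae_class R (?f R) = ae_class R (\<lambda>x. complex_of_real (root_density R Q x) * g x)"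
      by (subst ae_class_eq_iff) (use m[OF R] borel_measurable_change[OF Q R g(1)] in auto)
    then show "half_density_of P f R = ae_class R (\<lambda>x. complex_of_real (sqrt (enn2real (RN_deriv R Q x))) * g x)"
      using R by (simp add: half_density_of_def root_density_def)
  qed
  show "f \<in> half_density_of P f P"
    using P f(1) root_density_self[OF P]
    by (auto simp: half_density_of_def ae_class_def elim!: eventually_mono)
qed

subsection \<open>The squared modulus and the coefficients at atoms\<close>

text \<open>
  The measure \<open>\<bar>f\<bar>\<^sup>2 P\<close>, and the inner product of a half-density with the unit vector that sits at an atom, do not
  depend on the choice of \<open>P\<close> and of the representative \<open>f\<close>.
\<close>

definition square :: "'a half_density \<Rightarrow> 'a measure" where
  "square \<psi> = (let P = SOME P. P \<in> \<T>; f = SOME f. f \<in> \<psi> P in density P (\<lambda>x. ennreal ((cmod (f x))\<^sup>2)))"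

definition atom :: "'a \<Rightarrow> 'a half_density \<Rightarrow> complex" where
  "atom a \<psi> = (let P = SOME P. P \<in> \<T>; f = SOME f. f \<in> \<psi> P in f a * complex_of_real (sqrt (measure P {a})))"

lemma some_representative:
  assumes "\<psi> \<in> L2_type \<T>"
  shows "(SOME P. P \<in> \<T>) \<in> \<T>" "(SOME f. f \<in> \<psi> (SOME P. P \<in> \<T>)) \<in> \<psi> (SOME P. P \<in> \<T>)"
proof -
  show P: "(SOME P. P \<in> \<T>) \<in> \<T>" using nonempty by (simp add: some_in_eq)
  show "(SOME f. f \<in> \<psi> (SOME P. P \<in> \<T>)) \<in> \<psi> (SOME P. P \<in> \<T>)"
    using L2_type_member[OF assms P] by (rule someI_ex)
qed

text \<open>
  The factor between two representatives is the square root of the density between the two measures.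
\<close>

lemma square_eq:
  assumes \<psi>: "\<psi> \<in> L2_type \<T>" and Q: "Q \<in> \<T>" and g: "g \<in> \<psi> Q"
  shows "square \<psi> = density Q (\<lambda>x. ennreal ((cmod (g x))\<^sup>2))"
proof -
  define P where "P = (SOME P. P \<in> \<T>)"
  define f where "f = (SOME f. f \<in> \<psi> P)"
  have P: "P \<in> \<T>" and f: "f \<in> \<psi> P" using some_representative[OF \<psi>] by (auto simp: P_def f_def)
  have [measurable]: "f \<in> borel_measurable P" "g \<in> borel_measurable Q"
    using L2_typeD(1)[OF \<psi>] P f Q g by auto
  have "density P (\<lambda>x. ennreal ((cmod (f x))\<^sup>2)) = density Q (\<lambda>x. ennreal ((cmod (g x))\<^sup>2))"
  proof (rule measure_eqI)
    show "sets (density P (\<lambda>x. ennreal ((cmod (f x))\<^sup>2))) = sets (density Q (\<lambda>x. ennreal ((cmod (g x))\<^sup>2)))"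
      using sets_eq[OF P Q] by simp
    fix A assume "A \<in> sets (density P (\<lambda>x. ennreal ((cmod (f x))\<^sup>2)))"
    then have A: "A \<in> sets P" "A \<in> sets Q" using sets_eq[OF P Q] by auto
    then show "emeasure (density P (\<lambda>x. ennreal ((cmod (f x))\<^sup>2))) A = emeasure (density Q (\<lambda>x. ennreal ((cmod (g x))\<^sup>2))) A"
      using nn_integral_root_density[OF P Q _ _ L2_type_AE[OF \<psi> P Q f g], of "indicator A"]
      by (simp add: emeasure_density mult.commute)
  qed
  then show ?thesis unfolding square_def P_def[symmetric] Let_def f_def[symmetric] .
qed

lemma atom_eq:
  assumes \<psi>: "\<psi> \<in> L2_type \<T>" and Q: "Q \<in> \<T>" and g: "g \<in> \<psi> Q" and a: "{a} \<in> sets Q"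
  shows "atom a \<psi> = g a * complex_of_real (sqrt (measure Q {a}))"
proof -
  define P where "P = (SOME P. P \<in> \<T>)"
  define f where "f = (SOME f. f \<in> \<psi> P)"
  have P: "P \<in> \<T>" and f: "f \<in> \<psi> P" using some_representative[OF \<psi>] by (auto simp: P_def f_def)
  have "sqrt (measure P {a}) = root_density Q P a * sqrt (measure Q {a})"
    using a sets_eq[OF P Q] by (intro measure_singleton_root_density P Q) simp
  moreover have "g a = complex_of_real (root_density Q P a) * f a" if "measure Q {a} \<noteq> 0"
    by (rule measure_singleton_AE[OF L2_type_AE[OF \<psi> P Q f g] a that])
  ultimately have "f a * complex_of_real (sqrt (measure P {a})) = g a * complex_of_real (sqrt (measure Q {a}))"
    by (cases "measure Q {a} = 0") auto
  then show ?thesis unfolding atom_def P_def[symmetric] Let_def f_def[symmetric] .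
qed

lemma square_atom:
  assumes \<psi>: "\<psi> \<in> L2_type \<T>" and P: "P \<in> \<T>" and a: "{a} \<in> sets P"
  shows "emeasure (square \<psi>) {a} = ennreal ((cmod (atom a \<psi>))\<^sup>2)"
proof -
  obtain f where f: "f \<in> \<psi> P" using L2_type_member[OF \<psi> P] by blast
  have [measurable]: "f \<in> borel_measurable P" using L2_typeD(1)[OF \<psi> P f] .
  interpret prob_space P using prob[OF P] .
  have "emeasure (square \<psi>) {a} = (\<integral>\<^sup>+x. ennreal ((cmod (f x))\<^sup>2) * indicator {a} x \<partial>P)"
    unfolding square_eq[OF \<psi> P f] using a by (intro emeasure_density) auto
  also have "\<dots> = (\<integral>\<^sup>+x. ennreal ((cmod (f a))\<^sup>2) * indicator {a} x \<partial>P)"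
    by (intro nn_integral_cong) (auto simp: indicator_def)
  also have "\<dots> = ennreal ((cmod (f a))\<^sup>2) * emeasure P {a}" using a by (simp add: nn_integral_cmult)
  also have "\<dots> = ennreal ((cmod (atom a \<psi>))\<^sup>2)"
    unfolding atom_eq[OF \<psi> P f a]
    by (simp add: norm_mult power_mult_distrib emeasure_eq_measure ennreal_mult)
  finally show ?thesis .
qed

lemma sets_square: "\<psi> \<in> L2_type \<T> \<Longrightarrow> P \<in> \<T> \<Longrightarrow> sets (square \<psi>) = sets P"
  using L2_type_member[of \<psi> P] square_eq[of \<psi> P] by auto

lemma finite_measure_square:
  assumes \<psi>: "\<psi> \<in> L2_type \<T>" shows "finite_measure (square \<psi>)"
proof -
  obtain P where P: "P \<in> \<T>" using nonempty by blast
  then obtain f where f: "f \<in> \<psi> P" using L2_type_member[OF \<psi>] by blast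
  have m: "f \<in> borel_measurable P" "integrable P (\<lambda>x. (cmod (f x))\<^sup>2)" using L2_typeD[OF \<psi> P f] by auto
  then show ?thesis
    unfolding square_eq[OF \<psi> P f]
    by (intro finite_measureI) (auto simp: emeasure_density integrable_square_iff less_top)
qed

lemma AE_square:
  assumes \<psi>: "\<psi> \<in> L2_type \<T>" and P: "P \<in> \<T>" and AE: "AE x in P. \<phi> x"
  shows "AE x in square \<psi>. \<phi> x"
proof -
  obtain f where f: "f \<in> \<psi> P" using L2_type_member[OF \<psi> P] by blast
  have [measurable]: "f \<in> borel_measurable P" using L2_typeD(1)[OF \<psi> P f] .
  show ?thesis unfolding square_eq[OF \<psi> P f] using AE by (subst AE_density) auto
qed

lemma square_zero_imp:
  assumes \<psi>: "\<psi> \<in> L2_type \<T>" and P: "P \<in> \<T>" and f: "f \<in> \<psi> P"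
    and AE: "AE x in square \<psi>. \<phi> x"
  shows "AE x in P. f x = 0 \<or> \<phi> x"
proof -
  have [measurable]: "f \<in> borel_measurable P" using L2_typeD(1)[OF \<psi> P f] .
  show ?thesis using AE unfolding square_eq[OF \<psi> P f]
    by (subst (asm) AE_density) (auto elim!: eventually_mono)
qed

end

subsection \<open>The metric\<close>

lemma minkowski_square:
  fixes a b c :: "'a \<Rightarrow> real"
  assumes [measurable]: "a \<in> borel_measurable M" "b \<in> borel_measurable M" "c \<in> borel_measurable M"
    and ia: "integrable M (\<lambda>x. (a x)\<^sup>2)" and ib: "integrable M (\<lambda>x. (b x)\<^sup>2)"
    and le: "\<And>x. \<bar>c x\<bar> \<le> \<bar>a x\<bar> + \<bar>b x\<bar>"
  shows "sqrt (LINT x|M. (c x)\<^sup>2) \<le> sqrt (LINT x|M. (a x)\<^sup>2) + sqrt (LINT x|M. (b x)\<^sup>2)"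
proof (rule field_le_epsilon)
  fix e :: real assume e: "0 < e"
  let ?A = "LINT x|M. (a x)\<^sup>2" and ?B = "LINT x|M. (b x)\<^sup>2"
  have A0: "0 \<le> ?A" and B0: "0 \<le> ?B" by simp_all
  define \<alpha> where "\<alpha> = sqrt ?A + e / 2"
  define \<beta> where "\<beta> = sqrt ?B + e / 2"
  have pos: "0 < \<alpha>" "0 < \<beta>" using e A0 B0 by (auto simp: \<alpha>_def \<beta>_def intro: add_nonneg_pos)
  have sq: "?A \<le> \<alpha>\<^sup>2" "?B \<le> \<beta>\<^sup>2"
    using e A0 B0 by (auto simp: \<alpha>_def \<beta>_def real_le_lsqrt power2_sum intro!: sqrt_le_D)
  \<comment> \<open>a pointwise form of the inequality, with the weights that are optimal after integration\<close>
  have pt: "(c x)\<^sup>2 \<le> (1 + \<beta> / \<alpha>) * (a x)\<^sup>2 + (1 + \<alpha> / \<beta>) * (b x)\<^sup>2" for x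
  proof -
    have "(c x)\<^sup>2 \<le> (\<bar>a x\<bar> + \<bar>b x\<bar>)\<^sup>2" using le[of x] by (simp add: abs_le_square_iff[symmetric])
    also have "\<dots> = (a x)\<^sup>2 + (b x)\<^sup>2 + 2 * \<bar>a x\<bar> * \<bar>b x\<bar>" by (simp add: power2_sum)
    also have "2 * \<bar>a x\<bar> * \<bar>b x\<bar> \<le> \<beta> / \<alpha> * (a x)\<^sup>2 + \<alpha> / \<beta> * (b x)\<^sup>2"
    proof -
      have "0 \<le> (\<beta> * \<bar>a x\<bar> - \<alpha> * \<bar>b x\<bar>)\<^sup>2 / (\<alpha> * \<beta>)" using pos by simp
      also have "\<dots> = \<beta> / \<alpha> * (a x)\<^sup>2 + \<alpha> / \<beta> * (b x)\<^sup>2 - 2 * \<bar>a x\<bar> * \<bar>b x\<bar>"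
        using pos by (simp add: power2_diff power_mult_distrib field_simps power2_eq_square)
      finally show ?thesis by simp
    qed
    finally show ?thesis by (simp add: algebra_simps)
  qed
  have ir: "integrable M (\<lambda>x. (1 + \<beta> / \<alpha>) * (a x)\<^sup>2 + (1 + \<alpha> / \<beta>) * (b x)\<^sup>2)" using ia ib by simp
  have "(LINT x|M. (c x)\<^sup>2) \<le> (LINT x|M. (1 + \<beta> / \<alpha>) * (a x)\<^sup>2 + (1 + \<alpha> / \<beta>) * (b x)\<^sup>2)"
    using ir pt order_trans[OF zero_le_power2 pt] by (rule integral_mono_AE'[OF _ AE_I2 AE_I2])
  also have "\<dots> = (1 + \<beta> / \<alpha>) * ?A + (1 + \<alpha> / \<beta>) * ?B" using ia ib by simp
  also have "\<dots> \<le> (1 + \<beta> / \<alpha>) * \<alpha>\<^sup>2 + (1 + \<alpha> / \<beta>) * \<beta>\<^sup>2"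
    using sq pos by (intro add_mono mult_left_mono) auto
  also have "\<dots> = (\<alpha> + \<beta>)\<^sup>2" using pos by (simp add: field_simps power2_eq_square)
  finally have "sqrt (LINT x|M. (c x)\<^sup>2) \<le> \<alpha> + \<beta>" using pos by (intro real_le_lsqrt) auto
  then show "sqrt (LINT x|M. (c x)\<^sup>2) \<le> sqrt ?A + sqrt ?B + e" by (simp add: \<alpha>_def \<beta>_def)
qed

lemma integrable_square_diff:
  fixes f g :: "'a \<Rightarrow> complex"
  assumes [measurable]: "f \<in> borel_measurable M" "g \<in> borel_measurable M"
    and i: "integrable M (\<lambda>x. (cmod (f x))\<^sup>2)" "integrable M (\<lambda>x. (cmod (g x))\<^sup>2)"
  shows "integrable M (\<lambda>x. (cmod (f x - g x))\<^sup>2)"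
proof (rule Bochner_Integration.integrable_bound)
  show "integrable M (\<lambda>x. 2 * (cmod (f x))\<^sup>2 + 2 * (cmod (g x))\<^sup>2)" using i by simp
  show "AE x in M. norm ((cmod (f x - g x))\<^sup>2) \<le> norm (2 * (cmod (f x))\<^sup>2 + 2 * (cmod (g x))\<^sup>2)"
  proof (intro AE_I2)
    fix x
    have "(cmod (f x - g x))\<^sup>2 \<le> (cmod (f x) + cmod (g x))\<^sup>2"
      using norm_triangle_ineq4[of "f x" "g x"] by (intro power_mono) auto
    also have "\<dots> \<le> 2 * (cmod (f x))\<^sup>2 + 2 * (cmod (g x))\<^sup>2"
      using sum_squares_bound[of "cmod (f x)" "cmod (g x)"] by (simp add: power2_sum)
    finally show "norm ((cmod (f x - g x))\<^sup>2) \<le> norm (2 * (cmod (f x))\<^sup>2 + 2 * (cmod (g x))\<^sup>2)" by simp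
  qed
qed measurable

context measure_class
begin

lemma L2_scale_eq:
  assumes P: "P \<in> \<T>" and f [measurable]: "f \<in> borel_measurable P" and \<psi>: "\<psi> P = ae_class P f"
  shows "L2_scale \<T> c \<psi> P = ae_class P (\<lambda>x. c * f x)"
proof -
  have "ae_class P (\<lambda>x. c * g x) = ae_class P (\<lambda>x. c * f x)" if "g \<in> ae_class P f" for g
  proof (subst ae_class_eq_iff)
    have [measurable]: "g \<in> borel_measurable P" using that by (simp add: ae_class_def)
    show "(\<lambda>x. c * g x) \<in> borel_measurable P" "(\<lambda>x. c * f x) \<in> borel_measurable P" by measurable
    have "AE x in P. g x = f x" using that by (simp add: ae_class_def)
    then show "AE x in P. c * g x = c * f x" by eventually_elim simp
  qed
  then have "(\<Union>g\<in>ae_class P f. ae_class P (\<lambda>x. c * g x)) = ae_class P (\<lambda>x. c * f x)"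
    by (rule SUP_eq_const[rotated]) (use ae_class_self[OF f] in auto)
  then show ?thesis using P \<psi> by (simp add: L2_scale_def)
qed

lemma L2_diff_eq:
  assumes \<psi>: "\<psi> \<in> L2_type \<T>" and \<phi>: "\<phi> \<in> L2_type \<T>" and P: "P \<in> \<T>"
    and f: "f \<in> \<psi> P" and g: "g \<in> \<phi> P"
  shows "L2_diff \<T> \<psi> \<phi> P = ae_class P (\<lambda>x. f x - g x)"
proof -
  have [measurable]: "f \<in> borel_measurable P" "g \<in> borel_measurable P"
    using L2_typeD(1)[OF \<psi> P f] L2_typeD(1)[OF \<phi> P g] by auto
  have "ae_class P (\<lambda>x. f' x - g' x) = ae_class P (\<lambda>x. f x - g x)" if "f' \<in> \<psi> P" "g' \<in> \<phi> P" for f' g'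
  proof (subst ae_class_eq_iff)
    have [measurable]: "f' \<in> borel_measurable P" "g' \<in> borel_measurable P"
      using L2_typeD(1)[OF \<psi> P that(1)] L2_typeD(1)[OF \<phi> P that(2)] by auto
    show "(\<lambda>x. f' x - g' x) \<in> borel_measurable P" "(\<lambda>x. f x - g x) \<in> borel_measurable P" by measurable
    have "AE x in P. f' x = f x" "AE x in P. g' x = g x"
      using that L2_typeD(3)[OF \<psi> P f] L2_typeD(3)[OF \<phi> P g] by (auto simp: ae_class_def)
    then show "AE x in P. f' x - g' x = f x - g x" by eventually_elim simp
  qed
  then have "(\<Union>g'\<in>\<phi> P. ae_class P (\<lambda>x. f' x - g' x)) = ae_class P (\<lambda>x. f x - g x)" if "f' \<in> \<psi> P" for f'
    using that g by (intro SUP_eq_const) blast+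
  then have "(\<Union>f'\<in>\<psi> P. \<Union>g'\<in>\<phi> P. ae_class P (\<lambda>x. f' x - g' x)) = ae_class P (\<lambda>x. f x - g x)"
    by (rule SUP_eq_const[rotated]) (use f in auto)
  then show ?thesis using P by (simp add: L2_diff_def)
qed

text \<open>
  All integrals that \<open>L2_inner\<close> ranges over coincide, so its description has a unique value.
\<close>

lemma L2_norm_diff:
  assumes \<psi>: "\<psi> \<in> L2_type \<T>" and \<phi>: "\<phi> \<in> L2_type \<T>" and P: "P \<in> \<T>"
    and f: "f \<in> \<psi> P" and g: "g \<in> \<phi> P"
  shows "L2_norm \<T> (L2_diff \<T> \<psi> \<phi>) = sqrt (LINT x|P. (cmod (f x - g x))\<^sup>2)"
proof -
  let ?I = "LINT x|P. (cmod (f x - g x))\<^sup>2"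
  have fg: "f \<in> borel_measurable P" "g \<in> borel_measurable P"
    using L2_typeD(1)[OF \<psi> P f] L2_typeD(1)[OF \<phi> P g] by auto
  have integral_eq: "complex_of_real ?I = (LINT x|Q. h x * cnj (k x))"
    if Q: "Q \<in> \<T>" and h: "h \<in> L2_diff \<T> \<psi> \<phi> Q" and k: "k \<in> L2_diff \<T> \<psi> \<phi> Q" for Q h k
  proof -
    obtain f' g' where f': "f' \<in> \<psi> Q" and g': "g' \<in> \<phi> Q"
      using L2_type_member[OF \<psi> Q] L2_type_member[OF \<phi> Q] by blast
    have [measurable]: "f' \<in> borel_measurable Q" "g' \<in> borel_measurable Q"
      using L2_typeD(1)[OF \<psi> Q f'] L2_typeD(1)[OF \<phi> Q g'] by auto
    have [measurable]: "h \<in> borel_measurable Q" "k \<in> borel_measurable Q"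
      and AE: "AE x in Q. h x = f' x - g' x" "AE x in Q. k x = f' x - g' x"
      using h k unfolding L2_diff_eq[OF \<psi> \<phi> Q f' g'] ae_class_def by auto
    have "AE x in Q. f' x - g' x = complex_of_real (root_density Q P x) * (f x - g x)"
      using L2_type_AE[OF \<psi> P Q f f'] L2_type_AE[OF \<phi> P Q g g']
      by eventually_elim (simp add: right_diff_distrib)
    from nn_integral_root_density[OF P Q _ _ this, of "\<lambda>_. 1"]
    have nn: "(\<integral>\<^sup>+x. ennreal ((cmod (f' x - g' x))\<^sup>2) \<partial>Q) = (\<integral>\<^sup>+x. ennreal ((cmod (f x - g x))\<^sup>2) \<partial>P)"
      using fg by simp
    have "(LINT x|Q. h x * cnj (k x)) = (LINT x|Q. complex_of_real ((cmod (f' x - g' x))\<^sup>2))"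
    proof (rule integral_cong_AE)
      have [measurable]: "cnj \<in> borel_measurable borel" "complex_of_real \<in> borel_measurable borel"
        by (intro borel_measurable_continuous_onI continuous_intros)+
      show "(\<lambda>x. h x * cnj (k x)) \<in> borel_measurable Q"
        "(\<lambda>x. complex_of_real ((cmod (f' x - g' x))\<^sup>2)) \<in> borel_measurable Q" by measurable
      show "AE x in Q. h x * cnj (k x) = complex_of_real ((cmod (f' x - g' x))\<^sup>2)"
        using AE by eventually_elim (simp only: complex_norm_square)
    qed
    also have "\<dots> = complex_of_real (LINT x|Q. (cmod (f' x - g' x))\<^sup>2)" by (rule integral_complex_of_real)
    also have "(LINT x|Q. (cmod (f' x - g' x))\<^sup>2) = enn2real (\<integral>\<^sup>+x. ennreal ((cmod (f' x - g' x))\<^sup>2) \<partial>Q)"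
      by (intro integral_eq_nn_integral) auto
    also have "\<dots> = ?I"
      unfolding nn using fg by (intro integral_eq_nn_integral[symmetric]) auto
    finally show ?thesis by simp
  qed
  have mem: "(\<lambda>x. f x - g x) \<in> L2_diff \<T> \<psi> \<phi> P"
    unfolding L2_diff_eq[OF \<psi> \<phi> P f g] using fg by (intro ae_class_self) simp
  have "L2_inner \<T> (L2_diff \<T> \<psi> \<phi>) (L2_diff \<T> \<psi> \<phi>) = complex_of_real ?I"
    unfolding L2_inner_def
  proof (rule the_equality)
    show "\<forall>P\<in>\<T>. \<forall>f\<in>L2_diff \<T> \<psi> \<phi> P. \<forall>g\<in>L2_diff \<T> \<psi> \<phi> P.
        complex_of_real ?I = (LINT x|P. f x * cnj (g x))" using integral_eq by blast
    show "z = complex_of_real ?I" if "\<forall>P\<in>\<T>. \<forall>f\<in>L2_diff \<T> \<psi> \<phi> P. \<forall>g\<in>L2_diff \<T> \<psi> \<phi> P.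
        z = (LINT x|P. f x * cnj (g x))" for z
      using that P mem integral_eq[OF P mem mem] by auto
  qed
  then show ?thesis by (simp add: L2_norm_def)
qed

lemma L2_Metric_space:
  "Metric_space (L2_type \<T>) (\<lambda>\<psi> \<phi>. if \<psi> \<in> L2_type \<T> \<and> \<phi> \<in> L2_type \<T> then L2_norm \<T> (L2_diff \<T> \<psi> \<phi>) else 0)"
proof -
  obtain P where P: "P \<in> \<T>" using nonempty by blast
  show ?thesis
  proof
    fix \<psi> \<phi>
    have sym: "0 \<le> L2_norm \<T> (L2_diff \<T> x y) \<and> L2_norm \<T> (L2_diff \<T> x y) = L2_norm \<T> (L2_diff \<T> y x)"
      if h: "x \<in> L2_type \<T>" "y \<in> L2_type \<T>" for x y
    proof -
      obtain f g where fg: "f \<in> x P" "g \<in> y P" using L2_type_member[OF h(1) P] L2_type_member[OF h(2) P] by blast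
      show ?thesis using L2_norm_diff[OF h P fg] L2_norm_diff[OF h(2,1) P fg(2,1)]
        by (simp add: norm_minus_commute)
    qed
    show "0 \<le> (if \<psi> \<in> L2_type \<T> \<and> \<phi> \<in> L2_type \<T> then L2_norm \<T> (L2_diff \<T> \<psi> \<phi>) else 0)"
      by (simp add: conjunct1[OF sym])
    show "(if \<psi> \<in> L2_type \<T> \<and> \<phi> \<in> L2_type \<T> then L2_norm \<T> (L2_diff \<T> \<psi> \<phi>) else 0) =
       (if \<phi> \<in> L2_type \<T> \<and> \<psi> \<in> L2_type \<T> then L2_norm \<T> (L2_diff \<T> \<phi> \<psi>) else 0)"
      using conjunct2[OF sym, of \<psi> \<phi>] by (cases "\<psi> \<in> L2_type \<T> \<and> \<phi> \<in> L2_type \<T>") auto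
  next
    fix \<psi> \<phi> assume h: "\<psi> \<in> L2_type \<T>" "\<phi> \<in> L2_type \<T>"
    obtain f g where fg: "f \<in> \<psi> P" "g \<in> \<phi> P" using L2_type_member[OF h(1) P] L2_type_member[OF h(2) P] by blast
    have m: "f \<in> borel_measurable P" "g \<in> borel_measurable P"
      using L2_typeD(1)[OF h(1) P fg(1)] L2_typeD(1)[OF h(2) P fg(2)] by auto
    have i: "integrable P (\<lambda>x. (cmod (f x - g x))\<^sup>2)"
      using m L2_typeD(2)[OF h(1) P fg(1)] L2_typeD(2)[OF h(2) P fg(2)] by (rule integrable_square_diff)
    have "L2_norm \<T> (L2_diff \<T> \<psi> \<phi>) = 0 \<longleftrightarrow> (AE x in P. (cmod (f x - g x))\<^sup>2 = 0)"
      unfolding L2_norm_diff[OF h P fg] using integral_nonneg_eq_0_iff_AE[OF i] by simp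
    also have "\<dots> \<longleftrightarrow> (AE x in P. g x = f x)" by (rule AE_equiv) auto
    also have "\<dots> \<longleftrightarrow> \<psi> = \<phi>"
    proof
      assume "AE x in P. g x = f x"
      then have "g \<in> \<psi> P" using L2_typeD(3)[OF h(1) P fg(1)] m by (simp add: ae_class_def)
      then show "\<psi> = \<phi>" using L2_type_eqI[OF h P] fg by blast
    next
      assume "\<psi> = \<phi>"
      then show "AE x in P. g x = f x" using L2_typeD(3)[OF h(1) P fg(1)] fg by (simp add: ae_class_def)
    qed
    finally show "((if \<psi> \<in> L2_type \<T> \<and> \<phi> \<in> L2_type \<T> then L2_norm \<T> (L2_diff \<T> \<psi> \<phi>) else 0) = 0) = (\<psi> = \<phi>)"
      using h by simp
  next
    fix \<psi> \<phi> \<zeta> assume h: "\<psi> \<in> L2_type \<T>" "\<phi> \<in> L2_type \<T>" "\<zeta> \<in> L2_type \<T>"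
    obtain f g k where fgk: "f \<in> \<psi> P" "g \<in> \<phi> P" "k \<in> \<zeta> P"
      using L2_type_member[OF h(1) P] L2_type_member[OF h(2) P] L2_type_member[OF h(3) P] by blast
    note m = L2_typeD[OF h(1) P fgk(1)] L2_typeD[OF h(2) P fgk(2)] L2_typeD[OF h(3) P fgk(3)]
    note [measurable] = m(1,4,7)
    have "sqrt (LINT x|P. (cmod (f x - k x))\<^sup>2) \<le>
        sqrt (LINT x|P. (cmod (f x - g x))\<^sup>2) + sqrt (LINT x|P. (cmod (g x - k x))\<^sup>2)"
    proof (rule minkowski_square)
      show "integrable P (\<lambda>x. (cmod (f x - g x))\<^sup>2)" "integrable P (\<lambda>x. (cmod (g x - k x))\<^sup>2)"
        by (rule integrable_square_diff[OF m(1,4,2,5)], rule integrable_square_diff[OF m(4,7,5,8)])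
      show "\<bar>cmod (f x - k x)\<bar> \<le> \<bar>cmod (f x - g x)\<bar> + \<bar>cmod (g x - k x)\<bar>" for x
        using norm_triangle_ineq[of "f x - g x" "g x - k x"] by simp
    qed measurable
    then show "(if \<psi> \<in> L2_type \<T> \<and> \<zeta> \<in> L2_type \<T> then L2_norm \<T> (L2_diff \<T> \<psi> \<zeta>) else 0) \<le>
        (if \<psi> \<in> L2_type \<T> \<and> \<phi> \<in> L2_type \<T> then L2_norm \<T> (L2_diff \<T> \<psi> \<phi>) else 0) +
        (if \<phi> \<in> L2_type \<T> \<and> \<zeta> \<in> L2_type \<T> then L2_norm \<T> (L2_diff \<T> \<phi> \<zeta>) else 0)"
      using h L2_norm_diff[OF h(1,2) P fgk(1,2)] L2_norm_diff[OF h(2,3) P fgk(2,3)]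
        L2_norm_diff[OF h(1,3) P fgk(1,3)] by simp
  qed
qed

lemma space_L2_borel: "space (L2_borel \<T>) = L2_type \<T>"
  unfolding L2_borel_def by (rule space_metric_borel[OF L2_Metric_space])

text \<open>
  The atom alone contributes this much to the norm of the difference.
\<close>

lemma atom_Lipschitz:
  assumes \<psi>: "\<psi> \<in> L2_type \<T>" and \<phi>: "\<phi> \<in> L2_type \<T>" and P: "P \<in> \<T>" and a: "{a} \<in> sets P"
  shows "cmod (atom a \<psi> - atom a \<phi>) \<le> L2_norm \<T> (L2_diff \<T> \<psi> \<phi>)"
proof -
  obtain f g where f: "f \<in> \<psi> P" and g: "g \<in> \<phi> P"
    using L2_type_member[OF \<psi> P] L2_type_member[OF \<phi> P] by blast
  have i: "integrable P (\<lambda>x. (cmod (f x - g x))\<^sup>2)"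
    using L2_typeD(1,2)[OF \<psi> P f] L2_typeD(1,2)[OF \<phi> P g] by (intro integrable_square_diff)
  interpret prob_space P using prob[OF P] .
  have "(cmod (f a - g a))\<^sup>2 * measure P {a} = (LINT x|P. (cmod (f a - g a))\<^sup>2 * indicator {a} x)"
    using a by simp
  also have "\<dots> \<le> (LINT x|P. (cmod (f x - g x))\<^sup>2)"
    using a by (intro integral_mono_AE' AE_I2 i) (auto simp: indicator_def)
  finally have "sqrt ((cmod (f a - g a))\<^sup>2 * measure P {a}) \<le> L2_norm \<T> (L2_diff \<T> \<psi> \<phi>)"
    unfolding L2_norm_diff[OF \<psi> \<phi> P f g] by (rule real_sqrt_le_mono)
  moreover have "atom a \<psi> - atom a \<phi> = (f a - g a) * complex_of_real (sqrt (measure P {a}))"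
    unfolding atom_eq[OF \<psi> P f a] atom_eq[OF \<phi> P g a] by (simp add: left_diff_distrib)
  ultimately show ?thesis by (simp add: norm_mult real_sqrt_mult)
qed

lemma measurable_atom:
  assumes P: "P \<in> \<T>" and a: "{a} \<in> sets P"
  shows "atom a \<in> borel_measurable (L2_borel \<T>)"
proof (rule borel_measurableI)
  fix S :: "complex set" assume S: "open S"
  have "atom a -` S \<inter> L2_type \<T> \<in> {U. U \<subseteq> L2_type \<T> \<and>
      (\<forall>x\<in>U. \<exists>r>0. \<forall>y\<in>L2_type \<T>. L2_norm \<T> (L2_diff \<T> x y) < r \<longrightarrow> y \<in> U)}"
  proof (intro CollectI conjI ballI)
    fix \<psi> assume "\<psi> \<in> atom a -` S \<inter> L2_type \<T>"
    then have \<psi>: "atom a \<psi> \<in> S" "\<psi> \<in> L2_type \<T>" by auto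
    obtain r where r: "0 < r" "\<And>z. dist z (atom a \<psi>) < r \<Longrightarrow> z \<in> S"
      using S \<psi>(1) unfolding open_dist by blast
    have "\<phi> \<in> atom a -` S \<inter> L2_type \<T>" if \<phi>: "\<phi> \<in> L2_type \<T>" "L2_norm \<T> (L2_diff \<T> \<psi> \<phi>) < r" for \<phi>
    proof -
      have "dist (atom a \<phi>) (atom a \<psi>) < r"
        using atom_Lipschitz[OF \<psi>(2) \<phi>(1) P a] \<phi>(2) by (simp add: dist_norm norm_minus_commute)
      then show ?thesis using r(2) \<phi>(1) by simp
    qed
    then show "\<exists>r>0. \<forall>y\<in>L2_type \<T>. L2_norm \<T> (L2_diff \<T> \<psi> y) < r \<longrightarrow> y \<in> atom a -` S \<inter> L2_type \<T>"
      using r(1) by blast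
  qed simp
  then show "atom a -` S \<inter> space (L2_borel \<T>) \<in> sets (L2_borel \<T>)"
    unfolding space_L2_borel
    unfolding L2_borel_def sets_metric_borel[OF L2_Metric_space] by (rule sigma_sets.Basic)
qed

end

subsection \<open>Transport along an isomorphism\<close>

text \<open>
  Dilations of closed sets are the instance of interest: they identify the half-densities on the subsets of
  \<open>[0,1]\<close> with those on the subsets of \<open>[0,t]\<close>.
\<close>

locale measure_class_iso = A: measure_class \<T>\<^sub>1 + B: measure_class \<T>\<^sub>2
  for \<T>\<^sub>1 :: "'a measure set" and \<T>\<^sub>2 :: "'b measure set" +
  fixes N\<^sub>1 :: "'a measure" and N\<^sub>2 :: "'b measure" and T :: "'a \<Rightarrow> 'b" and S :: "'b \<Rightarrow> 'a"
  assumes sets_1: "P \<in> \<T>\<^sub>1 \<Longrightarrow> sets P = sets N\<^sub>1" and sets_2: "Q \<in> \<T>\<^sub>2 \<Longrightarrow> sets Q = sets N\<^sub>2"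
    and T: "T \<in> N\<^sub>1 \<rightarrow>\<^sub>M N\<^sub>2" and S: "S \<in> N\<^sub>2 \<rightarrow>\<^sub>M N\<^sub>1"
    and ST: "\<And>x. S (T x) = x" and TS: "\<And>y. T (S y) = y"
    and push: "P \<in> \<T>\<^sub>1 \<Longrightarrow> distr P N\<^sub>2 T \<in> \<T>\<^sub>2" and pull: "Q \<in> \<T>\<^sub>2 \<Longrightarrow> distr Q N\<^sub>1 S \<in> \<T>\<^sub>1"
begin

definition transport :: "'a half_density \<Rightarrow> 'b half_density" where
  "transport \<psi> = (\<lambda>Q\<in>\<T>\<^sub>2. {g \<in> borel_measurable Q.
     \<exists>P\<in>\<T>\<^sub>1. Q = distr P N\<^sub>2 T \<and> (\<exists>f\<in>\<psi> P. AE x in P. g (T x) = f x)})"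

lemma T_P: "P \<in> \<T>\<^sub>1 \<Longrightarrow> T \<in> P \<rightarrow>\<^sub>M N\<^sub>2"
  using T measurable_cong_sets[OF sets_1 refl] by blast

lemma S_Q: "Q \<in> \<T>\<^sub>2 \<Longrightarrow> S \<in> Q \<rightarrow>\<^sub>M N\<^sub>1"
  using S measurable_cong_sets[OF sets_2 refl] by blast

lemma push_pull: "Q \<in> \<T>\<^sub>2 \<Longrightarrow> distr (distr Q N\<^sub>1 S) N\<^sub>2 T = Q"
  by (subst distr_distr[OF T S_Q]) (auto simp: o_def TS sets_2 intro: distr_id2)

lemma pull_push: "P \<in> \<T>\<^sub>1 \<Longrightarrow> distr (distr P N\<^sub>2 T) N\<^sub>1 S = P"
  by (subst distr_distr[OF S T_P]) (auto simp: o_def ST sets_1 intro: distr_id2)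

lemma compose_S: "P \<in> \<T>\<^sub>1 \<Longrightarrow> f \<in> borel_measurable P \<Longrightarrow> (\<lambda>y. f (S y)) \<in> borel_measurable (distr P N\<^sub>2 T)"
  using S by (auto intro!: measurable_compose[of S N\<^sub>2 N\<^sub>1] simp: measurable_cong_sets[OF sets_1 refl])

lemma AE_push:
  assumes P: "P \<in> \<T>\<^sub>1"
  shows "(AE y in distr P N\<^sub>2 T. \<phi> y) \<longleftrightarrow> (AE x in P. \<phi> (T x))"
proof
  show "AE x in P. \<phi> (T x)" if "AE y in distr P N\<^sub>2 T. \<phi> y" using that by (rule AE_distrD[OF T_P[OF P]])
  assume *: "AE x in P. \<phi> (T x)"
  then have "AE x in distr (distr P N\<^sub>2 T) N\<^sub>1 S. \<phi> (T x)" by (simp only: pull_push[OF P])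
  then have "AE y in distr P N\<^sub>2 T. \<phi> (T (S y))" by (rule AE_distrD[OF S_Q[OF push[OF P]]])
  then show "AE y in distr P N\<^sub>2 T. \<phi> y" by (simp add: TS)
qed

lemma transport_eq:
  assumes \<psi>: "\<psi> \<in> L2_type \<T>\<^sub>1" and P: "P \<in> \<T>\<^sub>1" and f: "f \<in> \<psi> P"
  shows "transport \<psi> (distr P N\<^sub>2 T) = ae_class (distr P N\<^sub>2 T) (\<lambda>y. f (S y))"
proof -
  let ?Q = "distr P N\<^sub>2 T"
  have unique: "P' = P" if "P' \<in> \<T>\<^sub>1" "?Q = distr P' N\<^sub>2 T" for P'
    using pull_push[OF that(1)] pull_push[OF P] that(2) by simp
  have cls: "g \<in> \<psi> P \<longleftrightarrow> g \<in> borel_measurable P \<and> (AE x in P. g x = f x)" for g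
    using A.L2_typeD(3)[OF \<psi> P f] by (simp add: ae_class_def)
  have "(\<exists>f'\<in>\<psi> P. AE x in P. g (T x) = f' x) \<longleftrightarrow> (AE x in P. g (T x) = f x)" for g
  proof
    assume "\<exists>f'\<in>\<psi> P. AE x in P. g (T x) = f' x"
    then obtain f' where f': "AE x in P. g (T x) = f' x" "AE x in P. f' x = f x" using cls by blast
    then show "AE x in P. g (T x) = f x" by eventually_elim simp
  qed (use f in blast)
  then have "(\<exists>P'\<in>\<T>\<^sub>1. ?Q = distr P' N\<^sub>2 T \<and> (\<exists>f\<in>\<psi> P'. AE x in P'. g (T x) = f x)) \<longleftrightarrow>
      (AE y in ?Q. g y = f (S y))" for g
    unfolding AE_push[OF P] ST using P unique by blast
  then show ?thesis using push[OF P] by (simp add: transport_def ae_class_def)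
qed

text \<open>
  Densities are carried along by isomorphisms.
\<close>

lemma root_density_push:
  assumes P: "P \<in> \<T>\<^sub>1" and P': "P' \<in> \<T>\<^sub>1"
  shows "AE y in distr P' N\<^sub>2 T. B.root_density (distr P' N\<^sub>2 T) (distr P N\<^sub>2 T) y = A.root_density P' P (S y)"
proof -
  have m: "(\<lambda>y. RN_deriv P' P (S y)) \<in> borel_measurable (distr P' N\<^sub>2 T)"
    by (rule compose_S[OF P']) simp
  have "density (distr P' N\<^sub>2 T) (\<lambda>y. RN_deriv P' P (S y)) = distr (density P' (\<lambda>x. RN_deriv P' P (S (T x)))) N\<^sub>2 T"
    using m by (intro density_distr T_P P') simp
  also have "\<dots> = distr P N\<^sub>2 T" by (simp add: ST A.density_RN[OF P P'])
  finally show ?thesis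
    using B.root_density_unique[OF push[OF P] push[OF P'] m] by (simp add: A.root_density_def)
qed

lemma transport_L2_type:
  assumes \<psi>: "\<psi> \<in> L2_type \<T>\<^sub>1"
  shows "transport \<psi> \<in> L2_type \<T>\<^sub>2"
proof -
  obtain P where P: "P \<in> \<T>\<^sub>1" using A.nonempty by blast
  obtain f where f: "f \<in> \<psi> P" using A.L2_type_member[OF \<psi> P] by blast
  note f' = A.L2_typeD[OF \<psi> P f]
  let ?Q = "distr P N\<^sub>2 T"
  have m: "(\<lambda>y. f (S y)) \<in> borel_measurable ?Q" using compose_S[OF P f'(1)] .
  then have i: "integrable ?Q (\<lambda>y. (cmod (f (S y)))\<^sup>2)"
    using f'(2) T_P[OF P] by (subst integrable_distr_eq) (auto simp: ST)
  have "transport \<psi> = B.half_density_of ?Q (\<lambda>y. f (S y))"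
  proof (rule extensionalityI[of _ \<T>\<^sub>2])
    fix Q assume Q: "Q \<in> \<T>\<^sub>2"
    define R where "R = distr Q N\<^sub>1 S"
    have R: "R \<in> \<T>\<^sub>1" "Q = distr R N\<^sub>2 T" using pull[OF Q] push_pull[OF Q] by (auto simp: R_def)
    let ?g = "\<lambda>x. complex_of_real (A.root_density R P x) * f x"
    have gm: "?g \<in> borel_measurable R" by (rule A.borel_measurable_change[OF P R(1) f'(1)])
    then have g: "?g \<in> \<psi> R" unfolding A.L2_type_change[OF \<psi> P R(1) f] by (rule ae_class_self)
    have "transport \<psi> Q = ae_class Q (\<lambda>y. ?g (S y))" unfolding R(2) by (rule transport_eq[OF \<psi> R(1) g])
    also have "\<dots> = ae_class Q (\<lambda>y. complex_of_real (B.root_density Q ?Q y) * f (S y))"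
    proof (subst ae_class_eq_iff)
      show "(\<lambda>y. ?g (S y)) \<in> borel_measurable Q" unfolding R(2) by (rule compose_S[OF R(1) gm])
      show "(\<lambda>y. complex_of_real (B.root_density Q ?Q y) * f (S y)) \<in> borel_measurable Q"
        by (rule B.borel_measurable_change[OF push[OF P] Q m])
      show "AE y in Q. ?g (S y) = complex_of_real (B.root_density Q ?Q y) * f (S y)"
        using root_density_push[OF P R(1)] unfolding R(2)[symmetric] by eventually_elim simp
    qed
    finally show "transport \<psi> Q = B.half_density_of ?Q (\<lambda>y. f (S y)) Q"
      using Q by (simp add: B.half_density_of_def)
  qed (auto simp: transport_def B.half_density_of_def)
  then show ?thesis using B.half_density_of(1)[OF push[OF P] m i] by simp
qed

lemma transport_surj:
  assumes \<phi>: "\<phi> \<in> L2_type \<T>\<^sub>2"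
  shows "\<exists>\<psi>\<in>L2_type \<T>\<^sub>1. transport \<psi> = \<phi>"
proof -
  obtain Q where Q: "Q \<in> \<T>\<^sub>2" using B.nonempty by blast
  obtain g where g: "g \<in> \<phi> Q" using B.L2_type_member[OF \<phi> Q] by blast
  note g' = B.L2_typeD[OF \<phi> Q g]
  define P where "P = distr Q N\<^sub>1 S"
  have P: "P \<in> \<T>\<^sub>1" "Q = distr P N\<^sub>2 T" using pull[OF Q] push_pull[OF Q] by (auto simp: P_def)
  let ?f = "\<lambda>x. g (T x)"
  have "g \<in> borel_measurable N\<^sub>2" using g'(1) measurable_cong_sets[OF sets_2[OF Q] refl] by blast
  then have m: "?f \<in> borel_measurable P" using T_P[OF P(1)] by (rule measurable_compose[rotated])
  have i: "integrable P (\<lambda>x. (cmod (?f x))\<^sup>2)"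
    using g' T_P[OF P(1)] unfolding P(2) by (subst (asm) integrable_distr_eq) auto
  define \<psi> where "\<psi> = A.half_density_of P ?f"
  have \<psi>: "\<psi> \<in> L2_type \<T>\<^sub>1" "?f \<in> \<psi> P" unfolding \<psi>_def using A.half_density_of[OF P(1) m i] by auto
  have "g \<in> transport \<psi> Q"
    unfolding P(2) transport_eq[OF \<psi>(1) P(1) \<psi>(2)] TS
    by (rule ae_class_self) (use g'(1) P(2) in simp)
  then show ?thesis using B.L2_type_eqI[OF transport_L2_type[OF \<psi>(1)] \<phi> Q _ g] \<psi>(1) by blast
qed

lemma atom_transport:
  assumes \<psi>: "\<psi> \<in> L2_type \<T>\<^sub>1" and P: "P \<in> \<T>\<^sub>1" and a: "{a} \<in> sets N\<^sub>1" "{T a} \<in> sets N\<^sub>2"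
  shows "B.atom (T a) (transport \<psi>) = A.atom a \<psi>"
proof -
  obtain f where f: "f \<in> \<psi> P" using A.L2_type_member[OF \<psi> P] by blast
  let ?Q = "distr P N\<^sub>2 T"
  have g: "(\<lambda>y. f (S y)) \<in> transport \<psi> ?Q"
    unfolding transport_eq[OF \<psi> P f]
    by (rule ae_class_self[OF compose_S[OF P A.L2_typeD(1)[OF \<psi> P f]]])
  have "T -` {T a} \<inter> space P = {a}"
  proof -
    have "a \<in> space P" using a(1) sets_1[OF P] sets.sets_into_space[of "{a}" P] by simp
    moreover have "T x = T a \<Longrightarrow> x = a" for x using ST by metis
    ultimately show ?thesis by auto
  qed
  then have "measure ?Q {T a} = measure P {a}" using T_P[OF P] a by (simp add: measure_distr)
  then show ?thesis
    using B.atom_eq[OF transport_L2_type[OF \<psi>] push[OF P] g] A.atom_eq[OF \<psi> P f] a sets_1[OF P]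
    by (simp add: ST)
qed

end

section \<open>Stationary factorizing measures on closed sets\<close>

text \<open>
  The cells are half-open and do not contain \<open>0\<close>: on sets that avoid \<open>0\<close> the number of met cells is additive under
  \<open>join\<close>, with no special role for the endpoints of the cells.
\<close>

definition cells :: "nat \<Rightarrow> real \<Rightarrow> real set \<Rightarrow> ennreal" where
  "cells n h C = (\<Sum>k<n. if C \<inter> {real k * h<..real (Suc k) * h} \<noteq> {} then 1 else 0)"

lemma measurable_cells:
  assumes t: "0 < t" shows "cells n h \<in> borel_measurable (closed_sets_space t)"
proof -
  have "(\<lambda>C. if C \<inter> {p<..q} \<noteq> {} then 1 else 0 :: ennreal) \<in> borel_measurable (closed_sets_space t)" for p q
  proof (rule measurable_If)
    show "{C \<in> space (closed_sets_space t). C \<inter> {p<..q} \<noteq> {}} \<in> sets (closed_sets_space t)"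
      using sets_hit_Ioc[OF t] t by simp
  qed simp_all
  then show ?thesis unfolding cells_def by (intro borel_measurable_sum)
qed

lemma cells_join:
  assumes C: "C \<in> closed_subsets (real n * h)" and D: "D \<in> closed_subsets h" and h: "0 < h" and 0: "0 \<notin> D"
  shows "cells (Suc n) h (join (real n * h) C D) = cells n h C + (if D = {} then 0 else 1)"
proof -
  have C': "x \<le> real n * h" if "x \<in> C" for x using C that by (auto simp: closed_subsets_def)
  have D': "0 < x" "x \<le> h" if "x \<in> D" for x
  proof -
    have "0 \<le> x" "x \<le> h" using D that by (auto simp: closed_subsets_def)
    then show "0 < x" "x \<le> h" using 0 that by (auto simp: less_le)
  qed
  have old: "join (real n * h) C D \<inter> {real k * h<..real (Suc k) * h} = C \<inter> {real k * h<..real (Suc k) * h}"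
    if k: "k < n" for k
  proof -
    have le: "real (Suc k) * h \<le> real n * h" using k h by (intro mult_right_mono) auto
    have "x + real n * h \<notin> {real k * h<..real (Suc k) * h}" if "x \<in> D" for x
      using D'(1)[OF that] le unfolding greaterThanAtMost_iff by linarith
    then show ?thesis by (auto simp: join_def)
  qed
  have new: "join (real n * h) C D \<inter> {real n * h<..real (Suc n) * h} \<noteq> {} \<longleftrightarrow> D \<noteq> {}"
  proof
    assume "join (real n * h) C D \<inter> {real n * h<..real (Suc n) * h} \<noteq> {}"
    then show "D \<noteq> {}" using C' by (force simp: join_def)
  next
    assume "D \<noteq> {}"
    then obtain x where x: "x \<in> D" by auto
    then have "x + real n * h \<in> join (real n * h) C D \<inter> {real n * h<..real (Suc n) * h}"
      using D'[OF x] by (auto simp: join_def algebra_simps)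
    then show "join (real n * h) C D \<inter> {real n * h<..real (Suc n) * h} \<noteq> {}" by blast
  qed
  have "(\<Sum>k<n. if join (real n * h) C D \<inter> {real k * h<..real (Suc k) * h} \<noteq> {} then 1 else 0 :: ennreal) =
      cells n h C" unfolding cells_def by (rule sum.cong) (simp_all only: old lessThan_iff)
  moreover have "cells (Suc n) h (join (real n * h) C D) =
      (if join (real n * h) C D \<inter> {real n * h<..real (Suc n) * h} \<noteq> {} then 1 else 0) +
      (\<Sum>k<n. if join (real n * h) C D \<inter> {real k * h<..real (Suc k) * h} \<noteq> {} then 1 else 0)"
    unfolding cells_def lessThan_Suc by (rule sum.insert) simp_all
  ultimately show ?thesis unfolding new by (simp add: add.commute)
qed

text \<open>
  Any \<open>K\<close> points of the set lie in different cells as soon as the cells are shorter than their distances.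
\<close>

lemma cells_infinite:
  assumes C: "C \<subseteq> {0..t}" "infinite C" and t: "0 < t"
  shows "\<exists>N. \<forall>n\<ge>N. of_nat K \<le> cells (Suc n) (t / real (Suc n)) C"
proof -
  have "infinite (C - {0})" using C by simp
  then obtain F where F: "finite F" "card F = K" "F \<subseteq> C - {0}"
    using infinite_arbitrarily_large by blast
  have "\<exists>\<gamma>>0. \<forall>x\<in>F. \<forall>y\<in>F. x \<noteq> y \<longrightarrow> \<gamma> \<le> dist x y"
  proof -
    have "\<forall>x\<in>F. \<exists>d>0. \<forall>y\<in>F. y \<noteq> x \<longrightarrow> d \<le> dist x y" using finite_set_avoid[OF F(1)] by auto
    then obtain d where d: "\<And>x. x \<in> F \<Longrightarrow> 0 < d x" "\<And>x y. x \<in> F \<Longrightarrow> y \<in> F \<Longrightarrow> y \<noteq> x \<Longrightarrow> d x \<le> dist x y"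
      by metis
    show ?thesis
    proof (intro exI[of _ "Min (insert 1 (d ` F))"] conjI ballI impI)
      show "0 < Min (insert 1 (d ` F))" using F(1) d(1) by simp
      fix x y assume xy: "x \<in> F" "y \<in> F" "x \<noteq> y"
      have "Min (insert 1 (d ` F)) \<le> d x" using F(1) xy by (intro Min_le) auto
      also have "\<dots> \<le> dist x y" using d(2) xy by blast
      finally show "Min (insert 1 (d ` F)) \<le> dist x y" .
    qed
  qed
  then obtain \<gamma> where \<gamma>: "\<gamma> > 0" "\<And>x y. x \<in> F \<Longrightarrow> y \<in> F \<Longrightarrow> x \<noteq> y \<Longrightarrow> \<gamma> \<le> dist x y" by blast
  obtain N :: nat where N: "t / \<gamma> < real N" using reals_Archimedean2 by blast
  have "of_nat K \<le> cells (Suc n) (t / real (Suc n)) C" if n: "n \<ge> N" for n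
  proof -
    define h where "h = t / real (Suc n)"
    have h: "0 < h" "real (Suc n) * h = t" using t by (auto simp: h_def)
    have "t / \<gamma> < real (Suc n)" using N n by simp
    then have h\<gamma>: "h < \<gamma>" using \<gamma> by (simp add: h_def field_simps del: of_nat_Suc)
    define k where "k x = nat (\<lceil>x / h\<rceil> - 1)" for x
    have k: "real (k x) * h < x" "x \<le> real (Suc (k x)) * h" "k x < Suc n" if x: "x \<in> F" for x
    proof -
      have "0 \<le> x" "x \<le> t" "x \<noteq> 0" using F(3) C(1) x by auto
      then have "0 < x / h" using h by simp
      then have "real (k x) = of_int \<lceil>x / h\<rceil> - 1" unfolding k_def by (simp add: of_nat_nat)
      then have "real (k x) < x / h" "x / h \<le> real (k x) + 1" using ceiling_correct[of "x / h"] by linarith+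
      then show 1: "real (k x) * h < x" "x \<le> real (Suc (k x)) * h" using h by (auto simp: field_simps)
      have "real (k x) * h < real (Suc n) * h" using 1(1) \<open>x \<le> t\<close> h(2) by linarith
      then show "k x < Suc n" using h(1) by simp
    qed
    have "inj_on k F"
    proof (rule inj_onI, rule ccontr)
      fix x y assume xy: "x \<in> F" "y \<in> F" "k x = k y" "x \<noteq> y"
      have "real (Suc (k y)) * h = real (k y) * h + h" by (simp add: algebra_simps)
      then have "dist x y < h" using k(1,2)[OF xy(1)] k(1,2)[OF xy(2)] xy(3) by (simp add: dist_real_def)
      then show False using \<gamma>(2)[OF xy(1,2,4)] h\<gamma> by simp
    qed
    then have "of_nat K = (\<Sum>j\<in>k ` F. 1 :: ennreal)" using F(2) by (simp add: card_image)
    also have "\<dots> \<le> (\<Sum>j\<in>k ` F. if C \<inter> {real j * h<..real (Suc j) * h} \<noteq> {} then 1 else 0)"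
    proof (rule sum_mono)
      fix j assume "j \<in> k ` F"
      then obtain x where x: "x \<in> F" "j = k x" by blast
      then have "x \<in> C \<inter> {real j * h<..real (Suc j) * h}" using k[OF x(1)] F(3) by auto
      then show "1 \<le> (if C \<inter> {real j * h<..real (Suc j) * h} \<noteq> {} then 1 else 0 :: ennreal)"
        by (subst if_P) auto
    qed
    also have "\<dots> \<le> cells (Suc n) h C"
      unfolding cells_def using k(3) by (intro sum_mono2) auto
    finally show ?thesis by (simp add: h_def)
  qed
  then show ?thesis by blast
qed

lemma multiplicative_power:
  fixes f :: "real \<Rightarrow> 'a::comm_monoid_mult"
  assumes mult: "\<And>s t. 0 < s \<Longrightarrow> 0 < t \<Longrightarrow> f (s + t) = f s * f t" and x: "0 < x"
  shows "f (real (Suc n) * x) = f x ^ Suc n"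
proof (induction n)
  case (Suc n)
  have "real (Suc (Suc n)) * x = real (Suc n) * x + x" by (simp add: algebra_simps)
  then have "f (real (Suc (Suc n)) * x) = f (real (Suc n) * x) * f x"
    using mult[of "real (Suc n) * x" x] x by simp
  then show ?case using Suc by (simp add: mult.commute)
qed simp

lemma multiplicative_nonzero:
  fixes f :: "real \<Rightarrow> 'a::idom"
  assumes mult: "\<And>s t. 0 < s \<Longrightarrow> 0 < t \<Longrightarrow> f (s + t) = f s * f t"
    and t\<^sub>0: "0 < t\<^sub>0" "f t\<^sub>0 \<noteq> 0" and t: "0 < t"
  shows "f t \<noteq> 0"
proof -
  obtain k :: nat where k: "t / t\<^sub>0 < real k" using reals_Archimedean2 by blast
  then have lt: "t < real (Suc k) * t\<^sub>0" using t\<^sub>0 by (simp add: field_simps)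
  have "f (real (Suc k) * t\<^sub>0) \<noteq> 0" using multiplicative_power[of f, OF mult t\<^sub>0(1)] t\<^sub>0(2) by simp
  moreover have "f (real (Suc k) * t\<^sub>0) = f t * f (real (Suc k) * t\<^sub>0 - t)"
    using mult[of t "real (Suc k) * t\<^sub>0 - t"] t lt by simp
  ultimately show ?thesis by auto
qed

locale factorizing_measures =
  fixes \<mu> :: "real \<Rightarrow> real set measure"
  assumes sets_\<mu>: "0 < t \<Longrightarrow> sets (\<mu> t) = sets (closed_sets_space t)"
    and finite_\<mu>: "0 < t \<Longrightarrow> finite_measure (\<mu> t)"
    and factor: "0 < s \<Longrightarrow> 0 < t \<Longrightarrow>
      \<mu> (s + t) = distr (\<mu> s \<Otimes>\<^sub>M \<mu> t) (closed_sets_space (s + t)) (\<lambda>(C, D). join s C D)"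
    and AE_zero: "0 < t \<Longrightarrow> AE C in \<mu> t. 0 \<notin> C"
    and nonzero: "\<exists>t>0. emeasure (\<mu> t) (closed_subsets t) \<noteq> 0"
begin

lemma space_\<mu>: "0 < t \<Longrightarrow> space (\<mu> t) = closed_subsets t"
  using sets_eq_imp_space_eq[OF sets_\<mu>] by simp

lemma measurable_join_\<mu>:
  "0 < s \<Longrightarrow> 0 < t \<Longrightarrow> (\<lambda>(C, D). join s C D) \<in> \<mu> s \<Otimes>\<^sub>M \<mu> t \<rightarrow>\<^sub>M closed_sets_space (s + t)"
  using measurable_join[of s t] sets_\<mu>
  by (simp cong: measurable_cong_sets sets_pair_measure_cong)

lemma nn_integral_factor:
  assumes s: "0 < s" and t: "0 < t" and f: "f \<in> borel_measurable (closed_sets_space (s + t))"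
  shows "(\<integral>\<^sup>+C. f C \<partial>\<mu> (s + t)) = (\<integral>\<^sup>+C. (\<integral>\<^sup>+D. f (join s C D) \<partial>\<mu> t) \<partial>\<mu> s)"
proof -
  interpret finite_measure "\<mu> t" using finite_\<mu>[OF t] .
  have j: "(\<lambda>z. f (case z of (C, D) \<Rightarrow> join s C D)) \<in> borel_measurable (\<mu> s \<Otimes>\<^sub>M \<mu> t)"
    by (rule measurable_compose[OF measurable_join_\<mu>[OF s t] f])
  have "(\<integral>\<^sup>+C. f C \<partial>\<mu> (s + t)) = (\<integral>\<^sup>+z. f (case z of (C, D) \<Rightarrow> join s C D) \<partial>(\<mu> s \<Otimes>\<^sub>M \<mu> t))"
    unfolding factor[OF s t] using f by (intro nn_integral_distr measurable_join_\<mu> s t) simp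
  also have "\<dots> = (\<integral>\<^sup>+C. (\<integral>\<^sup>+D. f (join s C D) \<partial>\<mu> t) \<partial>\<mu> s)"
    using nn_integral_fst[OF j] by simp
  finally show ?thesis .
qed

definition total :: "real \<Rightarrow> real" where "total t = measure (\<mu> t) (closed_subsets t)"

definition void :: "real \<Rightarrow> real" where "void t = measure (\<mu> t) {{}}"

lemma emeasure_total: "0 < t \<Longrightarrow> emeasure (\<mu> t) (closed_subsets t) = ennreal (total t)"
  using finite_measure.emeasure_eq_measure[OF finite_\<mu>] by (simp add: total_def)

lemma emeasure_void: "0 < t \<Longrightarrow> emeasure (\<mu> t) {{}} = ennreal (void t)"
  using finite_measure.emeasure_eq_measure[OF finite_\<mu>] by (simp add: void_def)

lemma nonneg: "0 \<le> total t" "0 \<le> void t"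
  by (auto simp: total_def void_def)

lemma sets_void: "0 < t \<Longrightarrow> {{}} \<in> sets (\<mu> t)"
  using sets_singleton_empty sets_\<mu> by simp

lemma sets_total: "0 < t \<Longrightarrow> closed_subsets t \<in> sets (\<mu> t)"
  using sets.top[of "\<mu> t"] space_\<mu>[of t] by simp

lemma join_empty_iff: "join s C D = {} \<longleftrightarrow> C = {} \<and> D = {}"
  by (auto simp: join_def)

lemma total_mult:
  assumes s: "0 < s" and t: "0 < t"
  shows "total (s + t) = total s * total t"
proof -
  have "ennreal (total (s + t)) = (\<integral>\<^sup>+C. 1 \<partial>\<mu> (s + t))"
    using s t by (simp add: emeasure_total[symmetric] space_\<mu>)
  also have "\<dots> = ennreal (total s * total t)"
    using s t nonneg by (subst nn_integral_factor) (simp_all add: space_\<mu> emeasure_total ennreal_mult mult.commute)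
  finally show ?thesis using nonneg by (simp add: ennreal_inj)
qed

lemma void_mult:
  assumes s: "0 < s" and t: "0 < t"
  shows "void (s + t) = void s * void t"
proof -
  have st: "0 < s + t" using s t by simp
  have "ennreal (void (s + t)) = (\<integral>\<^sup>+C. indicator {{}} C \<partial>\<mu> (s + t))"
    using sets_void[OF st] by (simp add: emeasure_void[OF st])
  also have "\<dots> = (\<integral>\<^sup>+C. (\<integral>\<^sup>+D. indicator {{}} C * indicator {{}} D \<partial>\<mu> t) \<partial>\<mu> s)"
    using st by (subst nn_integral_factor[OF s t]) (auto simp: indicator_def join_empty_iff intro!: nn_integral_cong)
  also have "\<dots> = ennreal (void s * void t)"
    using sets_void[OF s] sets_void[OF t] nonneg
    by (simp add: nn_integral_cmult nn_integral_multc emeasure_void s t ennreal_mult)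
  finally show ?thesis using nonneg by (simp add: ennreal_inj)
qed

lemma total_pos: "0 < t \<Longrightarrow> 0 < total t"
proof -
  assume t: "0 < t"
  obtain t\<^sub>0 where t\<^sub>0: "0 < t\<^sub>0" "emeasure (\<mu> t\<^sub>0) (closed_subsets t\<^sub>0) \<noteq> 0" using nonzero by blast
  have "total t\<^sub>0 \<noteq> 0" using t\<^sub>0(2) unfolding emeasure_total[OF t\<^sub>0(1)] by auto
  with t\<^sub>0(1) have "total t \<noteq> 0" using multiplicative_nonzero[of total, OF total_mult] t by blast
  then show ?thesis using nonneg(1)[of t] by simp
qed

text \<open>
  As \<open>0\<close> is almost surely outside the closed set, some neighbourhood of \<open>0\<close> is missed with positive
  measure; by factorization, the empty set has positive measure.
\<close>

lemma void_pos:
  assumes t: "0 < t" shows "0 < void t"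
proof -
  let ?A = "\<lambda>n::nat. {C\<in>closed_subsets 1. C \<inter> {0..1 / real (Suc (Suc n))} = {}}"
  have A: "?A n \<in> sets (\<mu> 1)" for n using miss_open[of 1 0] by (simp add: sets_\<mu>)
  have "AE C in \<mu> 1. \<exists>n. C \<in> ?A n"
    using AE_zero[OF zero_less_one] AE_space
  proof eventually_elim
    fix C :: "real set" assume 0: "0 \<notin> C" and "C \<in> space (\<mu> 1)"
    then have C: "C \<in> closed_subsets 1" by (simp add: space_\<mu>)
    then have "open (- C)" "0 \<in> - C" using 0 by (auto simp: closed_subsets_def)
    then obtain d where d: "d > 0" "\<forall>x. dist x 0 < d \<longrightarrow> x \<in> - C" unfolding open_dist by blast
    obtain n where n: "inverse (real (Suc n)) < d" using reals_Archimedean[OF d(1)] by blast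
    have "1 / real (Suc (Suc n)) \<le> inverse (real (Suc n))" by (simp add: inverse_eq_divide frac_le)
    then have "C \<in> ?A n" using C n d(2) by (fastforce simp: dist_real_def)
    then show "\<exists>n. C \<in> ?A n" ..
  qed
  then have "\<exists>n. \<not> (AE C in \<mu> 1. C \<notin> ?A n)"
  proof (rule contrapos_pp)
    assume "\<not> (\<exists>n. \<not> (AE C in \<mu> 1. C \<notin> ?A n))"
    then have none: "AE C in \<mu> 1. \<forall>n. C \<notin> ?A n" by (intro iffD2[OF AE_all_countable] allI) blast
    show "\<not> (AE C in \<mu> 1. \<exists>n. C \<in> ?A n)"
    proof
      assume "AE C in \<mu> 1. \<exists>n. C \<in> ?A n"
      then have "AE C in \<mu> 1. False" using none by eventually_elim blast
      then have "emeasure (\<mu> 1) (space (\<mu> 1)) = 0" using AE_iff_null_sets[of "space (\<mu> 1)" "\<mu> 1"]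
        by (auto simp: null_sets_def elim!: eventually_mono)
      then show False using total_pos[of 1] by (simp add: space_\<mu> emeasure_total)
    qed
  qed
  then obtain n where "\<not> (AE C in \<mu> 1. C \<notin> ?A n)" by blast
  then have "?A n \<notin> null_sets (\<mu> 1)" unfolding AE_iff_null_sets[OF A[of n]] .
  then have pos: "emeasure (\<mu> 1) (?A n) \<noteq> 0" using A[of n] unfolding null_sets_def by blast
  define s where "s = 1 / real (Suc (Suc n))"
  have s: "0 < s" "0 < 1 - s" by (auto simp: s_def field_simps)
  have sets_A: "?A n \<in> sets (closed_sets_space (s + (1 - s)))" using A[of n] by (simp add: sets_\<mu>)
  have "emeasure (\<mu> 1) (?A n) = (\<integral>\<^sup>+C. indicator (?A n) C \<partial>\<mu> (s + (1 - s)))"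
    using A[of n] by simp
  also have "\<dots> = (\<integral>\<^sup>+C. (\<integral>\<^sup>+D. indicator (?A n) (join s C D) \<partial>\<mu> (1 - s)) \<partial>\<mu> s)"
    using sets_A by (intro nn_integral_factor s borel_measurable_indicator)
  also have "\<dots> \<le> (\<integral>\<^sup>+C. (\<integral>\<^sup>+D. indicator {{}} C \<partial>\<mu> (1 - s)) \<partial>\<mu> s)"
  proof (intro nn_integral_mono)
    fix C D assume "C \<in> space (\<mu> s)" "D \<in> space (\<mu> (1 - s))"
    then have "C \<subseteq> {0..s}" using s by (auto simp: space_\<mu> closed_subsets_def)
    then have "C = {}" if "join s C D \<in> ?A n" using that by (auto simp: join_def s_def)
    then show "indicator (?A n) (join s C D) \<le> (indicator {{}} C :: ennreal)"
      by (auto simp: indicator_def)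
  qed
  also have "\<dots> = ennreal (void s * total (1 - s))"
    using s sets_void[OF s(1)] nonneg
    by (simp add: space_\<mu> emeasure_total emeasure_void nn_integral_multc ennreal_mult)
  finally have "void s \<noteq> 0" using pos by (auto simp: le_zero_eq)
  then have "void t \<noteq> 0" using multiplicative_nonzero[of void, OF void_mult] s(1) t by blast
  then show ?thesis using nonneg(2)[of t] by simp
qed

lemma void_le_total: "0 < t \<Longrightarrow> void t \<le> total t"
  unfolding void_def total_def using sets_total
  by (intro finite_measure.finite_measure_mono[OF finite_\<mu>]) auto

lemma emeasure_nonempty:
  assumes t: "0 < t"
  shows "(\<integral>\<^sup>+C. (if C = {} then 0 else 1) \<partial>\<mu> t) = ennreal (total t - void t)"
proof -
  interpret finite_measure "\<mu> t" using finite_\<mu>[OF t] .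
  have "(\<integral>\<^sup>+C. (if C = {} then 0 else 1) \<partial>\<mu> t) = (\<integral>\<^sup>+C. indicator (closed_subsets t - {{}}) C \<partial>\<mu> t)"
    by (intro nn_integral_cong) (auto simp: indicator_def space_\<mu> t)
  also have "\<dots> = emeasure (\<mu> t) (closed_subsets t - {{}})"
    using sets_total[OF t] sets_void[OF t] by (intro nn_integral_indicator sets.Diff)
  also have "\<dots> = ennreal (total t - void t)"
    unfolding total_def void_def emeasure_eq_measure using sets_total[OF t] sets_void[OF t]
    by (subst finite_measure_Diff) auto
  finally show ?thesis .
qed

text \<open>
  Add one cell at a time: by factorization, the new cell is met with relative weight
  \<open>(total h - void h) / total h\<close>, whatever happens on the others.
\<close>

lemma expected_cells:
  assumes h: "0 < h"
  shows "(\<integral>\<^sup>+C. cells (Suc n) h C \<partial>\<mu> (real (Suc n) * h)) =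
    ennreal (real (Suc n) * total h ^ n * (total h - void h))"
proof (induction n)
  case 0
  have "(\<integral>\<^sup>+C. cells (Suc 0) h C \<partial>\<mu> h) = (\<integral>\<^sup>+C. (if C = {} then 0 else 1) \<partial>\<mu> h)"
  proof (rule nn_integral_cong_AE)
    show "AE C in \<mu> h. cells (Suc 0) h C = (if C = {} then 0 else 1)"
      using AE_zero[OF h] AE_space
    proof eventually_elim
      fix C :: "real set" assume "0 \<notin> C" "C \<in> space (\<mu> h)"
      then have "C \<inter> {0<..h} = C" using h by (force simp: space_\<mu> closed_subsets_def less_le)
      then show "cells (Suc 0) h C = (if C = {} then 0 else 1)" by (simp add: cells_def)
    qed
  qed
  then show ?case by (simp add: emeasure_nonempty[OF h])
next
  case (Suc n)
  let ?m = "real (Suc n) * h"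
  have m: "0 < ?m" using h by simp
  have mh: "real (Suc (Suc n)) * h = ?m + h" by (simp add: algebra_simps)
  have nn: "0 \<le> total h - void h" using void_le_total[OF h] by simp
  have "(\<integral>\<^sup>+C. cells (Suc (Suc n)) h C \<partial>\<mu> (real (Suc (Suc n)) * h)) =
      (\<integral>\<^sup>+C. (\<integral>\<^sup>+D. cells (Suc (Suc n)) h (join ?m C D) \<partial>\<mu> h) \<partial>\<mu> ?m)"
    unfolding mh by (intro nn_integral_factor measurable_cells m h add_pos_pos)
  also have "\<dots> = (\<integral>\<^sup>+C. (\<integral>\<^sup>+D. cells (Suc n) h C + (if D = {} then 0 else 1) \<partial>\<mu> h) \<partial>\<mu> ?m)"
  proof (rule nn_integral_cong, rule nn_integral_cong_AE)
    fix C assume C: "C \<in> space (\<mu> ?m)"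
    show "AE D in \<mu> h. cells (Suc (Suc n)) h (join ?m C D) = cells (Suc n) h C + (if D = {} then 0 else 1)"
      using AE_zero[OF h] AE_space
    proof eventually_elim
      fix D :: "real set" assume 0: "0 \<notin> D" and D: "D \<in> space (\<mu> h)"
      show "cells (Suc (Suc n)) h (join ?m C D) = cells (Suc n) h C + (if D = {} then 0 else 1)"
        using C D unfolding space_\<mu>[OF m] space_\<mu>[OF h] by (rule cells_join[OF _ _ h 0])
    qed
  qed
  also have "\<dots> = (\<integral>\<^sup>+C. cells (Suc n) h C * ennreal (total h) + ennreal (total h - void h) \<partial>\<mu> ?m)"
  proof (intro nn_integral_cong)
    fix C
    have "(\<lambda>D. if D = {} then 0 else 1 :: ennreal) \<in> borel_measurable (\<mu> h)"
    proof (rule measurable_If)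
      have "{D \<in> space (\<mu> h). D = {}} = {{}}" using h by (auto simp: space_\<mu>)
      then show "{D \<in> space (\<mu> h). D = {}} \<in> sets (\<mu> h)" using sets_void[OF h] by simp
    qed simp_all
    then have "(\<integral>\<^sup>+D. cells (Suc n) h C + (if D = {} then 0 else 1) \<partial>\<mu> h) =
        (\<integral>\<^sup>+D. cells (Suc n) h C \<partial>\<mu> h) + (\<integral>\<^sup>+D. (if D = {} then 0 else 1) \<partial>\<mu> h)"
      by (intro nn_integral_add) simp_all
    then show "(\<integral>\<^sup>+D. cells (Suc n) h C + (if D = {} then 0 else 1) \<partial>\<mu> h) =
        cells (Suc n) h C * ennreal (total h) + ennreal (total h - void h)"
      using h by (simp add: emeasure_nonempty space_\<mu> emeasure_total)
  qed
  also have "\<dots> = (\<integral>\<^sup>+C. cells (Suc n) h C \<partial>\<mu> ?m) * ennreal (total h) + ennreal (total h - void h) * ennreal (total ?m)"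
  proof -
    have c: "cells (Suc n) h \<in> borel_measurable (\<mu> ?m)"
      using measurable_cells[OF m] measurable_cong_sets[OF sets_\<mu>[OF m] refl] by blast
    then have "(\<integral>\<^sup>+C. cells (Suc n) h C * ennreal (total h) + ennreal (total h - void h) \<partial>\<mu> ?m) =
       (\<integral>\<^sup>+C. cells (Suc n) h C * ennreal (total h) \<partial>\<mu> ?m) + (\<integral>\<^sup>+C. ennreal (total h - void h) \<partial>\<mu> ?m)"
      by (intro nn_integral_add) simp_all
    then show ?thesis using c m nonneg by (simp add: nn_integral_multc space_\<mu> emeasure_total)
  qed
  also have "\<dots> = ennreal (real (Suc (Suc n)) * total h ^ Suc n * (total h - void h))"
  proof -
    have "total ?m = total h ^ Suc n" by (rule multiplicative_power[of total, OF total_mult h])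
    moreover have "real (Suc n) * total h ^ n * (total h - void h) * total h + (total h - void h) * total h ^ Suc n =
        real (Suc (Suc n)) * total h ^ Suc n * (total h - void h)" by (simp add: algebra_simps)
    ultimately show ?thesis unfolding Suc
      using nonneg(1)[of h] nn by (simp only: ennreal_mult[symmetric] ennreal_plus[symmetric] mult_nonneg_nonneg zero_le_power of_nat_0_le_iff)
  qed
  finally show ?case .
qed

text \<open>
  With \<open>\<rho> = void h / total h\<close>, where \<open>(n + 1) h = t\<close>, this is \<open>(n + 1) (1 - \<rho>) \<le> - (n + 1) ln \<rho>\<close>, and \<open>\<rho>\<^sup>n\<^sup>+\<^sup>1\<close> is the
  corresponding ratio at time \<open>t\<close>.
\<close>

lemma expected_cells_le:
  assumes t: "0 < t"
  shows "(\<integral>\<^sup>+C. cells (Suc n) (t / real (Suc n)) C \<partial>\<mu> t) \<le> ennreal (total t * (- ln (void t / total t)))"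
proof -
  define h where "h = t / real (Suc n)"
  have h: "0 < h" "real (Suc n) * h = t" using t by (auto simp: h_def)
  define \<rho> where "\<rho> = void h / total h"
  have pos: "0 < total h" "0 < void h" using h total_pos void_pos by auto
  then have \<rho>: "0 < \<rho>" by (simp add: \<rho>_def)
  have tt: "total t = total h ^ Suc n" and vt: "void t = void h ^ Suc n"
    using multiplicative_power[of total, OF total_mult h(1), of n]
      multiplicative_power[of void, OF void_mult h(1), of n] h(2) by simp_all
  have "ln (void t / total t) = real (Suc n) * ln \<rho>"
    unfolding tt vt \<rho>_def power_divide[symmetric] by (rule ln_realpow)
  moreover have "1 - \<rho> \<le> - ln \<rho>" using ln_le_minus_one[OF \<rho>] by simp
  ultimately have "real (Suc n) * (1 - \<rho>) \<le> - ln (void t / total t)"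
    using mult_left_mono[of "1 - \<rho>" "- ln \<rho>" "real (Suc n)"] by simp
  then have "total t * (real (Suc n) * (1 - \<rho>)) \<le> total t * (- ln (void t / total t))"
    using nonneg by (intro mult_left_mono)
  moreover have "total h * (1 - \<rho>) = total h - void h" using pos by (simp add: \<rho>_def field_simps)
  then have "total t * (real (Suc n) * (1 - \<rho>)) = real (Suc n) * total h ^ n * (total h - void h)"
    unfolding tt power_Suc by (metis (no_types, lifting) mult.assoc mult.commute)
  ultimately have le: "real (Suc n) * total h ^ n * (total h - void h) \<le> total t * (- ln (void t / total t))"
    by (simp only:)
  show ?thesis
    using expected_cells[OF h(1), of n] ennreal_leI[OF le] unfolding h(2) h_def[symmetric] by (simp only:)
qed

text \<open>
  The expected number of met cells stays bounded when the partition is refined. By Fatou's lemma its limit is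
  almost surely finite, whereas by assumption it is infinite on nonempty sets.
\<close>

lemma AE_empty:
  assumes t: "0 < t" and inf: "AE C in \<mu> t. C = {} \<or> (\<forall>K. \<exists>N. \<forall>n\<ge>N. of_nat K \<le> cells (Suc n) (t / real (Suc n)) C)"
  shows "AE C in \<mu> t. C = {}"
proof -
  let ?N = "\<lambda>n C. cells (Suc n) (t / real (Suc n)) C"
  have m: "?N n \<in> borel_measurable (\<mu> t)" for n
    using measurable_cells[OF t] measurable_cong_sets[OF sets_\<mu>[OF t] refl] by blast
  have "(\<integral>\<^sup>+C. liminf (\<lambda>n. ?N n C) \<partial>\<mu> t) \<le> liminf (\<lambda>n. \<integral>\<^sup>+C. ?N n C \<partial>\<mu> t)"
    using m by (rule nn_integral_liminf)
  also have "\<dots> \<le> limsup (\<lambda>n. \<integral>\<^sup>+C. ?N n C \<partial>\<mu> t)" by (rule Liminf_le_Limsup) simp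
  also have "\<dots> \<le> ennreal (total t * (- ln (void t / total t)))"
    by (intro Limsup_bounded always_eventually allI expected_cells_le[OF t])
  also have "\<dots> < \<infinity>" by simp
  finally have "AE C in \<mu> t. liminf (\<lambda>n. ?N n C) \<noteq> \<infinity>"
    using m by (intro nn_integral_PInf_AE) auto
  then show ?thesis
    using inf
  proof eventually_elim
    fix C assume fin: "liminf (\<lambda>n. ?N n C) \<noteq> \<infinity>" and C: "C = {} \<or> (\<forall>K. \<exists>N. \<forall>n\<ge>N. of_nat K \<le> ?N n C)"
    show "C = {}"
    proof (rule ccontr)
      assume "C \<noteq> {}"
      then have "\<exists>N. \<forall>n\<ge>N. of_nat K \<le> ?N n C" for K using C by blast
      then have "of_nat K \<le> liminf (\<lambda>n. ?N n C)" for K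
        by (intro Liminf_bounded) (simp add: eventually_sequentially)
      moreover obtain K where "liminf (\<lambda>n. ?N n C) < of_nat K"
        using fin ennreal_Ex_less_of_nat[of "liminf (\<lambda>n. ?N n C)"] by (auto simp: less_top)
      ultimately show False by (meson leD)
    qed
  qed
qed

end

section \<open>Measurable multiplicative functions\<close>

text \<open>
  The measures on \<open>[0,1]\<close> with the densities \<open>1 + r\<close> and \<open>1\<close> agree on half-lines, hence everywhere; the bound on
  \<open>r\<close> keeps the first density nonnegative.
\<close>

lemma AE_zero_of_interval_integrals:
  fixes r :: "real \<Rightarrow> real"
  assumes [measurable]: "r \<in> borel_measurable borel" and bound: "\<And>x. \<bar>r x\<bar> \<le> 1"
    and zero: "\<And>b. 0 \<le> b \<Longrightarrow> b \<le> 1 \<Longrightarrow> (LINT x|lborel. indicator {0..b} x * r x) = 0"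
  shows "AE x in lborel. x \<in> {0..1} \<longrightarrow> r x = 0"
proof -
  let ?f = "\<lambda>x. ennreal (indicator {0..1} x * (1 + r x))" and ?g = "\<lambda>x. ennreal (indicator {0..1} x)"
  have int: "integrable lborel (\<lambda>x. indicator {0..b} x * r x)" "integrable lborel (\<lambda>x. indicator {0..b::real} x :: real)" for b
  proof -
    show 1: "integrable lborel (\<lambda>x. indicator {0..b} x :: real)"
      by (rule integrable_real_indicator) (simp_all add: emeasure_lborel_Icc_eq)
    show "integrable lborel (\<lambda>x. indicator {0..b} x * r x)"
      by (rule Bochner_Integration.integrable_bound[OF 1]) (use bound in \<open>auto simp: indicator_def\<close>)
  qed
  have mass: "(LINT x|lborel. indicator {0..b} x * (1 + r x)) = b" if "0 \<le> b" "b \<le> 1" for b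
    using int[of b] zero[OF that] that by (simp add: distrib_left)
  have "density lborel ?f = density lborel ?g"
  proof (rule measure_eqI_lessThan)
    fix x :: real
    define b where "b = min 1 (max x 0)"
    have b: "0 \<le> b" "b \<le> 1" by (auto simp: b_def)
    have calc: "(LINT y|lborel. indicator {0..1} y * q y - indicator {0..b} y * q y) =
        (LINT y|lborel. indicator {0..1} y * q y) - (LINT y|lborel. indicator {0..b} y * q y)"
      if "q = (\<lambda>y. 1 + r y) \<or> q = (\<lambda>y. 1)" for q :: "real \<Rightarrow> real"
      using that int[of 1] int[of b] by (intro Bochner_Integration.integral_diff) (auto simp: distrib_left)
    have tail: "emeasure (density lborel (\<lambda>x. ennreal (indicator {0..1} x * q x))) {x<..} =
        ennreal (1 - b)"
      if q: "q = (\<lambda>y. 1 + r y) \<or> q = (\<lambda>y. 1)" for q :: "real \<Rightarrow> real"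
    proof -
      have [measurable]: "q \<in> borel_measurable borel" using q by auto
      have q0: "0 \<le> q y" for y using q bound[of y] by auto
      have qi: "integrable lborel (\<lambda>y. indicator {0..c} y * q y)" for c
        using q int[of c] by (auto simp: distrib_left)
      have "emeasure (density lborel (\<lambda>x. ennreal (indicator {0..1} x * q x))) {x<..} =
          (\<integral>\<^sup>+y. ennreal (indicator {0..1} y * q y) * indicator {x<..} y \<partial>lborel)"
        by (rule emeasure_density) auto
      also have "\<dots> = (\<integral>\<^sup>+y. ennreal (indicator {0..1} y * q y - indicator {0..b} y * q y) \<partial>lborel)"
        using AE_lborel_singleton[of 0]
        by (intro nn_integral_cong_AE) (auto simp: indicator_def b_def elim!: eventually_mono)
      also have "\<dots> = ennreal (LINT y|lborel. indicator {0..1} y * q y - indicator {0..b} y * q y)"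
        using qi b q0 by (intro nn_integral_eq_integral Bochner_Integration.integrable_diff AE_I2) (auto simp: indicator_def)
      also have "\<dots> = ennreal (1 - b)"
        unfolding calc[OF q] using q mass[of 1] mass[OF b] b by auto
      finally show ?thesis .
    qed
    show "emeasure (density lborel ?f) {x<..} = emeasure (density lborel ?g) {x<..}"
      using tail[of "\<lambda>y. 1 + r y"] tail[of "\<lambda>y. 1"] by simp
    show "emeasure (density lborel ?f) {x<..} < \<infinity>"
      using tail[of "\<lambda>y. 1 + r y"] by simp
  qed auto
  then have "AE x in lborel. ?f x = ?g x"
    by (intro sigma_finite_measure.density_unique[OF lborel.sigma_finite_measure_axioms]) auto
  then show ?thesis
  proof eventually_elim
    fix x assume "?f x = ?g x"
    then show "x \<in> {0..1} \<longrightarrow> r x = 0" using bound[of x] by (auto simp: indicator_def ennreal_inj)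
  qed
qed

text \<open>
  Choose an interval \<open>[0,T]\<close> on which the integral of \<open>G\<close> does not vanish. Then \<open>G x\<close> is, up to a constant factor, the
  integral of \<open>G\<close> over \<open>[x,x + T]\<close>; so \<open>G\<close> is continuous, hence differentiable, and \<open>G' = k G\<close>.
\<close>

lemma unimodular_multiplicative_exp:
  fixes G :: "real \<Rightarrow> complex"
  assumes mult: "\<And>s t. 0 < s \<Longrightarrow> 0 < t \<Longrightarrow> G (s + t) = G s * G t"
    and unimodular: "\<And>t. 0 < t \<Longrightarrow> cmod (G t) = 1"
    and meas: "G \<in> borel_measurable (restrict_space borel {0<..})"
  shows "\<exists>k. \<forall>t>0. G t = exp (k * complex_of_real t)"
proof -
  define H where "H x = indicator {0<..} x *\<^sub>R G x" for x
  have H [measurable]: "H \<in> borel_measurable borel"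
    using meas unfolding H_def by (subst (asm) borel_measurable_restrict_space_iff) auto
  have H_pos: "H x = G x" if "0 < x" for x using that by (simp add: H_def)
  have H_le: "cmod (H x) \<le> 1" for x using unimodular[of x] by (auto simp: H_def indicator_def)
  have si: "set_integrable lborel {a..b} H" for a b
    unfolding set_integrable_def
  proof (rule Bochner_Integration.integrable_bound)
    show "integrable lborel (\<lambda>x. indicator {a..b} x :: real)"
      by (rule integrable_real_indicator) (simp_all add: emeasure_lborel_Icc_eq)
  qed (use H_le in \<open>auto simp: indicator_def\<close>)
  have hk: "H integrable_on {a..b}" for a b using set_borel_integral_eq_integral(1)[OF si] .
  define c where "c T = integral {0..T} H" for T
  have "\<exists>T>0. c T \<noteq> 0"
  proof (rule ccontr)
    assume "\<not> ?thesis"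
    then have "c T = 0" if "0 \<le> T" for T using that by (cases "T = 0") (auto simp: c_def)
    then have zero: "(LINT x|lborel. indicator {0..b} x *\<^sub>R H x) = 0" if "0 \<le> b" for b
      using that set_borel_integral_eq_integral(2)[OF si, of 0 b] by (simp add: c_def set_lebesgue_integral_def)
    have i: "integrable lborel (\<lambda>x. indicator {0..b} x *\<^sub>R H x)" for b
      using si[of 0 b] by (simp add: set_integrable_def)
    have "AE x in lborel. x \<in> {0..1} \<longrightarrow> Re (H x) = 0"
    proof (rule AE_zero_of_interval_integrals)
      show "\<bar>Re (H x)\<bar> \<le> 1" for x using abs_Re_le_cmod[of "H x"] H_le[of x] by linarith
      show "(LINT x|lborel. indicator {0..b} x * Re (H x)) = 0" if "0 \<le> b" for b
        using arg_cong[OF zero[OF that], of Re] by (simp add: integral_Re[OF i, symmetric])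
    qed measurable
    moreover have "AE x in lborel. x \<in> {0..1} \<longrightarrow> Im (H x) = 0"
    proof (rule AE_zero_of_interval_integrals)
      show "\<bar>Im (H x)\<bar> \<le> 1" for x using abs_Im_le_cmod[of "H x"] H_le[of x] by linarith
      show "(LINT x|lborel. indicator {0..b} x * Im (H x)) = 0" if "0 \<le> b" for b
        using arg_cong[OF zero[OF that], of Im] by (simp add: integral_Im[OF i, symmetric])
    qed measurable
    ultimately have "AE x in lborel. x \<notin> {0<..1::real}"
    proof eventually_elim
      fix x :: real assume "x \<in> {0..1} \<longrightarrow> Re (H x) = 0" "x \<in> {0..1} \<longrightarrow> Im (H x) = 0"
      then have "H x = 0" if "x \<in> {0<..1}" using that by (intro complex_eqI) auto
      then show "x \<notin> {0<..1}" using unimodular[of x] H_pos[of x] by auto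
    qed
    then have "{0<..1::real} \<in> null_sets lborel" by (subst AE_iff_null_sets) auto
    then show False by (auto simp: null_sets_def)
  qed
  then obtain T where T: "0 < T" "c T \<noteq> 0" by blast
  have shift: "G x * c T = c (x + T) - c x" if x: "0 < x" for x
  proof -
    have "c x + integral {x..x + T} H = c (x + T)"
      unfolding c_def using x T hk by (intro Henstock_Kurzweil_Integration.integral_combine) auto
    moreover have "integral {x..x + T} H = (LINT z|lborel. indicator {x..x + T} z *\<^sub>R H z)"
      using set_borel_integral_eq_integral(2)[OF si, of x "x + T"] by (simp add: set_lebesgue_integral_def)
    moreover have "\<dots> = (LINT y|lborel. indicator {x..x + T} (x + 1 * y) *\<^sub>R H (x + 1 * y))"
      by (subst lborel_integral_real_affine[of 1 _ x]) simp_all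
    moreover have "\<dots> = (LINT y|lborel. G x * (indicator {0..T} y *\<^sub>R H y))"
    proof (rule integral_cong_AE)
      show "AE y in lborel. indicator {x..x + T} (x + 1 * y) *\<^sub>R H (x + 1 * y) = G x * (indicator {0..T} y *\<^sub>R H y)"
        using AE_lborel_singleton[of 0]
      proof eventually_elim
        fix y :: real assume "y \<noteq> 0"
        then show "indicator {x..x + T} (x + 1 * y) *\<^sub>R H (x + 1 * y) = G x * (indicator {0..T} y *\<^sub>R H y)"
          using x mult[of x y] by (auto simp: indicator_def H_pos)
      qed
    qed measurable
    moreover have "\<dots> = G x * c T"
      using set_borel_integral_eq_integral(2)[OF si, of 0 T]
      by (simp only: integral_mult_right_zero c_def set_lebesgue_integral_def)
    ultimately show ?thesis by (simp add: eq_diff_eq add.commute)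
  qed
  then have G_eq: "G x = (c (x + T) - c x) / c T" if "0 < x" for x
    using that T(2) by (simp add: field_simps)
  have c_cont: "continuous_on {0..b} c" for b
    unfolding c_def using hk by (rule indefinite_integral_continuous_1)
  have G_cont: "continuous_on {a..b} G" if "0 < a" for a b
  proof -
    have 1: "continuous_on {a..b} c" using that by (intro continuous_on_subset[OF c_cont[of b]]) auto
    have "continuous_on {a..b} (\<lambda>x. c (x + T))"
      by (rule continuous_on_compose2[OF c_cont[of "b + T"]])
        (use that T in \<open>auto intro!: continuous_intros\<close>)
    then have "continuous_on {a..b} (\<lambda>x. (c (x + T) - c x) / c T)" using 1 T by (intro continuous_intros) auto
    then show ?thesis using that by (subst continuous_on_cong[OF refl G_eq]) auto
  qed
  have c_deriv: "(c has_vector_derivative G x) (at x)" if x: "0 < x" for x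
  proof -
    have "continuous_on {x / 2..2 * x} H"
      using G_cont[of "x / 2" "2 * x"] x by (subst continuous_on_cong[OF refl H_pos]) auto
    then have "((\<lambda>u. integral {x / 2..u} H) has_vector_derivative H x) (at x within {x / 2..2 * x})"
      using x by (intro integral_has_vector_derivative) auto
    then have "((\<lambda>u. integral {x / 2..u} H) has_vector_derivative G x) (at x)"
      using x by (subst (asm) at_within_Icc_at) (auto simp: H_pos)
    then have "((\<lambda>u. c (x / 2) + integral {x / 2..u} H) has_vector_derivative 0 + G x) (at x)"
      by (intro has_vector_derivative_add has_vector_derivative_const)
    then have "((\<lambda>u. c (x / 2) + integral {x / 2..u} H) has_vector_derivative G x) (at x)" by simp
    then show ?thesis
    proof (rule has_vector_derivative_transform_within_open[of _ _ _ "{x / 2<..}"])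
      show "c (x / 2) + integral {x / 2..u} H = c u" if "u \<in> {x / 2<..}" for u
        unfolding c_def using that x hk by (intro Henstock_Kurzweil_Integration.integral_combine) auto
    qed (use x in auto)
  qed
  define k where "k = (G T - 1) / c T"
  have G_deriv: "(G has_vector_derivative k * G x) (at x)" if x: "0 < x" for x
  proof -
    have "((\<lambda>x. c (x + T)) has_vector_derivative 1 *\<^sub>R G (x + T)) (at x)"
      using vector_diff_chain_at[of "\<lambda>x. x + T" 1 x c "G (x + T)"] c_deriv[of "x + T"] x T
      by (simp add: o_def has_vector_derivative_add_const has_vector_derivative_id)
    then have "((\<lambda>x. (c (x + T) - c x) / c T) has_vector_derivative (1 *\<^sub>R G (x + T) - G x) / c T) (at x)"
      using c_deriv[OF x] by (intro has_vector_derivative_divide has_vector_derivative_diff)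
    moreover have "(1 *\<^sub>R G (x + T) - G x) / c T = k * G x"
      using mult[OF x T(1)] by (simp add: k_def field_simps)
    ultimately have "((\<lambda>x. (c (x + T) - c x) / c T) has_vector_derivative k * G x) (at x)" by simp
    then show ?thesis
      by (rule has_vector_derivative_transform_within_open[of _ _ _ "{0<..}"]) (use x G_eq in auto)
  qed
  have "((\<lambda>t. G t * exp (- k * complex_of_real t)) has_vector_derivative 0) (at x within {0<..})"
    if x: "x \<in> {0<..}" for x
  proof -
    have "((\<lambda>t. exp (- k * complex_of_real t)) has_vector_derivative - k * exp (- k * complex_of_real x)) (at x)"
      by (auto intro!: derivative_eq_intros has_vector_derivative_real_field simp: mult.commute)
    from has_vector_derivative_mult[OF G_deriv this] x
    have "((\<lambda>t. G t * exp (- k * complex_of_real t)) has_vector_derivative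
        G x * (- k * exp (- k * complex_of_real x)) + k * G x * exp (- k * complex_of_real x)) (at x)" by simp
    then show ?thesis by (simp add: has_vector_derivative_at_within)
  qed
  then obtain C where C: "\<And>t. t \<in> {0<..} \<Longrightarrow> G t * exp (- k * complex_of_real t) = C"
    using has_vector_derivative_zero_constant[of "{0<..}" "\<lambda>t. G t * exp (- k * complex_of_real t)"] by auto
  have G_exp: "G t = C * exp (k * complex_of_real t)" if "0 < t" for t
    using C[of t] that by (auto simp: exp_minus field_simps)
  have "C * exp (k * 2) = C * exp k * (C * exp k)"
    using mult[of 1 1] unfolding G_exp[of 1, OF zero_less_one] using G_exp[of 2] by simp
  also have "\<dots> = C * C * exp (k * 2)"
    unfolding mult_2_right exp_add by (simp only: mult_ac)
  finally have "C = C * C" by simp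
  moreover have "C \<noteq> 0" using G_exp[of 1] unimodular[of 1] by auto
  ultimately have "C = 1" by simp
  then show ?thesis using G_exp by auto
qed

text \<open>
  The phase of \<open>g\<close> is unimodular. As to the modulus, let \<open>d\<close> be the additive function \<open>ln \<bar>g\<bar>\<close> minus the linear function
  with the same value at \<open>1\<close>. For every real \<open>\<kappa>\<close> the function \<open>exp (\<i> \<kappa> d)\<close> is an exponential that equals \<open>1\<close> at all
  points \<open>1 / n\<close>, hence is identically \<open>1\<close>; as \<open>\<kappa>\<close> is arbitrary, \<open>d = 0\<close>.
\<close>

lemma measurable_multiplicative_exp:
  fixes g :: "real \<Rightarrow> complex"
  assumes mult: "\<And>s t. 0 < s \<Longrightarrow> 0 < t \<Longrightarrow> g (s + t) = g s * g t"
    and nz: "\<And>t. 0 < t \<Longrightarrow> g t \<noteq> 0"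
    and meas [measurable]: "g \<in> borel_measurable (restrict_space borel {0<..})"
  shows "\<exists>k. \<forall>t>0. g t = exp (k * complex_of_real t)"
proof -
  define L where "L t = ln (cmod (g t))" for t
  define d where "d t = L t - L 1 * t" for t
  have L_add: "L (s + t) = L s + L t" if "0 < s" "0 < t" for s t
    using that nz by (simp add: L_def mult norm_mult ln_mult)
  have [measurable]: "L \<in> borel_measurable (restrict_space borel {0<..})" unfolding L_def by measurable
  have L_inv: "real (Suc n) * L (1 / real (Suc n)) = L 1" for n
  proof -
    have "L (real (Suc m) * x) = real (Suc m) * L x" if x: "0 < x" for m x
    proof (induction m)
      case (Suc m)
      have "real (Suc (Suc m)) * x = real (Suc m) * x + x" by (simp add: algebra_simps)
      then have "L (real (Suc (Suc m)) * x) = L (real (Suc m) * x) + L x"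
        using L_add[of "real (Suc m) * x" x] x by simp
      then show ?case using Suc by (simp add: algebra_simps)
    qed simp
    from this[of "1 / real (Suc n)" n] show ?thesis by simp
  qed
  have unit: "exp (\<i> * complex_of_real (\<kappa> * d t)) = 1" if t: "0 < t" for \<kappa> t
  proof -
    let ?E = "\<lambda>t. exp (\<i> * complex_of_real (\<kappa> * d t))"
    have "\<exists>k. \<forall>t>0. ?E t = exp (k * complex_of_real t)"
    proof (rule unimodular_multiplicative_exp)
      fix s t :: real assume "0 < s" "0 < t"
      then have "d (s + t) = d s + d t" by (simp add: d_def L_add algebra_simps)
      then show "?E (s + t) = ?E s * ?E t" by (simp add: exp_add[symmetric] algebra_simps)
    next
      have [measurable]: "d \<in> borel_measurable (restrict_space borel {0<..})"
        unfolding d_def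
        by (intro borel_measurable_diff borel_measurable_times borel_measurable_const
            measurable_restrict_space1[OF measurable_ident_sets[OF refl]]) fact
      have "?E = (\<lambda>x. exp (\<i> * complex_of_real (\<kappa> * x))) \<circ> d" by (simp add: o_def)
      also have "\<dots> \<in> borel_measurable (restrict_space borel {0<..})"
        by (rule measurable_comp[of _ _ borel]) (auto intro!: borel_measurable_continuous_onI continuous_intros)
      finally show "?E \<in> borel_measurable (restrict_space borel {0<..})" .
    qed simp
    then obtain k where k: "\<And>t. 0 < t \<Longrightarrow> ?E t = exp (k * complex_of_real t)" by blast
    \<comment> \<open>\<open>d\<close> vanishes at \<open>1 / n\<close>, so \<open>k / n\<close> is a multiple of \<open>2 \<pi> \<i>\<close> for every \<open>n\<close>\<close>
    obtain n :: nat where n: "cmod k < real n" using reals_Archimedean2 by blast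
    have "d (1 / real (Suc n)) = 0" using L_inv[of n] by (simp add: d_def field_simps)
    then have "exp (k * complex_of_real (1 / real (Suc n))) = 1" using k[of "1 / real (Suc n)"] by simp
    then obtain m :: int where m: "Re (k * complex_of_real (1 / real (Suc n))) = 0"
        "Im (k * complex_of_real (1 / real (Suc n))) = of_int (2 * m) * pi"
      unfolding exp_eq_1 by blast
    have "\<bar>Im k\<bar> < real (Suc n)" using abs_Im_le_cmod[of k] n by simp
    then have "\<bar>Im k / real (Suc n)\<bar> < 1" by (simp add: field_simps abs_divide)
    moreover have "Im k / real (Suc n) = of_int (2 * m) * pi" using m(2) by simp
    ultimately have "\<bar>of_int (2 * m) * pi\<bar> < 1" by (simp only:)
    then have "m = 0"
    proof -
      assume lt: "\<bar>of_int (2 * m) * pi\<bar> < 1"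
      show "m = 0"
      proof (rule ccontr)
        assume "m \<noteq> 0"
        then have "1 \<le> \<bar>real_of_int (2 * m)\<bar>" by linarith
        then have "1 * 1 \<le> \<bar>real_of_int (2 * m)\<bar> * pi" using pi_gt3 by (intro mult_mono) auto
        then show False using lt by (simp add: abs_mult)
      qed
    qed
    then have "k = 0" using m by (simp add: complex_eq_iff)
    then show ?thesis using k[OF t] by simp
  qed
  have "d t = 0" if t: "0 < t" for t
  proof (rule ccontr)
    assume "d t \<noteq> 0"
    then show False using unit[OF t, of "pi / d t"] by simp
  qed
  then have abs_g: "complex_of_real (cmod (g t)) = exp (complex_of_real (L 1) * complex_of_real t)" if "0 < t" for t
  proof -
    have "ln (cmod (g t)) = L 1 * t" using \<open>\<And>t. 0 < t \<Longrightarrow> d t = 0\<close>[OF that] by (simp add: d_def L_def)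
    then have "cmod (g t) = exp (L 1 * t)" using nz[OF that] by (metis exp_ln zero_less_norm_iff)
    then show ?thesis by (simp add: exp_of_real[symmetric])
  qed
  have "\<exists>k. \<forall>t>0. g t / complex_of_real (cmod (g t)) = exp (k * complex_of_real t)"
  proof (rule unimodular_multiplicative_exp)
    show "(\<lambda>t. g t / complex_of_real (cmod (g t))) \<in> borel_measurable (restrict_space borel {0<..})" by measurable
  qed (use nz in \<open>auto simp: mult norm_mult norm_divide\<close>)
  then obtain k where k: "\<And>t. 0 < t \<Longrightarrow> g t / complex_of_real (cmod (g t)) = exp (k * complex_of_real t)" by blast
  have "g t = exp ((k + complex_of_real (L 1)) * complex_of_real t)" if t: "0 < t" for t
  proof -
    have "g t = exp (k * complex_of_real t) * complex_of_real (cmod (g t))"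
      using k[OF t] nz[OF t] by (simp add: field_simps)
    then show ?thesis unfolding abs_g[OF t] by (simp add: exp_add[symmetric] distrib_right)
  qed
  then show ?thesis by blast
qed

section \<open>The units of the product system\<close>

context standard_brownian_motion
begin

abbreviation type :: "real \<Rightarrow> real set measure set" where "type \<equiv> level_set_type M B"

lemma measure_class_type:
  assumes t: "0 < t"
  shows "measure_class (type t)"
proof (rule measure_class.intro)
  show "type t \<noteq> {}" using level_set_law_in_type[OF t, of 1] by auto
  show "prob_space P" if "P \<in> type t" for P using that by (rule level_set_type_prob)
  show "equivalent_measures P Q" if "P \<in> type t" "Q \<in> type t" for P Q
    using t that by (rule level_set_type_equivalent)
qed

lemma sets_singleton_type: "0 < t \<Longrightarrow> P \<in> type t \<Longrightarrow> {{}} \<in> sets P"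
  by (simp add: level_set_type_sets)

lemma iso_dilate:
  assumes t: "0 < t"
  shows "measure_class_iso (type 1) (type t) (closed_sets_space 1) (closed_sets_space t) (dilate t) (dilate (1 / t))"
proof -
  interpret A: measure_class "type 1" by (rule measure_class_type) simp
  interpret B: measure_class "type t" by (rule measure_class_type[OF t])
  show ?thesis
  proof
    show "dilate t \<in> closed_sets_space 1 \<rightarrow>\<^sub>M closed_sets_space t"
      using measurable_dilate[of 1 t] t by simp
    show "dilate (1 / t) \<in> closed_sets_space t \<rightarrow>\<^sub>M closed_sets_space 1"
      using measurable_dilate[of t "1 / t"] t by simp
    show "distr P (closed_sets_space t) (dilate t) \<in> type t" if "P \<in> type 1" for P
      using distr_dilate_in_type[of t 1 P] t that by simp
    show "distr Q (closed_sets_space 1) (dilate (1 / t)) \<in> type 1" if "Q \<in> type t" for Q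
      using distr_dilate_in_type[of "1 / t" t Q] t that by simp
  qed (use t in \<open>auto simp: level_set_type_sets dilate_inverse\<close>)
qed

lemma dilate_op_transport:
  "0 < t \<Longrightarrow> dilate_op type t \<psi> =
    measure_class_iso.transport (type 1) (type t) (closed_sets_space t) (dilate t) \<psi>"
  unfolding measure_class_iso.transport_def[OF iso_dilate] dilate_op_def dilate_law_def ..

text \<open>
  The coefficient of a half-density at the empty set: its inner product with the special unit.
\<close>

abbreviation void_coeff :: "real \<Rightarrow> real set half_density \<Rightarrow> complex" where
  "void_coeff t \<equiv> measure_class.atom (type t) {}"

lemma
  assumes t: "0 < t"
  shows dilate_op_L2_type: "\<psi> \<in> L2_type (type 1) \<Longrightarrow> dilate_op type t \<psi> \<in> L2_type (type t)"
    and dilate_op_surj: "\<phi> \<in> L2_type (type t) \<Longrightarrow> \<exists>\<psi>\<in>L2_type (type 1). dilate_op type t \<psi> = \<phi>"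
    and void_coeff_dilate_op: "\<psi> \<in> L2_type (type 1) \<Longrightarrow> void_coeff t (dilate_op type t \<psi>) = void_coeff 1 \<psi>"
proof -
  interpret measure_class_iso "type 1" "type t" "closed_sets_space 1" "closed_sets_space t" "dilate t" "dilate (1 / t)"
    by (rule iso_dilate[OF t])
  show "dilate_op type t \<psi> \<in> L2_type (type t)" if "\<psi> \<in> L2_type (type 1)"
    unfolding dilate_op_transport[OF t] using that by (rule transport_L2_type)
  show "\<exists>\<psi>\<in>L2_type (type 1). dilate_op type t \<psi> = \<phi>" if "\<phi> \<in> L2_type (type t)"
    unfolding dilate_op_transport[OF t] using that by (rule transport_surj)
  show "void_coeff t (dilate_op type t \<psi>) = void_coeff 1 \<psi>" if "\<psi> \<in> L2_type (type 1)"
  proof -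
    obtain P where P: "P \<in> type 1" using A.nonempty by blast
    have "dilate t {} = {}" by (simp add: dilate_def)
    then show ?thesis
      using atom_transport[OF that P, of "{}"] t unfolding dilate_op_transport[OF t] by simp
  qed
qed

lemma sets_bundle_spaceI:
  assumes "A \<in> sets (restrict_space borel {0<..} \<Otimes>\<^sub>M L2_borel (type 1))"
  shows "(\<lambda>(t, \<psi>). (t, dilate_op type t \<psi>)) ` A \<in> sets (bundle_space type)"
proof -
  interpret measure_class "type 1" by (rule measure_class_type) simp
  have into: "A' \<subseteq> {0<..} \<times> L2_type (type 1)" if "A' \<in> sets (restrict_space borel {0<..} \<Otimes>\<^sub>M L2_borel (type 1))" for A'
    using sets.sets_into_space[OF that] by (auto simp: space_pair_measure space_restrict_space space_L2_borel)
  have "{(\<lambda>(t, \<psi>). (t, dilate_op type t \<psi>)) ` A | A.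
      A \<in> sets (restrict_space borel {0<..} \<Otimes>\<^sub>M L2_borel (type 1))} \<subseteq> Pow (SIGMA t:{0<..}. L2_type (type t))"
  proof (intro subsetI, elim CollectE exE conjE)
    fix X A' assume X: "X = (\<lambda>(t, \<psi>). (t, dilate_op type t \<psi>)) ` A'"
      and A': "A' \<in> sets (restrict_space borel {0<..} \<Otimes>\<^sub>M L2_borel (type 1))"
    show "X \<in> Pow (SIGMA t:{0<..}. L2_type (type t))"
    proof (intro PowI subsetI)
      fix z assume "z \<in> X"
      then obtain t \<psi> where z: "(t, \<psi>) \<in> A'" "z = (t, dilate_op type t \<psi>)" unfolding X by auto
      then have "0 < t" "\<psi> \<in> L2_type (type 1)" using into[OF A'] by auto
      then show "z \<in> (SIGMA t:{0<..}. L2_type (type t))" using z(2) dilate_op_L2_type by simp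
    qed
  qed
  then show ?thesis
    unfolding bundle_space_def by (subst sets_measure_of) (use assms in blast)+
qed

text \<open>
  The Borel structure of the bundle comes from \<open>H\<^sub>1\<close> by dilations. They preserve the coefficient at the empty
  set, and on \<open>H\<^sub>1\<close> this coefficient is continuous.
\<close>

lemma measurable_void_coeff:
  assumes u: "\<And>t. 0 < t \<Longrightarrow> u t \<in> L2_type (type t)"
    and meas: "(\<lambda>t. (t, u t)) \<in> restrict_space borel {0<..} \<rightarrow>\<^sub>M bundle_space type"
  shows "(\<lambda>t. void_coeff t (u t)) \<in> borel_measurable (restrict_space borel {0<..})"
proof (rule measurableI)
  interpret measure_class "type 1" by (rule measure_class_type) simp
  let ?R = "restrict_space borel {0<..} :: real measure"
  fix U :: "complex set" assume U: "U \<in> sets borel"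
  obtain P where P: "P \<in> type 1" using nonempty by blast
  let ?A = "{z \<in> space (?R \<Otimes>\<^sub>M L2_borel (type 1)). void_coeff 1 (snd z) \<in> U}"
  have [measurable]: "void_coeff 1 \<in> borel_measurable (L2_borel (type 1))"
    by (rule measurable_atom[OF P sets_singleton_type[OF zero_less_one P]])
  have "?A \<in> sets (?R \<Otimes>\<^sub>M L2_borel (type 1))" using U by measurable
  then have "(\<lambda>t. (t, u t)) -` ((\<lambda>(t, \<psi>). (t, dilate_op type t \<psi>)) ` ?A) \<inter> space ?R \<in> sets ?R"
    by (intro measurable_sets[OF meas] sets_bundle_spaceI)
  also have "(\<lambda>t. (t, u t)) -` ((\<lambda>(t, \<psi>). (t, dilate_op type t \<psi>)) ` ?A) \<inter> space ?R =
      (\<lambda>t. void_coeff t (u t)) -` U \<inter> space ?R"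
  proof (intro set_eqI)
    fix t
    have A: "(t, \<psi>) \<in> ?A \<longleftrightarrow> 0 < t \<and> \<psi> \<in> L2_type (type 1) \<and> void_coeff 1 \<psi> \<in> U" for t \<psi>
      by (auto simp: space_pair_measure space_restrict_space space_L2_borel)
    have "(t, u t) \<in> (\<lambda>(t, \<psi>). (t, dilate_op type t \<psi>)) ` ?A \<longleftrightarrow> void_coeff t (u t) \<in> U" if t: "0 < t"
    proof
      assume "(t, u t) \<in> (\<lambda>(t, \<psi>). (t, dilate_op type t \<psi>)) ` ?A"
      then obtain \<psi> where "u t = dilate_op type t \<psi>" "(t, \<psi>) \<in> ?A" by auto
      then show "void_coeff t (u t) \<in> U" using void_coeff_dilate_op[OF t, of \<psi>] A by simp
    next
      assume *: "void_coeff t (u t) \<in> U"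
      obtain \<psi> where \<psi>: "\<psi> \<in> L2_type (type 1)" "dilate_op type t \<psi> = u t"
        using dilate_op_surj[OF t u[OF t]] by blast
      have "(t, \<psi>) \<in> ?A" unfolding A using * void_coeff_dilate_op[OF t \<psi>(1)] \<psi> t by simp
      then show "(t, u t) \<in> (\<lambda>(t, \<psi>). (t, dilate_op type t \<psi>)) ` ?A"
        by (rule rev_image_eqI) (simp add: \<psi>(2))
    qed
    then show "t \<in> (\<lambda>t. (t, u t)) -` ((\<lambda>(t, \<psi>). (t, dilate_op type t \<psi>)) ` ?A) \<inter> space ?R \<longleftrightarrow>
        t \<in> (\<lambda>t. void_coeff t (u t)) -` U \<inter> space ?R"
      by (simp add: space_restrict_space cong: conj_cong) blast
  qed
  finally show "(\<lambda>t. void_coeff t (u t)) -` U \<inter> space ?R \<in> sets ?R" .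
qed simp

text \<open>
  On a product of measures the squared modulus and the value at the atom \<open>(\<emptyset>, \<emptyset>)\<close> of a product function are
  products. If the atom has measure \<open>0\<close>, both coefficients vanish by definition.
\<close>

lemma tensor_square_and_void_coeff:
  assumes s: "0 < s" and t: "0 < t"
    and \<psi>\<^sub>1: "\<psi>\<^sub>1 \<in> L2_type (type s)" and \<psi>\<^sub>2: "\<psi>\<^sub>2 \<in> L2_type (type t)"
    and tensor: "is_tensor type s t \<psi>\<^sub>1 \<psi>\<^sub>2 \<psi>"
  shows "measure_class.square (type (s + t)) \<psi> =
      distr (measure_class.square (type s) \<psi>\<^sub>1 \<Otimes>\<^sub>M measure_class.square (type t) \<psi>\<^sub>2)
        (closed_sets_space (s + t)) (\<lambda>(C, D). join s C D)"
    and "void_coeff (s + t) \<psi> = void_coeff s \<psi>\<^sub>1 * void_coeff t \<psi>\<^sub>2"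
proof -
  have st: "0 < s + t" using s t by simp
  interpret S: measure_class "type s" by (rule measure_class_type[OF s])
  interpret T: measure_class "type t" by (rule measure_class_type[OF t])
  interpret ST: measure_class "type (s + t)" by (rule measure_class_type[OF st])
  obtain P\<^sub>1 P\<^sub>2 where P\<^sub>1: "P\<^sub>1 \<in> type s" and P\<^sub>2: "P\<^sub>2 \<in> type t" using S.nonempty T.nonempty by blast
  define J where "J = join_law s t P\<^sub>1 P\<^sub>2"
  have J: "J \<in> type (s + t)" unfolding J_def by (rule join_law_in_type[OF s t P\<^sub>1 P\<^sub>2])
  have \<psi>: "\<psi> \<in> L2_type (type (s + t))" using tensor by (simp add: is_tensor_def)
  obtain f\<^sub>1 f\<^sub>2 f where f\<^sub>1: "f\<^sub>1 \<in> \<psi>\<^sub>1 P\<^sub>1" and f\<^sub>2: "f\<^sub>2 \<in> \<psi>\<^sub>2 P\<^sub>2" and f: "f \<in> \<psi> J"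
    using S.L2_type_member[OF \<psi>\<^sub>1 P\<^sub>1] T.L2_type_member[OF \<psi>\<^sub>2 P\<^sub>2] ST.L2_type_member[OF \<psi> J] by blast
  have m1 [measurable]: "f\<^sub>1 \<in> borel_measurable P\<^sub>1" using S.L2_typeD(1)[OF \<psi>\<^sub>1 P\<^sub>1 f\<^sub>1] .
  have m2 [measurable]: "f\<^sub>2 \<in> borel_measurable P\<^sub>2" using T.L2_typeD(1)[OF \<psi>\<^sub>2 P\<^sub>2 f\<^sub>2] .
  have "f \<in> borel_measurable J" using ST.L2_typeD(1)[OF \<psi> J f] .
  then have m: "f \<in> borel_measurable (closed_sets_space (s + t))"
    using measurable_cong_sets[OF level_set_type_sets[OF J] refl] by blast
  let ?j = "\<lambda>(C, D). join s C D"
  have j: "?j \<in> P\<^sub>1 \<Otimes>\<^sub>M P\<^sub>2 \<rightarrow>\<^sub>M closed_sets_space (s + t)"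
    using measurable_join[OF s t] level_set_type_sets[OF P\<^sub>1] level_set_type_sets[OF P\<^sub>2]
    by (simp cong: measurable_cong_sets sets_pair_measure_cong)
  have mj [measurable]: "(\<lambda>z. f (?j z)) \<in> borel_measurable (P\<^sub>1 \<Otimes>\<^sub>M P\<^sub>2)" by (rule measurable_compose[OF j m])
  have AE: "AE z in P\<^sub>1 \<Otimes>\<^sub>M P\<^sub>2. f (?j z) = f\<^sub>1 (fst z) * f\<^sub>2 (snd z)"
    using tensor P\<^sub>1 P\<^sub>2 f\<^sub>1 f\<^sub>2 f unfolding is_tensor_def J_def by (simp add: case_prod_beta)
  let ?n = "\<lambda>f x. ennreal ((cmod (f x))\<^sup>2)"
  have "ST.square \<psi> = density (distr (P\<^sub>1 \<Otimes>\<^sub>M P\<^sub>2) (closed_sets_space (s + t)) ?j) (?n f)"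
    unfolding ST.square_eq[OF \<psi> J f] by (simp add: J_def join_law_def)
  also have "\<dots> = distr (density (P\<^sub>1 \<Otimes>\<^sub>M P\<^sub>2) (\<lambda>z. ?n f (?j z))) (closed_sets_space (s + t)) ?j"
    using m by (intro density_distr j) simp
  also have "density (P\<^sub>1 \<Otimes>\<^sub>M P\<^sub>2) (\<lambda>z. ?n f (?j z)) = density (P\<^sub>1 \<Otimes>\<^sub>M P\<^sub>2) (\<lambda>(C, D). ?n f\<^sub>1 C * ?n f\<^sub>2 D)"
  proof (rule density_cong)
    show "AE z in P\<^sub>1 \<Otimes>\<^sub>M P\<^sub>2. ?n f (?j z) = (case z of (C, D) \<Rightarrow> ?n f\<^sub>1 C * ?n f\<^sub>2 D)"
      using AE by eventually_elim
        (auto simp: case_prod_beta norm_mult power_mult_distrib ennreal_mult)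
  qed measurable
  also have "\<dots> = density P\<^sub>1 (?n f\<^sub>1) \<Otimes>\<^sub>M density P\<^sub>2 (?n f\<^sub>2)"
  proof (rule pair_measure_density[symmetric])
    show "sigma_finite_measure P\<^sub>2" by (rule T.sigma_finite[OF P\<^sub>2])
    show "sigma_finite_measure (density P\<^sub>2 (?n f\<^sub>2))"
      using T.finite_measure_square[OF \<psi>\<^sub>2] unfolding T.square_eq[OF \<psi>\<^sub>2 P\<^sub>2 f\<^sub>2]
      by (simp add: finite_measure_def)
  qed measurable
  finally show "ST.square \<psi> = distr (S.square \<psi>\<^sub>1 \<Otimes>\<^sub>M T.square \<psi>\<^sub>2) (closed_sets_space (s + t)) ?j"
    unfolding S.square_eq[OF \<psi>\<^sub>1 P\<^sub>1 f\<^sub>1] T.square_eq[OF \<psi>\<^sub>2 P\<^sub>2 f\<^sub>2] .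
  have 1: "{{}} \<in> sets P\<^sub>1" "{{}} \<in> sets P\<^sub>2" "{{}} \<in> sets J"
    using sets_singleton_type[OF s P\<^sub>1] sets_singleton_type[OF t P\<^sub>2] sets_singleton_type[OF st J] by auto
  have atom: "{({}, {})} \<in> sets (P\<^sub>1 \<Otimes>\<^sub>M P\<^sub>2)" using pair_measureI[OF 1(1,2)] by simp
  have "emeasure (P\<^sub>1 \<Otimes>\<^sub>M P\<^sub>2) ({{}} \<times> {{}}) = emeasure P\<^sub>1 {{}} * emeasure P\<^sub>2 {{}}"
    by (rule sigma_finite_measure.emeasure_pair_measure_Times[OF T.sigma_finite[OF P\<^sub>2] 1(1,2)])
  then have prod: "measure (P\<^sub>1 \<Otimes>\<^sub>M P\<^sub>2) {({}, {})} = measure P\<^sub>1 {{}} * measure P\<^sub>2 {{}}"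
    by (simp add: measure_def enn2real_mult)
  have "?j -` {{}} \<inter> space (P\<^sub>1 \<Otimes>\<^sub>M P\<^sub>2) = {({}, {})}"
    using sets.sets_into_space[OF atom] by (auto simp: join_def)
  then have mJ: "measure J {{}} = measure P\<^sub>1 {{}} * measure P\<^sub>2 {{}}"
    using prod measure_distr[OF j sets_singleton_empty[OF st]] by (simp add: J_def join_law_def)
  have "f {} = f\<^sub>1 {} * f\<^sub>2 {}" if "measure P\<^sub>1 {{}} * measure P\<^sub>2 {{}} \<noteq> 0"
    using measure_singleton_AE[OF AE atom] that by (simp add: prod join_def)
  then show "void_coeff (s + t) \<psi> = void_coeff s \<psi>\<^sub>1 * void_coeff t \<psi>\<^sub>2"
    unfolding ST.atom_eq[OF \<psi> J f 1(3)] S.atom_eq[OF \<psi>\<^sub>1 P\<^sub>1 f\<^sub>1 1(1)] T.atom_eq[OF \<psi>\<^sub>2 P\<^sub>2 f\<^sub>2 1(2)] mJ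
    by (cases "measure P\<^sub>1 {{}} * measure P\<^sub>2 {{}} = 0") (auto simp: real_sqrt_mult)
qed

text \<open>
  Infinite level sets meet arbitrarily many cells; in this form the property involves countably many Borel
  conditions, so that it passes from paths to the law of the level set.
\<close>

lemma AE_many_cells:
  assumes t: "0 < t" and P: "P \<in> type t"
  shows "AE C in P. C = {} \<or> (\<forall>K. \<exists>N. \<forall>n\<ge>N. of_nat K \<le> cells (Suc n) (t / real (Suc n)) C)"
    (is "AE C in P. ?Q C")
proof -
  have [measurable]: "cells n h \<in> borel_measurable (closed_sets_space t)" for n h by (rule measurable_cells[OF t])
  have "{C \<in> space (closed_sets_space t). \<forall>K. \<exists>N. \<forall>n\<ge>N. of_nat K \<le> cells (Suc n) (t / real (Suc n)) C}
      \<in> sets (closed_sets_space t)" by measurable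
  then have "{{}} \<union> {C \<in> space (closed_sets_space t). \<forall>K. \<exists>N. \<forall>n\<ge>N. of_nat K \<le> cells (Suc n) (t / real (Suc n)) C}
      \<in> sets (closed_sets_space t)" using sets_singleton_empty[OF t] by (rule sets.Un[rotated])
  also have "{{}} \<union> {C \<in> space (closed_sets_space t). \<forall>K. \<exists>N. \<forall>n\<ge>N. of_nat K \<le> cells (Suc n) (t / real (Suc n)) C} =
      {C \<in> closed_subsets t. ?Q C}" using t by auto
  finally have "{C \<in> closed_subsets t. ?Q C} \<in> sets (closed_sets_space t)" .
  from AE_level_set_law_iff[OF t this, of 1]
  have "AE C in level_set_law M B t 1. ?Q C"
  proof (rule iffD2)
    show "AE \<omega> in M. ?Q {s\<in>{0..t}. B s \<omega> = 1}"
      using AE_level_set_empty_or_infinite[OF t one_neq_zero]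
    proof eventually_elim
      fix \<omega> assume h: "{s\<in>{0..t}. B s \<omega> = 1} = {} \<or> infinite {s\<in>{0..t}. B s \<omega> = 1}"
      have "{s\<in>{0..t}. B s \<omega> = 1} \<subseteq> {0..t}" by auto
      from cells_infinite[OF this _ t] h show "?Q {s\<in>{0..t}. B s \<omega> = 1}" by auto
    qed
  qed
  then show ?thesis
    using AE_equivalent_measures[of P "level_set_law M B t 1" ?Q] P t by (simp add: level_set_type_iff)
qed

lemma unit_factorizing:
  assumes u: "product_system_unit type u"
  shows "factorizing_measures (\<lambda>t. measure_class.square (type t) (u t))"
proof (rule factorizing_measures.intro)
  have L2: "u t \<in> L2_type (type t)" if "0 < t" for t using u that by (simp add: product_system_unit_def)
  fix t :: real assume t: "0 < t"
  interpret measure_class "type t" by (rule measure_class_type[OF t])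
  obtain P where P: "P \<in> type t" using nonempty by blast
  show "sets (square (u t)) = sets (closed_sets_space t)"
    using sets_square[OF L2[OF t] P] level_set_type_sets[OF P] by simp
  show "finite_measure (square (u t))" by (rule finite_measure_square[OF L2[OF t]])
  show "AE C in square (u t). 0 \<notin> C" by (rule AE_square[OF L2[OF t] P AE_level_set_type_zero[OF t P]])
next
  fix s t :: real assume s: "0 < s" and t: "0 < t"
  show "measure_class.square (type (s + t)) (u (s + t)) =
      distr (measure_class.square (type s) (u s) \<Otimes>\<^sub>M measure_class.square (type t) (u t))
        (closed_sets_space (s + t)) (\<lambda>(C, D). join s C D)"
    using u s t by (intro tensor_square_and_void_coeff) (auto simp: product_system_unit_def)
next
  obtain t where t: "0 < t" "u t \<noteq> L2_zero (type t)" and L2: "u t \<in> L2_type (type t)"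
    using u by (auto simp: product_system_unit_def)
  interpret measure_class "type t" by (rule measure_class_type[OF t(1)])
  have "emeasure (square (u t)) (closed_subsets t) \<noteq> 0"
  proof
    assume zero: "emeasure (square (u t)) (closed_subsets t) = 0"
    have "u t P = ae_class P (\<lambda>_. 0)" if P: "P \<in> type t" for P
    proof -
      obtain f where f: "f \<in> u t P" using L2_type_member[OF L2 P] by blast
      have sets: "sets (square (u t)) = sets (closed_sets_space t)"
        using sets_square[OF L2 P] level_set_type_sets[OF P] by simp
      have "space (square (u t)) = closed_subsets t" using sets_eq_imp_space_eq[OF sets] t(1) by simp
      then have "closed_subsets t \<in> null_sets (square (u t))"
        using zero sets.top[of "square (u t)"] by (auto simp: null_sets_def)
      then have "AE C in square (u t). C \<notin> closed_subsets t" by (rule AE_not_in)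
      then have "AE C in square (u t). False"
        using AE_space by eventually_elim (simp add: \<open>space (square (u t)) = closed_subsets t\<close>)
      then have "AE x in P. f x = 0 \<or> False" by (rule square_zero_imp[OF L2 P f])
      then have "AE x in P. f x = 0" by (simp only: simp_thms)
      then show ?thesis
        unfolding L2_typeD(3)[OF L2 P f] by (subst ae_class_eq_iff) (use L2_typeD(1)[OF L2 P f] in auto)
    qed
    then have "u t P = L2_zero (type t) P" if "P \<in> type t" for P using that by (simp add: L2_zero_def)
    moreover have "u t \<in> extensional (type t)" using L2 by (simp add: L2_type_def PiE_def)
    moreover have "L2_zero (type t) \<in> extensional (type t)" by (simp add: L2_zero_def)
    ultimately have "u t = L2_zero (type t)" by (rule extensionalityI[rotated 2])
    then show False using t(2) by simp
  qed
  then show "\<exists>t>0. emeasure (measure_class.square (type t) (u t)) (closed_subsets t) \<noteq> 0"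
    using t(1) by blast
qed

theorem unit_exponential:
  assumes u: "product_system_unit type u"
  shows "\<exists>l::complex. \<forall>t>0. u t =
    L2_scale (type t) (exp (\<i> * l * complex_of_real t)) (special_unit type t)"
proof -
  have L2: "u t \<in> L2_type (type t)" if "0 < t" for t using u that by (simp add: product_system_unit_def)
  let ?\<mu> = "\<lambda>t. measure_class.square (type t) (u t)"
  let ?g = "\<lambda>t. void_coeff t (u t)"
  interpret F: factorizing_measures ?\<mu> by (rule unit_factorizing[OF u])
  have empty: "AE C in ?\<mu> t. C = {}" if t: "0 < t" for t
  proof -
    interpret measure_class "type t" by (rule measure_class_type[OF t])
    obtain P where P: "P \<in> type t" using nonempty by blast
    show ?thesis by (rule F.AE_empty[OF t AE_square[OF L2[OF t] P AE_many_cells[OF t P]]])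
  qed
  have nz: "?g t \<noteq> 0" if t: "0 < t" for t
  proof -
    interpret measure_class "type t" by (rule measure_class_type[OF t])
    obtain P where P: "P \<in> type t" using nonempty by blast
    have "emeasure (square (u t)) {{}} \<noteq> 0" using F.emeasure_void[OF t] F.void_pos[OF t] by simp
    then show ?thesis using square_atom[OF L2[OF t] P sets_singleton_type[OF t P]] by auto
  qed
  have "\<exists>k. \<forall>t>0. ?g t = exp (k * complex_of_real t)"
  proof (rule measurable_multiplicative_exp)
    show "?g (s + t) = ?g s * ?g t" if "0 < s" "0 < t" for s t
      using u that L2 by (intro tensor_square_and_void_coeff(2)) (auto simp: product_system_unit_def)
    show "?g \<in> borel_measurable (restrict_space borel {0<..})"
      using u L2 by (intro measurable_void_coeff) (auto simp: product_system_unit_def)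
  qed (rule nz)
  then obtain k where k: "\<And>t. 0 < t \<Longrightarrow> ?g t = exp (k * complex_of_real t)" by blast
  have "u t = L2_scale (type t) (exp (\<i> * (- \<i> * k) * complex_of_real t)) (special_unit type t)" if t: "0 < t" for t
  proof (rule extensionalityI[of _ "type t"])
    interpret measure_class "type t" by (rule measure_class_type[OF t])
    show "u t \<in> extensional (type t)" using L2[OF t] by (auto simp: L2_type_def PiE_def)
    show "L2_scale (type t) (exp (\<i> * (- \<i> * k) * complex_of_real t)) (special_unit type t) \<in> extensional (type t)"
      by (simp add: L2_scale_def)
    fix P assume P: "P \<in> type t"
    obtain f where f: "f \<in> u t P" using L2_type_member[OF L2[OF t] P] by blast
    have m: "f \<in> borel_measurable P" using L2_typeD(1)[OF L2[OF t] P f] .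
    let ?v = "\<lambda>C. if C = {} then complex_of_real (1 / sqrt (measure P {{}})) else 0"
    have v: "?v \<in> borel_measurable P"
    proof (rule measurable_If)
      have "{C \<in> space P. C = {}} = {{}}"
        using sets.sets_into_space[OF sets_singleton_type[OF t P]] by auto
      then show "{C \<in> space P. C = {}} \<in> sets P" using sets_singleton_type[OF t P] by simp
    qed simp_all
    have g: "?g t = f {} * complex_of_real (sqrt (measure P {{}}))"
      by (rule atom_eq[OF L2[OF t] P f sets_singleton_type[OF t P]])
    then have "measure P {{}} \<noteq> 0" using nz[OF t] by auto
    then have f_void: "f {} = ?g t * complex_of_real (1 / sqrt (measure P {{}}))" unfolding g by simp
    have "AE C in P. f C = 0 \<or> C = {}" by (rule square_zero_imp[OF L2[OF t] P f empty[OF t]])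
    then have "AE C in P. f C = ?g t * ?v C" by eventually_elim (auto simp: f_void)
    moreover have "?g t = exp (\<i> * (- \<i> * k) * complex_of_real t)"
      using k[OF t] by (simp add: mult.assoc[symmetric])
    ultimately have "AE C in P. f C = exp (\<i> * (- \<i> * k) * complex_of_real t) * ?v C" by (simp only:)
    moreover have "L2_scale (type t) (exp (\<i> * (- \<i> * k) * complex_of_real t)) (special_unit type t) P =
        ae_class P (\<lambda>C. exp (\<i> * (- \<i> * k) * complex_of_real t) * ?v C)"
      by (rule L2_scale_eq[OF P v]) (simp add: special_unit_def P)
    ultimately show "u t P = L2_scale (type t) (exp (\<i> * (- \<i> * k) * complex_of_real t)) (special_unit type t) P"
      unfolding L2_typeD(3)[OF L2[OF t] P f] using m v by (simp only: ae_class_eq_iff borel_measurable_times borel_measurable_const)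
  qed
  then show ?thesis by blast
qed

end

theorem theorem2p1:
  fixes M :: "'w measure" and B :: "real \<Rightarrow> 'w \<Rightarrow> real"
    and u :: "real \<Rightarrow> real set half_density"
  assumes "standard_brownian_motion M B"
    and "product_system_unit (level_set_type M B) u"
  shows "\<exists>l::complex. \<forall>t>0. u t =
    L2_scale (level_set_type M B t) (exp (\<i> * l * complex_of_real t))
      (special_unit (level_set_type M B) t)"
  by (rule standard_brownian_motion.unit_exponential[OF assms])

end
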